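(* Consider the Markov chain produced by Algorithm 1 (defined in the context). (i) If $a>p/2$, the chain is geometrically ergodic. (ii) Suppose $a\le p/2$; that $a\notin\mathbb N=\{1,2,\dots\}$ if $p$ is even; that $a\notin\mathbb N-1/2=\{1/2,3/2,5/2,\dots\}$ if $p$ is odd; and that $$\frac{a}{p}>\log 2-\frac12 .$$ Then the chain is geometrically ergodic.
   Context: Let $n,p\ge 1$, $y\in\mathbb R^n$, $X\in\mathbb R^{n\times p}$ with $X^\top X$ invertible, $a',b'>0$, and $a,b,c>0$. Let $\pi_\tau(t)=t^{a-1}(c+t)^{-(a+b)}/C(a,b,c)$ for $t>0$, where $C(a,b,c)=\int_0^\infty t^{a-1}(c+t)^{-(a+b)}\,dt$ (a scaled three-parameter beta density). $\mathrm{IG}(\alpha,\beta)$ denotes the inverse gamma distribution with density $\beta^\alpha x^{-\alpha-1}e^{-\beta/x}/\Gamma(\alpha)$, $x>0$. For $v\in(0,\infty)^p$ put $\Psi(v)=\mathrm{diag}(1/v_1,\dots,1/v_p)$. Algorithm 1 is the Markov chain with state $(\beta,\sigma^2,\tilde\lambda^2,\tau^2,\nu)\in\mathbb R^p\times(0,\infty)\times(0,\infty)^p\times(0,\infty)\times(0,\infty)^p$, where $\tilde\lambda^2=(\tilde\lambda_1^2,\dots,\tilde\lambda_p^2)$ and $\nu=(\nu_1,\dots,\nu_p)$. One iteration, given the current $\tilde\lambda^2$ and with $\Psi=\Psi(\tilde\lambda^2)$, does: (1) draw $\sigma^2\sim\mathrm{IG}\big(n/2+a',\ \{\|y\|^2-y^\top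 X(X^\top X+\Psi)^{-1}X^\top y\}/2+b'\big)$, then $\beta\sim N_p\big((X^\top X+\Psi)^{-1}X^\top y,\ \sigma^2(X^\top X+\Psi)^{-1}\big)$; independently draw $\tau^2$ from the density on $(0,\infty)$ proportional to $t\mapsto \pi_\tau(t)\prod_{k=1}^p t^{1/2}/(\tilde\lambda_k^2+t)$, and then, independently for $k=1,\dots,p$, $\nu_k\sim\mathrm{IG}(1,\,1+\tau^2/\tilde\lambda_k^2)$; (2) independently for $k=1,\dots,p$, draw the new $\tilde\lambda_k^2\sim \mathrm{IG}\big(1,\ \beta_k^2/(2\sigma^2)+\tau^2/\nu_k\big)$. (This is a two-block Gibbs sampler for the posterior of the normal linear regression model $y_i\sim N(x_i^\top\beta,\sigma^2)$ with horseshoe prior, reparametrized by $\tilde\lambda_k^2=\tau^2\lambda_k^2$ and augmented with latent $\nu$.) *)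

theory Defs
  imports "HOL-Probability.Probability"
begin

definition ig_density :: "real \<Rightarrow> real \<Rightarrow> real \<Rightarrow> real" where
  "ig_density \<alpha> \<beta> x =
     (if x > 0 then \<beta> powr \<alpha> * x powr (-\<alpha> - 1) * exp (- \<beta> / x) / Gamma \<alpha> else 0)"

definition mvn_density :: "real^'p \<Rightarrow> real^'p^'p \<Rightarrow> real^'p \<Rightarrow> real" where
  "mvn_density \<mu> \<Sigma> x =
     exp (- ((x - \<mu>) \<bullet> (matrix_inv \<Sigma> *v (x - \<mu>))) / 2)
       / sqrt ((2 * pi) ^ CARD('p) * det \<Sigma>)"

definition C_abc :: "real \<Rightarrow> real \<Rightarrow> real \<Rightarrow> real" where
  "C_abc a b c = (\<integral>t. indicator {0<..} t * (t powr (a - 1) * (c + t) powr (-(a + b))) \<partial>lborel)"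

definition pi_tau :: "real \<Rightarrow> real \<Rightarrow> real \<Rightarrow> real \<Rightarrow> real" where
  "pi_tau a b c t = (if t > 0 then t powr (a - 1) * (c + t) powr (-(a + b)) / C_abc a b c else 0)"

text \<open>Unnormalised conditional density of tau^2 given lambda-tilde^2, and its normalisation.\<close>
definition tau_unnorm :: "real \<Rightarrow> real \<Rightarrow> real \<Rightarrow> real^'p \<Rightarrow> real \<Rightarrow> real" where
  "tau_unnorm a b c lam t =
     (if t > 0 then pi_tau a b c t * (\<Prod>k\<in>UNIV. t powr (1/2) / (lam $ k + t)) else 0)"

definition tau_density :: "real \<Rightarrow> real \<Rightarrow> real \<Rightarrow> real^'p \<Rightarrow> real \<Rightarrow> real" where
  "tau_density a b c lam t = tau_unnorm a b c lam t / (\<integral>s. tau_unnorm a b c lam s \<partial>lborel)"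

definition Psi :: "real^'p \<Rightarrow> real^'p^'p" where
  "Psi v = (\<chi> i j. if i = j then 1 / v $ i else 0)"

definition Amat :: "real^'p^'n \<Rightarrow> real^'p \<Rightarrow> real^'p^'p" where
  "Amat X lam = transpose X ** X + Psi lam"

text \<open>State (beta, sigma^2, lambda-tilde^2, tau^2, nu).\<close>
type_synonym ('p) state = "(real^'p) \<times> real \<times> (real^'p) \<times> real \<times> (real^'p)"

definition alg1_space :: "('p::finite) state set" where
  "alg1_space = {(\<beta>, s2, lam, t, nu). s2 > 0 \<and> (\<forall>k. lam $ k > 0) \<and> t > 0 \<and> (\<forall>k. nu $ k > 0)}"

text \<open>Joint density of the new state given the current lambda-tilde^2 = lam
  (steps (1) and (2) composed).\<close>
definition alg1_density ::
  "real^'n \<Rightarrow> real^'p^'n \<Rightarrow> real \<Rightarrow> real \<Rightarrow> real \<Rightarrow> real \<Rightarrow> real \<Rightarrow> real^'p \<Rightarrow> ('p::finite) state \<Rightarrow> real" where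
  "alg1_density y X a' b' a b c lam s' =
     (case s' of (\<beta>, s2, lam', t, nu) \<Rightarrow>
        let A = Amat X lam;
            Xty = transpose X *v y;
            shape = real CARD('n) / 2 + a';
            scale = (y \<bullet> y - Xty \<bullet> (matrix_inv A *v Xty)) / 2 + b'
        in ig_density shape scale s2
           * mvn_density (matrix_inv A *v Xty) (s2 *\<^sub>R matrix_inv A) \<beta>
           * tau_density a b c lam t
           * (\<Prod>k\<in>UNIV. ig_density 1 (1 + t / lam $ k) (nu $ k))
           * (\<Prod>k\<in>UNIV. ig_density 1 ((\<beta> $ k)\<^sup>2 / (2 * s2) + t / nu $ k) (lam' $ k)))"

text \<open>Markov transition kernel of Algorithm 1 (outside the state space it is
  taken to be the identity, which is irrelevant for the chain on alg1_space).\<close>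
definition alg1_kernel ::
  "real^'n \<Rightarrow> real^'p^'n \<Rightarrow> real \<Rightarrow> real \<Rightarrow> real \<Rightarrow> real \<Rightarrow> real \<Rightarrow> ('p::finite) state \<Rightarrow> 'p state measure" where
  "alg1_kernel y X a' b' a b c s =
     (if s \<in> alg1_space
      then density lborel (\<lambda>s'. ennreal (alg1_density y X a' b' a b c (fst (snd (snd s))) s'))
      else return borel s)"

fun kstep :: "('s::topological_space \<Rightarrow> 's measure) \<Rightarrow> nat \<Rightarrow> 's \<Rightarrow> 's measure" where
  "kstep K 0 x = return borel x"
| "kstep K (Suc m) x = bind (kstep K m x) K"

definition tv_dist :: "'s::topological_space measure \<Rightarrow> 's measure \<Rightarrow> real" where
  "tv_dist M N = (SUP A \<in> sets borel. \<bar>measure M A - measure N A\<bar>)"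

definition geom_ergodic :: "'s::topological_space set \<Rightarrow> ('s \<Rightarrow> 's measure) \<Rightarrow> bool" where
  "geom_ergodic S K \<longleftrightarrow>
     (\<exists>Q. prob_space Q \<and> sets Q = sets borel \<and>
        (\<exists>\<rho> M. 0 \<le> \<rho> \<and> \<rho> < 1 \<and>
           (\<forall>x\<in>S. \<forall>m. tv_dist (kstep K m x) Q \<le> M x * \<rho> ^ m)))"

end

(* The new local scales depend on the state only through the current ones, written lam, so it
   suffices to find a Lyapunov function of lam that satisfies the hypotheses of Harris' theorem:
   a geometric drift, and a minorization on sublevel sets. We take
     V = sum_k (lam_k^(-d) + lam_k^d)   with a small d > 0.
   With u_k = t / (t + lam_k), where t is the global scale, the new lam_k is
   (beta_k^2 / (2 sigma^2) + u_k lam_k E') / E with independent standard exponentials E, E'.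
   Near lam_k = 0 the first term behaves at worst like lam_k times a Gamma(1/2) variable, and to
   first order in d the factor multiplying lam_k^(-d) is at most 1 - 2 d (mean of u_k - ln 2).
   Integrating by parts in the density of t gives
     sum_k mean of u_k = a + p/2 - (a+b) * mean of t / (c + t),
   and u_k decreases in lam_k, so by Chebyshev's sum inequality the mean of u_k weighted by
   lam_k^(-d) is essentially at least min 1 (a/p + 1/2), which exceeds ln 2. The same identity
   controls the positive powers. The minorization comes from explicit lower bounds of the
   density on a box. *)
theory Submission
  imports Defs
begin

section \<open>Harris' theorem\<close>

text \<open>The critical regime is \<open>lam_k\<close> near 0, and two reductions keep the estimate
  there independent of the data and of the joint law of the coordinates. First, the Laplace
  transform of \<open>beta_k^2 / (2 sigma^2)\<close> is largest for a centred Gaussian whose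
  variance is the conditional one, so the posterior mean and the posterior correlations drop out and
  only the k-th diagonal entry of the precision matrix is left. Second, the bound on the Laplace
  transform of \<open>t / nu_k\<close> is affine in \<open>u_k\<close>; hence the law of
  \<open>t\<close>, which couples all coordinates, enters only through the means of the
  \<open>u_k\<close>. The obstacle is the negative term of the identity for these means: it is not
  small when the law of \<open>t\<close> has mass far from 0. For such \<open>t\<close>, however,
  the \<open>u_k\<close> that belong to tiny \<open>lam_k\<close> are close to 1. A slowly decaying
  weight in \<open>t\<close> separates the two situations and produces the minimum of 1 and
  \<open>a/p + 1/2\<close>. The margin above \<open>ln 2\<close> does not depend on the exponent
  \<open>d\<close>, so a first order expansion in \<open>d\<close> suffices to choose it.\<close>

lemma geometric_increments_limit:
  fixes F :: "nat \<Rightarrow> real"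
  assumes inc: "\<And>m. \<bar>F (Suc m) - F m\<bar> \<le> c * \<alpha> ^ m" and \<alpha>: "0 \<le> \<alpha>" "\<alpha> < 1"
  obtains q where "F \<longlonglongrightarrow> q" "\<And>m. \<bar>F m - q\<bar> \<le> c / (1 - \<alpha>) * \<alpha> ^ m"
proof -
  have cg: "(\<lambda>k. c * \<alpha> ^ (m + k)) sums (c / (1 - \<alpha>) * \<alpha> ^ m)" for m
    using sums_mult[OF geometric_sums[of \<alpha>], of "c * \<alpha> ^ m"] \<alpha> by (simp add: power_add mult_ac)
  have sm: "summable (\<lambda>k. \<bar>F (Suc (m + k)) - F (m + k)\<bar>)" for m
    by (rule summable_comparison_test[OF _ sums_summable[OF cg[of m]]]) (use inc in auto)
  have s0: "summable (\<lambda>k. F (Suc k) - F k)"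
    by (rule summable_rabs_cancel) (use sm[of 0] in simp)
  define q where "q = F 0 + (\<Sum>k. F (Suc k) - F k)"
  have lim: "F \<longlonglongrightarrow> q"
  proof -
    have "(\<lambda>n. F 0 + (\<Sum>k<n. F (Suc k) - F k)) \<longlonglongrightarrow> q"
      unfolding q_def by (intro tendsto_add tendsto_const summable_LIMSEQ s0)
    then show ?thesis by (simp add: sum_lessThan_telescope)
  qed
  have "\<bar>F m - q\<bar> \<le> c / (1 - \<alpha>) * \<alpha> ^ m" for m
  proof -
    have sh: "(\<lambda>k. F (m + k)) \<longlonglongrightarrow> q"
      using LIMSEQ_ignore_initial_segment[OF lim, of m] by (simp add: add.commute)
    have "(\<lambda>k. F (Suc (m + k)) - F (m + k)) sums (q - F m)"
      using telescope_sums[OF sh] by simp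
    then have "q - F m = (\<Sum>k. F (Suc (m + k)) - F (m + k))" by (rule sums_unique)
    then have "\<bar>q - F m\<bar> \<le> (\<Sum>k. \<bar>F (Suc (m + k)) - F (m + k)\<bar>)"
      using summable_rabs[OF sm[of m]] by simp
    also have "\<dots> \<le> (\<Sum>k. c * \<alpha> ^ (m + k))"
      by (intro suminf_le sm sums_summable[OF cg] inc)
    also have "\<dots> = c / (1 - \<alpha>) * \<alpha> ^ m" by (rule sums_unique[OF cg, symmetric])
    finally show ?thesis by (simp add: abs_minus_commute)
  qed
  with lim that show thesis by blast
qed

text \<open>The minorizing measure \<nu> is neither normalised nor assumed finite. If some point of
  \<open>S\<close> lies in the sublevel set, domination by a probability measure makes its mass at
  most 1; otherwise the condition on it is void. Drift and minorization concern points of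
  \<open>S\<close> only, so the kernel may do anything elsewhere.\<close>

locale harris_kernel =
  fixes S :: "'s::topological_space set" and K :: "'s \<Rightarrow> 's measure"
    and V :: "'s \<Rightarrow> real" and \<gamma> C :: real
  assumes K[measurable]: "K \<in> borel \<rightarrow>\<^sub>M subprob_algebra borel"
    and S[measurable]: "S \<in> sets borel"
    and KS: "\<And>x. x \<in> S \<Longrightarrow> emeasure (K x) S = 1"
    and V[measurable]: "V \<in> borel_measurable borel" and V0: "\<And>x. 0 \<le> V x"
    and drift: "\<And>x. x \<in> S \<Longrightarrow> (\<integral>\<^sup>+z. ennreal (V z) \<partial>K x) \<le> ennreal (\<gamma> * V x + C)"
    and \<gamma>: "0 \<le> \<gamma>" "\<gamma> < 1" and C: "0 \<le> C"
    and minor: "\<And>R. \<exists>\<nu>. sets \<nu> = sets borel \<and> 0 < emeasure \<nu> UNIV \<and>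
        (\<forall>x\<in>S. V x \<le> R \<longrightarrow> (\<forall>f \<in> borel_measurable borel. (\<integral>\<^sup>+z. f z \<partial>\<nu>) \<le> (\<integral>\<^sup>+z. f z \<partial>K x)))"
begin

lemma sets_K[measurable_cong, simp]: "sets (K x) = sets borel"
  by (rule sets_kernel[OF K]) simp

lemma space_K[simp]: "space (K x) = UNIV"
  using sets_eq_imp_space_eq[OF sets_K] by simp

lemma prob_K: assumes "x \<in> S" shows "prob_space (K x)"
proof (rule prob_spaceI)
  have "emeasure (K x) (space (K x)) \<le> 1"
    by (rule subprob_space.emeasure_space_le_1[OF subprob_space_kernel[OF K]]) simp
  moreover have "1 \<le> emeasure (K x) (space (K x))"
    using KS[OF assms] emeasure_mono[of S "space (K x)" "K x"] by simp
  ultimately show "emeasure (K x) (space (K x)) = 1" by simp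
qed

lemma AE_S: assumes "x \<in> S" shows "AE z in K x. z \<in> S"
proof -
  interpret prob_space "K x" by (rule prob_K[OF assms])
  show ?thesis using KS[OF assms] by (subst AE_in_set_eq_1) (simp_all add: emeasure_eq_measure)
qed

lemma V_integrable:
  assumes "x \<in> S" shows "integrable (K x) V" "(\<integral>z. V z \<partial>K x) \<le> \<gamma> * V x + C"
proof -
  have fin: "(\<integral>\<^sup>+z. ennreal (V z) \<partial>K x) < \<infinity>"
    using le_less_trans[OF drift[OF assms]] by simp
  then show "integrable (K x) V" by (intro integrableI_nonneg) (auto simp: V0)
  show "(\<integral>z. V z \<partial>K x) \<le> \<gamma> * V x + C"
    using enn2real_mono[OF drift[OF assms]] \<gamma> C V0[of x]
    by (subst integral_eq_nn_integral) (auto simp: V0 simp del: ennreal_plus)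
qed

lemma bounded_integrable:
  fixes f :: "'s \<Rightarrow> real"
  assumes "x \<in> S" "f \<in> borel_measurable borel" "\<And>z. \<bar>f z\<bar> \<le> B"
  shows "integrable (K x) f"
proof -
  interpret prob_space "K x" by (rule prob_K[OF assms(1)])
  show ?thesis using assms by (intro integrable_const_bound[where B = B]) auto
qed

text \<open>The minorization speaks of nonnegative functions on the whole space, whereas the
  functions used below have a sign only on \<open>S\<close>. Replacing \<open>h\<close> by its
  positive part changes nothing almost surely under \<open>K x\<close>, and can only increase the
  integral under \<nu>, which may charge the complement of \<open>S\<close>.\<close>

lemma minorant_integral_le:
  fixes h :: "'s \<Rightarrow> real"
  assumes x: "x \<in> S" and \<nu>: "sets \<nu> = sets borel"
    and le: "\<And>f. f \<in> borel_measurable borel \<Longrightarrow> (\<integral>\<^sup>+z. f z \<partial>\<nu>) \<le> (\<integral>\<^sup>+z. f z \<partial>K x)"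
    and h[measurable]: "h \<in> borel_measurable borel" and int: "integrable (K x) h"
  shows "integrable \<nu> h" "(\<And>z. z \<in> S \<Longrightarrow> 0 \<le> h z) \<Longrightarrow> (\<integral>z. h z \<partial>\<nu>) \<le> (\<integral>z. h z \<partial>K x)"
proof -
  note [measurable_cong] = \<nu>
  have fin: "(\<integral>\<^sup>+z. ennreal \<bar>h z\<bar> \<partial>K x) < \<infinity>"
    using int by (simp add: integrable_iff_bounded)
  show iv: "integrable \<nu> h"
    unfolding integrable_iff_bounded using le_less_trans[OF le fin] by simp
  assume pos: "\<And>z. z \<in> S \<Longrightarrow> 0 \<le> h z"
  have "(\<integral>z. h z \<partial>\<nu>) \<le> (\<integral>z. max 0 (h z) \<partial>\<nu>)"
    by (intro integral_mono iv integrable_max) auto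
  also have "\<dots> = enn2real (\<integral>\<^sup>+z. ennreal (max 0 (h z)) \<partial>\<nu>)"
    by (rule integral_eq_nn_integral) auto
  also have "\<dots> \<le> enn2real (\<integral>\<^sup>+z. ennreal (max 0 (h z)) \<partial>K x)"
  proof (rule enn2real_mono[OF le])
    have "(\<integral>\<^sup>+z. ennreal (max 0 (h z)) \<partial>K x) \<le> (\<integral>\<^sup>+z. ennreal \<bar>h z\<bar> \<partial>K x)"
      by (intro nn_integral_mono) (auto intro!: ennreal_leI)
    then show "(\<integral>\<^sup>+z. ennreal (max 0 (h z)) \<partial>K x) < top" using fin by simp
  qed simp
  also have "\<dots> = (\<integral>z. max 0 (h z) \<partial>K x)"
    by (rule integral_eq_nn_integral[symmetric]) auto
  also have "\<dots> = (\<integral>z. h z \<partial>K x)"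
    using AE_S[OF x] by (intro integral_cong_AE) (auto simp: pos max_absorb2 elim!: AE_mp)
  finally show "(\<integral>z. h z \<partial>\<nu>) \<le> (\<integral>z. h z \<partial>K x)" .
qed

text \<open>One step contracts the oscillation weighted by \<open>2 + \<beta> * (V x + V y)\<close>; centring
  \<open>f\<close> by a constant turns the two-point bound into the one-point bound by \<open>1 + \<beta> * V\<close>.\<close>

lemma contraction:
  obtains \<alpha> \<beta> where "0 \<le> \<alpha>" "\<alpha> < 1" "0 < \<beta>"
    "\<And>f B D x y. \<lbrakk>f \<in> borel_measurable borel; \<And>z. \<bar>f z\<bar> \<le> B; 0 \<le> D;
        \<And>x y. \<lbrakk>x \<in> S; y \<in> S\<rbrakk> \<Longrightarrow> f x - f y \<le> D * (2 + \<beta> * (V x + V y)); x \<in> S; y \<in> S\<rbrakk>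
      \<Longrightarrow> (\<integral>z. f z \<partial>K x) - (\<integral>z. f z \<partial>K y) \<le> \<alpha> * D * (2 + \<beta> * (V x + V y))"
proof -
  \<comment> \<open>Beyond this level of \<open>V x + V y\<close> the drift yields the factor
    \<open>(1 + \<gamma>) / 2\<close> and still leaves a surplus of 1, which pays for shrinking the
    constant part of the weight.\<close>
  define R where "R = 2 * (2 * C + 1) / (1 - \<gamma>)"
  from minor[of R] obtain \<nu> where \<nu>[measurable_cong]: "sets \<nu> = sets borel" and \<nu>0: "0 < emeasure \<nu> UNIV"
    and \<nu>K: "\<And>x f. x \<in> S \<Longrightarrow> V x \<le> R \<Longrightarrow> f \<in> borel_measurable borel \<Longrightarrow> (\<integral>\<^sup>+z. f z \<partial>\<nu>) \<le> (\<integral>\<^sup>+z. f z \<partial>K x)"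
    by blast
  have sp: "space \<nu> = UNIV" using sets_eq_imp_space_eq[OF \<nu>] by simp
  define \<epsilon> where "\<epsilon> = min 1 (measure \<nu> UNIV)"
  \<comment> \<open>Small enough that \<open>\<beta> * C\<close> uses up at most half of the mass
    \<epsilon> gained from the minorization. An infinite \<nu> has \<open>measure\<close> 0; then no
    pair lies below level \<open>R\<close>, and 1 is a dummy value.\<close>
  define \<beta> where "\<beta> = (if \<epsilon> > 0 then \<epsilon> else 1) / (2 * C + 1)"
  \<comment> \<open>The entries control, in this order, the \<open>V\<close> part for all pairs, the
    constant part for pairs above level \<open>R\<close>, and the constant part for pairs below
    it.\<close>
  define \<alpha> where "\<alpha> = Max {(1 + \<gamma>) / 2, 1 - \<beta> / 2, 1 - (if \<epsilon> > 0 then \<epsilon> else 1) / 2}"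
  have \<epsilon>1: "0 \<le> \<epsilon>" "\<epsilon> \<le> 1" by (auto simp: \<epsilon>_def)
  have \<beta>: "0 < \<beta>" using C \<epsilon>1 by (auto simp: \<beta>_def)
  have \<alpha>: "0 \<le> \<alpha>" "\<alpha> < 1" using \<gamma> \<beta> \<epsilon>1 by (auto simp: \<alpha>_def max_def)
  have \<alpha>_ge: "(1 + \<gamma>) / 2 \<le> \<alpha>" "1 - \<beta> / 2 \<le> \<alpha>" "\<epsilon> > 0 \<Longrightarrow> 1 - \<epsilon> / 2 \<le> \<alpha>"
    by (auto simp: \<alpha>_def)
  have main: "(\<integral>z. f z \<partial>K x) - (\<integral>z. f z \<partial>K y) \<le> \<alpha> * D * (2 + \<beta> * (V x + V y))"
    if f[measurable]: "f \<in> borel_measurable borel" and B: "\<And>z. \<bar>f z\<bar> \<le> B" and D: "0 \<le> D"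
      and osc: "\<And>x y. \<lbrakk>x \<in> S; y \<in> S\<rbrakk> \<Longrightarrow> f x - f y \<le> D * (2 + \<beta> * (V x + V y))"
      and x: "x \<in> S" and y: "y \<in> S" for f B D x y
  proof -
    interpret Kx: prob_space "K x" by (rule prob_K[OF x])
    interpret Ky: prob_space "K y" by (rule prob_K[OF y])
    define W where "W z = D * (1 + \<beta> * V z)" for z
    have [measurable]: "W \<in> borel_measurable borel" unfolding W_def[abs_def] by measurable
    have W0: "0 \<le> W z" for z using D \<beta> V0[of z] by (simp add: W_def)
    define c where "c = (SUP z\<in>S. f z - W z)"
    have bdd: "bdd_above ((\<lambda>z. f z - W z) ` S)"
      by (rule bdd_aboveI2[where M = B]) (use B W0 in \<open>smt (verit)\<close>)
    define g where "g z = f z - c" for z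
    have [measurable]: "g \<in> borel_measurable borel" unfolding g_def[abs_def] by measurable
    have gW: "g z \<le> W z" if "z \<in> S" for z
      using cSUP_upper[OF that bdd] by (simp add: g_def c_def)
    have gW': "- g z \<le> W z" if "z \<in> S" for z
    proof -
      have "c \<le> f z + W z"
        unfolding c_def
      proof (rule cSUP_least)
        show "S \<noteq> {}" using x by auto
        show "f w - W w \<le> f z + W z" if "w \<in> S" for w
          using osc[OF that \<open>z \<in> S\<close>] by (simp add: W_def algebra_simps)
      qed
      then show ?thesis by (simp add: g_def)
    qed
    have fi: "integrable (K w) f" if "w \<in> S" for w using bounded_integrable[OF that f B] .
    have gi: "integrable (K w) g" "(\<integral>z. g z \<partial>K w) = (\<integral>z. f z \<partial>K w) - c" if "w \<in> S" for w
    proof -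
      interpret prob_space "K w" by (rule prob_K[OF that])
      show "integrable (K w) g" "(\<integral>z. g z \<partial>K w) = (\<integral>z. f z \<partial>K w) - c"
        using fi[OF that] prob_space by (auto simp: g_def[abs_def])
    qed
    have Wi: "integrable (K w) W" "(\<integral>z. W z \<partial>K w) \<le> D * (1 + \<beta> * (\<gamma> * V w + C))" if "w \<in> S" for w
    proof -
      interpret prob_space "K w" by (rule prob_K[OF that])
      note Vi = V_integrable[OF that]
      show "integrable (K w) W" unfolding W_def using Vi(1) by simp
      have "(\<integral>z. W z \<partial>K w) = D * (1 + \<beta> * (\<integral>z. V z \<partial>K w))"
        unfolding W_def using Vi prob_space by simp
      also have "\<dots> \<le> D * (1 + \<beta> * (\<gamma> * V w + C))"
        using Vi(2) D \<beta> by (intro mult_left_mono add_left_mono) auto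
      finally show "(\<integral>z. W z \<partial>K w) \<le> D * (1 + \<beta> * (\<gamma> * V w + C))" .
    qed
    have diff: "(\<integral>z. f z \<partial>K x) - (\<integral>z. f z \<partial>K y) = (\<integral>z. g z \<partial>K x) - (\<integral>z. g z \<partial>K y)"
      using gi[OF x] gi[OF y] by simp
    define T where "T = V x + V y"
    have T0: "0 \<le> T" using V0[of x] V0[of y] by (simp add: T_def)
    have WW: "(\<integral>z. W z \<partial>K x) + (\<integral>z. W z \<partial>K y) \<le> D * (2 + \<beta> * (\<gamma> * T + 2 * C))"
      using Wi(2)[OF x] Wi(2)[OF y] by (simp add: T_def algebra_simps)
    show ?thesis
    proof (cases "T \<le> R")
      case False
      have 1: "(\<integral>z. g z \<partial>K x) \<le> (\<integral>z. W z \<partial>K x)"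
        using AE_S[OF x] by (intro integral_mono_AE gi Wi x) (auto elim!: AE_mp simp: gW)
      have "(\<integral>z. - g z \<partial>K y) \<le> (\<integral>z. W z \<partial>K y)"
        using AE_S[OF y] by (intro integral_mono_AE integrable_minus gi Wi y) (auto elim!: AE_mp simp: gW')
      then have 2: "- (\<integral>z. g z \<partial>K y) \<le> (\<integral>z. W z \<partial>K y)" by simp
      have "2 * C + 1 \<le> (1 - \<gamma>) / 2 * T"
        using False \<gamma> by (simp add: R_def field_simps)
      then have "\<gamma> * T + 2 * C \<le> (1 + \<gamma>) / 2 * T - 1" by (simp add: field_simps)
      then have "2 + \<beta> * (\<gamma> * T + 2 * C) \<le> 2 + \<beta> * ((1 + \<gamma>) / 2 * T - 1)"
        using \<beta> by simp
      also have "\<dots> = 2 * (1 - \<beta> / 2) + \<beta> * T * ((1 + \<gamma>) / 2)" by (simp add: algebra_simps)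
      also have "\<dots> \<le> 2 * \<alpha> + \<beta> * T * \<alpha>"
        using \<alpha>_ge \<beta> T0 by (intro add_mono mult_left_mono) auto
      finally have "D * (2 + \<beta> * (\<gamma> * T + 2 * C)) \<le> D * (2 * \<alpha> + \<beta> * T * \<alpha>)"
        using D by (intro mult_left_mono)
      then show ?thesis using 1 2 WW diff by (simp add: T_def algebra_simps)
    next
      case True
      then have VR: "V x \<le> R" "V y \<le> R" using V0[of x] V0[of y] by (auto simp: T_def)
      have "emeasure \<nu> UNIV \<le> emeasure (K x) UNIV"
        using \<nu>K[OF x VR(1), of "\<lambda>_. 1"] sp by simp
      also have "\<dots> = 1" using Kx.emeasure_space_1 by simp
      finally have \<nu>le: "emeasure \<nu> UNIV \<le> 1" .
      interpret \<nu>: finite_measure \<nu> by (rule finite_measureI) (use \<nu>le sp in \<open>auto simp: top_unique\<close>)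
      have \<epsilon>: "\<epsilon> = measure \<nu> UNIV" "0 < \<epsilon>"
        using \<nu>le \<nu>0 by (auto simp: \<epsilon>_def \<nu>.emeasure_eq_measure)
      have Wx: "integrable \<nu> W"
        by (rule minorant_integral_le(1)[OF x \<nu> \<nu>K[OF x VR(1)] _ Wi(1)[OF x]]) auto
      have gx: "integrable \<nu> g"
        by (rule minorant_integral_le(1)[OF x \<nu> \<nu>K[OF x VR(1)] _ gi(1)[OF x]]) auto
      \<comment> \<open>Both \<open>W - g\<close> and \<open>W + g\<close> are nonnegative on
        \<open>S\<close>, so each of the two kernels may be compared with \<nu> on one of them. In
        the sum of the two inequalities \<open>g\<close> cancels under \<nu>, and a gain of twice
        the \<nu>-integral of \<open>W\<close> remains.\<close>
      have "(\<integral>z. W z - g z \<partial>\<nu>) \<le> (\<integral>z. W z - g z \<partial>K x)"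
        by (rule minorant_integral_le(2)[OF x \<nu> \<nu>K[OF x VR(1)]]) (auto intro!: Wi gi x simp: gW)
      moreover have "(\<integral>z. W z + g z \<partial>\<nu>) \<le> (\<integral>z. W z + g z \<partial>K y)"
        by (rule minorant_integral_le(2)[OF y \<nu> \<nu>K[OF y VR(2)]])
          (use gW' in \<open>force intro!: Wi gi y\<close>)+
      ultimately have *: "(\<integral>z. g z \<partial>K x) - (\<integral>z. g z \<partial>K y)
          \<le> (\<integral>z. W z \<partial>K x) + (\<integral>z. W z \<partial>K y) - 2 * (\<integral>z. W z \<partial>\<nu>)"
        using Wx gx Wi(1)[OF x] Wi(1)[OF y] gi(1)[OF x] gi(1)[OF y] by simp
      have "D * \<epsilon> = (\<integral>z. D \<partial>\<nu>)" by (simp add: \<epsilon> sp)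
      also have "\<dots> \<le> (\<integral>z. W z \<partial>\<nu>)"
        using D \<beta> V0 by (intro integral_mono Wx) (auto simp: W_def algebra_simps)
      finally have "(\<integral>z. g z \<partial>K x) - (\<integral>z. g z \<partial>K y) \<le> D * (2 + \<beta> * (\<gamma> * T + 2 * C)) - 2 * (D * \<epsilon>)"
        using * WW by simp
      also have "\<dots> = D * (2 * (1 - \<epsilon> + \<beta> * C) + \<beta> * T * \<gamma>)" by (simp add: algebra_simps)
      also have "\<dots> \<le> D * (2 * \<alpha> + \<beta> * T * \<alpha>)"
      proof (intro mult_left_mono add_mono D)
        have "\<beta> * C \<le> \<epsilon> / 2" using C \<epsilon> by (simp add: \<beta>_def field_simps)
        then show "1 - \<epsilon> + \<beta> * C \<le> \<alpha>" using \<alpha>_ge(3)[OF \<epsilon>(2)] by simp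
        show "\<gamma> \<le> \<alpha>" using \<alpha>_ge(1) \<gamma> by simp
      qed (use \<beta> T0 in auto)
      finally show ?thesis using diff by (simp add: T_def algebra_simps)
    qed
  qed
  show thesis by (rule that[OF \<alpha> \<beta>]) (rule main)
qed

section \<open>Iterates of the kernel and their limit law\<close>

lemma kstep_measurable[measurable]: "kstep K m \<in> borel \<rightarrow>\<^sub>M subprob_algebra borel"
proof (induction m)
  case 0 show ?case by (simp add: return_measurable cong: measurable_cong)
next
  case (Suc m)
  then show ?case by (simp add: measurable_bind2[OF Suc K] cong: measurable_cong)
qed

lemma sets_kstep[simp]: "sets (kstep K m x) = sets borel"
  by (rule sets_kernel[OF kstep_measurable]) simp

text \<open>\<open>kstep\<close> appends the new step at the end, while the contraction acts on the
  first step out of the starting point; associativity of \<open>bind\<close> moves it there.\<close>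

lemma kstep_Suc: "kstep K (Suc m) x = bind (K x) (kstep K m)"
proof (induction m)
  case 0
  have "bind (K x) (\<lambda>z. return borel z) = K x"
    using bind_return''[of "K x" borel] by (simp add: fun_eq_iff[symmetric])
  then show ?case using bind_return[OF K, of x] by (simp add: fun_eq_iff[symmetric])
next
  case (Suc m)
  have "kstep K (Suc (Suc m)) x = bind (bind (K x) (kstep K m)) K" using Suc by simp
  also have "\<dots> = bind (K x) (\<lambda>z. bind (kstep K m z) K)"
    by (rule bind_assoc[where N = borel and R = borel]) (auto cong: measurable_cong_sets)
  also have "(\<lambda>z. bind (kstep K m z) K) = kstep K (Suc m)" by auto
  finally show ?case .
qed

lemma subprob_kstep: "subprob_space (kstep K m x)"
  by (rule subprob_space_kernel[OF kstep_measurable]) simp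

lemma measure_kstep_Suc:
  assumes x: "x \<in> S" and A[measurable]: "A \<in> sets borel"
  shows "measure (kstep K (Suc m) x) A = (\<integral>z. measure (kstep K m z) A \<partial>K x)"
proof -
  have "emeasure (kstep K (Suc m) x) A = (\<integral>\<^sup>+z. emeasure (kstep K m z) A \<partial>K x)"
    unfolding kstep_Suc by (rule emeasure_bind[where N = borel]) (auto cong: measurable_cong_sets)
  also have "\<dots> = (\<integral>\<^sup>+z. ennreal (measure (kstep K m z) A) \<partial>K x)"
    by (intro nn_integral_cong finite_measure.emeasure_eq_measure subprob_space.axioms(1) subprob_kstep)
  finally show ?thesis
    by (subst integral_eq_nn_integral) (auto simp: measure_def)
qed

lemma measure_kstep_UNIV: "x \<in> S \<Longrightarrow> measure (kstep K m x) UNIV = 1"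
proof (induction m arbitrary: x)
  case 0 show ?case by (simp add: measure_return)
next
  case (Suc m)
  interpret prob_space "K x" by (rule prob_K[OF Suc.prems])
  have "(\<integral>w. measure (kstep K m w) UNIV \<partial>K x) = (\<integral>w. 1 \<partial>K x)"
    using AE_S[OF Suc.prems] by (intro integral_cong_AE) (auto elim!: AE_mp simp: Suc.IH)
  then show ?case using measure_kstep_Suc[OF Suc.prems, of UNIV m] prob_space
    by (simp del: kstep.simps)
qed

text \<open>As a function of its starting point, the m-step probability of a fixed set has weighted
  oscillation of order \<alpha>^m. Comparing the starting point with the position after one step
  shows that these probabilities form a Cauchy sequence in m, at a geometric rate that is uniform
  over all Borel sets. The limit from one reference point \<open>x0\<close> is the desired law, and
  any other starting point is compared with \<open>x0\<close>.\<close>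

theorem geom_ergodic:
  assumes "S \<noteq> {}"
  shows "geom_ergodic S K"
proof -
  obtain \<alpha> \<beta> where \<alpha>: "0 \<le> \<alpha>" "\<alpha> < 1" and \<beta>: "0 < \<beta>" and
    contr: "\<And>f B D x y. \<lbrakk>f \<in> borel_measurable borel; \<And>z. \<bar>f z\<bar> \<le> B; 0 \<le> D;
        \<And>x y. \<lbrakk>x \<in> S; y \<in> S\<rbrakk> \<Longrightarrow> f x - f y \<le> D * (2 + \<beta> * (V x + V y)); x \<in> S; y \<in> S\<rbrakk>
      \<Longrightarrow> (\<integral>z. f z \<partial>K x) - (\<integral>z. f z \<partial>K y) \<le> \<alpha> * D * (2 + \<beta> * (V x + V y))"
    using contraction by blast
  define p where "p m A x = measure (kstep K m x) A" for m A x
  have p_meas[measurable]: "p m A \<in> borel_measurable borel" if [measurable]: "A \<in> sets borel" for m A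
    unfolding p_def by measurable
  have p01: "0 \<le> p m A x" "p m A x \<le> 1" for m A x
    by (auto simp: p_def intro: subprob_space.subprob_measure_le_1[OF subprob_kstep])
  have p_osc: "p m A x - p m A y \<le> \<alpha> ^ m * (2 + \<beta> * (V x + V y))"
    if A: "A \<in> sets borel" and "x \<in> S" "y \<in> S" for m A x y
    using that(2,3)
  proof (induction m arbitrary: x y)
    case 0
    have "p 0 A x - p 0 A y \<le> 1" using p01(1)[of 0 A y] p01(2)[of 0 A x] by linarith
    also have "\<dots> \<le> 2 + \<beta> * (V x + V y)" using \<beta> V0[of x] V0[of y] by simp
    finally show ?case by simp
  next
    case (Suc m)
    have "(\<integral>z. p m A z \<partial>K x) - (\<integral>z. p m A z \<partial>K y) \<le> \<alpha> * \<alpha> ^ m * (2 + \<beta> * (V x + V y))"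
      by (rule contr[where B = 1]) (use p01 A Suc \<alpha> in auto)
    then show ?case using measure_kstep_Suc[OF _ A] Suc.prems by (simp add: p_def del: kstep.simps)
  qed
  define M0 where "M0 x = 2 + \<beta> * (V x + (\<gamma> * V x + C))" for x
  have p_inc: "\<bar>p (Suc m) A x - p m A x\<bar> \<le> M0 x * \<alpha> ^ m" if A: "A \<in> sets borel" and x: "x \<in> S" for m A x
  proof -
    interpret prob_space "K x" by (rule prob_K[OF x])
    have pi: "integrable (K x) (p m A)" by (rule bounded_integrable[OF x p_meas[OF A], where B = 1]) (use p01 in auto)
    note Vi = V_integrable[OF x]
    have "p (Suc m) A x = (\<integral>z. p m A z \<partial>K x)"
      using measure_kstep_Suc[OF x A] by (simp add: p_def del: kstep.simps)
    then have "p (Suc m) A x - p m A x = (\<integral>z. p m A z - p m A x \<partial>K x)"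
      using pi prob_space by simp
    also have "\<bar>\<dots>\<bar> \<le> (\<integral>z. \<bar>p m A z - p m A x\<bar> \<partial>K x)" by (rule integral_abs_bound)
    also have "\<dots> \<le> (\<integral>z. \<alpha> ^ m * (2 + \<beta> * (V x + V z)) \<partial>K x)"
    proof (rule integral_mono_AE)
      show "AE z in K x. \<bar>p m A z - p m A x\<bar> \<le> \<alpha> ^ m * (2 + \<beta> * (V x + V z))"
        using AE_S[OF x]
      proof (rule AE_mp, intro AE_I2 impI)
        fix z assume z: "z \<in> S"
        show "\<bar>p m A z - p m A x\<bar> \<le> \<alpha> ^ m * (2 + \<beta> * (V x + V z))"
          using p_osc[OF A x z] p_osc[OF A z x] by (simp add: abs_le_iff add.commute)
      qed
    qed (use pi Vi in auto)
    also have "\<dots> = \<alpha> ^ m * (2 + \<beta> * (V x + (\<integral>z. V z \<partial>K x)))" using Vi prob_space by simp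
    also have "\<dots> \<le> \<alpha> ^ m * M0 x"
      unfolding M0_def using Vi(2) \<alpha> \<beta> by (intro mult_left_mono add_left_mono) auto
    finally show ?thesis by (simp add: mult.commute)
  qed
  obtain x0 where x0: "x0 \<in> S" using assms by auto
  define c where "c = M0 x0 / (1 - \<alpha>)"
  have "\<exists>q. (\<lambda>m. p m A x0) \<longlonglongrightarrow> q \<and> (\<forall>m. \<bar>p m A x0 - q\<bar> \<le> c * \<alpha> ^ m)" if "A \<in> sets borel" for A
    using geometric_increments_limit[of "\<lambda>m. p m A x0", OF p_inc[OF that x0] \<alpha>] unfolding c_def by metis
  then obtain q where q_lim: "\<And>A. A \<in> sets borel \<Longrightarrow> (\<lambda>m. p m A x0) \<longlonglongrightarrow> q A"
    and q_rate: "\<And>A m. A \<in> sets borel \<Longrightarrow> \<bar>p m A x0 - q A\<bar> \<le> c * \<alpha> ^ m" by metis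
  have q0: "0 \<le> q A" if "A \<in> sets borel" for A
    by (rule LIMSEQ_le_const[OF q_lim[OF that]]) (use p01 in auto)
  have q_add: "q (A \<union> B) = q A + q B" if A: "A \<in> sets borel" and B: "B \<in> sets borel" and "A \<inter> B = {}" for A B
  proof (rule LIMSEQ_unique)
    have "p m (A \<union> B) x0 = p m A x0 + p m B x0" for m
      unfolding p_def using that subprob_space.axioms(1)[OF subprob_kstep]
      by (intro finite_measure.finite_measure_Union) auto
    then show "(\<lambda>m. p m (A \<union> B) x0) \<longlonglongrightarrow> q A + q B"
      using tendsto_add[OF q_lim[OF A] q_lim[OF B]] by simp
  qed (rule q_lim, use A B in auto)
  have q_empty: "q {} = 0" using q_add[of "{}" "{}"] by simp
  have q_UNIV: "q UNIV = 1"
  proof (rule LIMSEQ_unique[OF q_lim])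
    have "p m UNIV x0 = 1" for m using measure_kstep_UNIV[OF x0] by (simp add: p_def)
    then show "(\<lambda>m. p m UNIV x0) \<longlonglongrightarrow> 1" by simp
  qed simp
  have c0: "0 \<le> c" using \<alpha> \<beta> V0[of x0] \<gamma> C by (simp add: c_def M0_def)
  \<comment> \<open>Finite additivity passes to the limit set by set, countable additivity does not.
    The rate is uniform in the set, so continuity at the empty set is inherited from one iterate
    \<open>m\<close> that is already within \<open>r / 2\<close> of the limit.\<close>
  have ca: "countably_additive (sets borel) (\<lambda>A. ennreal (q A))"
  proof (rule ring_of_sets.empty_continuous_imp_countably_additive)
    show "ring_of_sets UNIV (sets (borel :: 's measure))"
      using sets.ring_of_sets_axioms[of "borel :: 's measure"] by simp
    show "positive (sets borel) (\<lambda>A. ennreal (q A))" by (simp add: positive_def q_empty)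
    show "additive (sets borel) (\<lambda>A. ennreal (q A))"
      by (auto simp: additive_def q_add q0 ennreal_plus[symmetric] simp del: ennreal_plus)
    fix A :: "nat \<Rightarrow> 's set" assume A: "range A \<subseteq> sets borel" "decseq A" "(\<Inter>i. A i) = {}"
    have Ai: "A i \<in> sets borel" for i using A by auto
    have "(\<lambda>i. q (A i)) \<longlonglongrightarrow> 0"
    proof (rule LIMSEQ_I)
      fix r :: real assume r: "0 < r"
      have "(\<lambda>m. c * \<alpha> ^ m) \<longlonglongrightarrow> c * 0" by (intro tendsto_mult_left LIMSEQ_power_zero) (use \<alpha> in simp)
      then have "eventually (\<lambda>m. c * \<alpha> ^ m < r / 2) sequentially" 
        using r by (intro order_tendstoD(2)[where y = 0]) auto
      then obtain m where m: "c * \<alpha> ^ m < r / 2" by (auto simp: eventually_sequentially)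
      have "(\<lambda>i. p m (A i) x0) \<longlonglongrightarrow> p m (\<Inter>i. A i) x0"
        unfolding p_def using A subprob_space.axioms(1)[OF subprob_kstep]
        by (intro finite_measure.finite_Lim_measure_decseq) auto
      then have "eventually (\<lambda>i. p m (A i) x0 < r / 2) sequentially"
        using r A(3) by (intro order_tendstoD(2)[where y = 0]) (auto simp: p_def)
      then obtain N where N: "\<And>i. i \<ge> N \<Longrightarrow> p m (A i) x0 < r / 2" by (auto simp: eventually_sequentially)
      show "\<exists>N. \<forall>i\<ge>N. norm (q (A i) - 0) < r"
        using q_rate[OF Ai, of m] q0[OF Ai] m N by (intro exI[of _ N]) (smt (verit) real_norm_def field_sum_of_halves)
    qed
    then show "(\<lambda>i. ennreal (q (A i))) \<longlonglongrightarrow> 0" using tendsto_ennrealI by fastforce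
  qed simp
  define Q where "Q = measure_of UNIV (sets borel) (\<lambda>A. ennreal (q A))"
  have setsQ: "sets Q = sets borel" unfolding Q_def by (metis sets.sigma_sets_eq sets_measure_of space_borel subset_UNIV subsetI sets.space_closed)
  have Q: "emeasure Q A = ennreal (q A)" if "A \<in> sets borel" for A
    unfolding Q_def
    by (rule emeasure_measure_of_sigma[OF _ _ ca that])
      (use sets.sigma_algebra_axioms[of "borel :: 's measure"] in \<open>auto simp: positive_def q_empty\<close>)
  have prQ: "prob_space Q"
    by (rule prob_spaceI) (use Q[of UNIV] q_UNIV sets_eq_imp_space_eq[OF setsQ] in simp)
  have mQ: "measure Q A = q A" if "A \<in> sets borel" for A
    using Q[OF that] q0[OF that] by (simp add: measure_def)
  define M where "M x = 2 + \<beta> * (V x + V x0) + c" for x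
  have "tv_dist (kstep K m x) Q \<le> M x * \<alpha> ^ m" if x: "x \<in> S" for x m
    unfolding tv_dist_def
  proof (rule cSUP_least)
    fix A :: "'s set" assume A: "A \<in> sets borel"
    have "\<bar>p m A x - p m A x0\<bar> \<le> \<alpha> ^ m * (2 + \<beta> * (V x + V x0))"
      using p_osc[OF A x x0] p_osc[OF A x0 x] by (simp add: abs_le_iff add.commute)
    then have "\<bar>p m A x - q A\<bar> \<le> M x * \<alpha> ^ m"
      using q_rate[OF A, of m] by (simp add: M_def algebra_simps)
    then show "\<bar>measure (kstep K m x) A - measure Q A\<bar> \<le> M x * \<alpha> ^ m"
      by (simp add: mQ[OF A] p_def)
  qed (use sets.empty_sets in blast)
  then show ?thesis
    unfolding geom_ergodic_def using prQ setsQ \<alpha> by blast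
qed

end

section \<open>Gaussian integrals\<close>

lemma nn_integral_lborel_translate:
  fixes f :: "'a::euclidean_space \<Rightarrow> ennreal"
  assumes [measurable]: "f \<in> borel_measurable borel"
  shows "(\<integral>\<^sup>+x. f (v + x) \<partial>lborel) = (\<integral>\<^sup>+x. f x \<partial>lborel)"
proof -
  have "(\<integral>\<^sup>+x. f x \<partial>lborel) = (\<integral>\<^sup>+x. f x \<partial>distr lborel borel ((+) v))"
    by (simp add: lborel_distr_plus)
  then show ?thesis by (subst (asm) nn_integral_distr) auto
qed

text \<open>Averaging over translations along \<open>e\<close> turns the shear into a one-dimensional translation.\<close>

lemma nn_integral_lborel_shear:
  fixes f :: "'a::euclidean_space \<Rightarrow> ennreal" and g :: "'a \<Rightarrow> real"
  assumes [measurable]: "f \<in> borel_measurable borel" "g \<in> borel_measurable borel"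
    and g: "\<And>r x. g (x + r *\<^sub>R e) = g x"
  shows "(\<integral>\<^sup>+x. f (g x *\<^sub>R e + x) \<partial>lborel) = (\<integral>\<^sup>+x. f x \<partial>lborel)"
proof -
  define h :: "real \<Rightarrow> ennreal" where "h = indicator {0..1}"
  have [measurable]: "h \<in> borel_measurable borel" by (simp add: h_def)
  have h1: "(\<integral>\<^sup>+r. h r \<partial>lborel) = 1" by (simp add: h_def)
  have tr: "(\<integral>\<^sup>+x. f (g x *\<^sub>R e + x) \<partial>lborel) = (\<integral>\<^sup>+x. f ((r + g x) *\<^sub>R e + x) \<partial>lborel)" for r
    using nn_integral_lborel_translate[of "\<lambda>x. f (g x *\<^sub>R e + x)" "r *\<^sub>R e"]
    using g[of _ r] by (simp add: algebra_simps)
  have "(\<integral>\<^sup>+x. f (g x *\<^sub>R e + x) \<partial>lborel) = (\<integral>\<^sup>+r. h r * (\<integral>\<^sup>+x. f ((r + g x) *\<^sub>R e + x) \<partial>lborel) \<partial>lborel)"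
    by (subst tr[symmetric]) (simp add: nn_integral_multc h1)
  also have "\<dots> = (\<integral>\<^sup>+r. \<integral>\<^sup>+x. h r * f ((r + g x) *\<^sub>R e + x) \<partial>lborel \<partial>lborel)"
    by (simp add: nn_integral_cmult)
  also have "\<dots> = (\<integral>\<^sup>+x. \<integral>\<^sup>+r. h r * f ((r + g x) *\<^sub>R e + x) \<partial>lborel \<partial>lborel)"
    by (rule lborel_pair.Fubini') measurable
  \<comment> \<open>For fixed \<open>x\<close> the variable \<open>r\<close> is real, and a
    translation by \<open>g x\<close> moves the shear out of \<open>f\<close> and into the weight
    \<open>h\<close>, where it is harmless.\<close>
  also have "\<dots> = (\<integral>\<^sup>+x. \<integral>\<^sup>+r. h (r - g x) * f (r *\<^sub>R e + x) \<partial>lborel \<partial>lborel)"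
  proof (rule nn_integral_cong)
    fix x
    show "(\<integral>\<^sup>+r. h r * f ((r + g x) *\<^sub>R e + x) \<partial>lborel) = (\<integral>\<^sup>+r. h (r - g x) * f (r *\<^sub>R e + x) \<partial>lborel)"
    proof -
      have m: "(\<lambda>r. h (r - g x) * f (r *\<^sub>R e + x)) \<in> borel_measurable borel" by measurable
      show ?thesis using nn_integral_lborel_translate[OF m, of "g x"] by (simp add: add.commute)
    qed
  qed
  also have "\<dots> = (\<integral>\<^sup>+r. \<integral>\<^sup>+x. h (r - g x) * f (r *\<^sub>R e + x) \<partial>lborel \<partial>lborel)"
    by (rule lborel_pair.Fubini'[symmetric]) measurable
  also have "\<dots> = (\<integral>\<^sup>+r. \<integral>\<^sup>+x. h (r - g x) * f x \<partial>lborel \<partial>lborel)"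
  proof (rule nn_integral_cong)
    fix r
    show "(\<integral>\<^sup>+x. h (r - g x) * f (r *\<^sub>R e + x) \<partial>lborel) = (\<integral>\<^sup>+x. h (r - g x) * f x \<partial>lborel)"
      using nn_integral_lborel_translate[of "\<lambda>x. h (r - g x) * f x" "r *\<^sub>R e"] g[of _ r] by (simp add: add.commute)
  qed
  also have "\<dots> = (\<integral>\<^sup>+x. \<integral>\<^sup>+r. h (r - g x) * f x \<partial>lborel \<partial>lborel)"
    by (rule lborel_pair.Fubini') measurable
  also have "\<dots> = (\<integral>\<^sup>+x. f x \<partial>lborel)"
  proof (rule nn_integral_cong)
    fix x
    have "(\<integral>\<^sup>+r. h (r - g x) \<partial>lborel) = 1"
      using nn_integral_lborel_translate[of h "- g x"] h1 by (simp add: add.commute)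
    then show "(\<integral>\<^sup>+r. h (r - g x) * f x \<partial>lborel) = f x"
      by (simp add: nn_integral_multc)
  qed
  finally show ?thesis .
qed

lemma nn_integral_lborel_prod_cart:
  fixes f :: "'n::finite \<Rightarrow> real \<Rightarrow> real"
  assumes [measurable]: "\<And>i. f i \<in> borel_measurable borel" and "\<And>i x. 0 \<le> f i x"
  shows "(\<integral>\<^sup>+x. ennreal (\<Prod>i\<in>UNIV. f i (x $ i)) \<partial>lborel) = (\<Prod>i\<in>UNIV. \<integral>\<^sup>+x. ennreal (f i x) \<partial>lborel)"
proof -
  \<comment> \<open>The product formula for Lebesgue measure is indexed by basis vectors;
    \<open>THE\<close> inverts \<open>axis _ 1\<close> to carry the coordinate index over to
    them.\<close>
  define F where "F b = f (THE i. b = axis i 1)" for b :: "real^'n"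
  have F: "F (axis i 1) = f i" for i by (simp add: F_def axis_eq_axis)
  have B: "(Basis :: (real^'n) set) = range (\<lambda>i. axis i 1)" by (auto simp: Basis_vec_def)
  have inj: "inj (\<lambda>i. axis i 1 :: real^'n)" by (auto simp: inj_def axis_eq_axis)
  have pr: "(\<Prod>b\<in>(Basis :: (real^'n) set). G b) = (\<Prod>i\<in>UNIV. G (axis i 1))" for G :: "real^'n \<Rightarrow> 'b::comm_monoid_mult"
    unfolding B by (subst prod.reindex[OF inj]) simp
  have "(\<integral>\<^sup>+x. (\<Prod>b\<in>(Basis :: (real^'n) set). ennreal (F b (x \<bullet> b))) \<partial>lborel) = (\<Prod>b\<in>Basis. \<integral>\<^sup>+x. ennreal (F b x) \<partial>lborel)"
    by (rule nn_integral_lborel_prod[of "\<lambda>b x. ennreal (F b x)"]) (auto simp: B F)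
  then show ?thesis
    using assms by (simp add: pr F inner_axis prod_ennreal)
qed

section \<open>Positive definite forms and their Gaussian integrals\<close>

definition pos_def :: "real^'n^'n \<Rightarrow> bool" where
  "pos_def A \<longleftrightarrow> (\<forall>i j. A $ i $ j = A $ j $ i) \<and> (\<forall>x. x \<noteq> 0 \<longrightarrow> x \<bullet> (A *v x) > 0)"

lemma quad_form_expand: "x \<bullet> (A *v x) = (\<Sum>i\<in>UNIV. \<Sum>j\<in>UNIV. A $ i $ j * x $ i * x $ j)" for A :: "real^'n^'n"
  by (simp add: inner_vec_def matrix_vector_mult_def sum_distrib_left mult_ac)

lemma pos_def_diag: "pos_def A \<Longrightarrow> A $ k $ k > 0"
proof -
  assume "pos_def A"
  then have "axis k 1 \<bullet> (A *v axis k 1) > 0" by (simp add: pos_def_def axis_eq_0_iff)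
  then show ?thesis by (simp add: matrix_vector_mult_basis column_def inner_axis')
qed

lemma measurable_vec_nth[measurable]: "(\<lambda>x::real^'n. x $ i) \<in> borel_measurable borel"
  by (intro borel_measurable_continuous_onI continuous_intros)

lemma measurable_mult_vec[measurable (raw)]:
  "f \<in> borel_measurable M \<Longrightarrow> (\<lambda>x. (A::real^'n^'m) *v f x) \<in> borel_measurable M"
  by (erule measurable_compose)
    (intro borel_measurable_continuous_onI linear_continuous_on matrix_vector_mul_bounded_linear)

lemma nn_integral_exp_square:
  assumes "d > 0"
  shows "(\<integral>\<^sup>+x. ennreal (exp (- (d * x\<^sup>2) / 2)) \<partial>lborel) = ennreal (sqrt (2 * pi / d))"
proof -
  define \<sigma> where "\<sigma> = 1 / sqrt d"
  have s: "\<sigma> > 0" "\<sigma>\<^sup>2 = 1 / d" using assms by (auto simp: \<sigma>_def power_divide)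
  have "exp (- (d * x\<^sup>2) / 2) = sqrt (2 * pi / d) * normal_density 0 \<sigma> x" for x
    using assms by (simp add: normal_density_def s)
  then have "(\<integral>\<^sup>+x. ennreal (exp (- (d * x\<^sup>2) / 2)) \<partial>lborel)
      = ennreal (sqrt (2 * pi / d)) * (\<integral>\<^sup>+x. ennreal (normal_density 0 \<sigma> x) \<partial>lborel)"
    using assms by (subst nn_integral_cmult[symmetric]) (auto simp: ennreal_mult[symmetric])
  also have "(\<integral>\<^sup>+x. ennreal (normal_density 0 \<sigma> x) \<partial>lborel) = 1"
    using s by (subst nn_integral_eq_integral) auto
  finally show ?thesis by simp
qed

text \<open>One step of Gaussian elimination: \<open>A\<close> equals
  \<open>transpose S ** B ** S\<close>, where \<open>S\<close> replaces the k-th coordinate by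
  \<open>(A *v x) $ k / A $ k $ k\<close>, and \<open>B\<close> has no off-diagonal entry left in
  row and column \<open>k\<close>. The displacement \<open>g\<close> does not depend on the k-th
  coordinate, so the substitution is a shear and preserves Lebesgue measure.\<close>

lemma complete_square:
  fixes A :: "real^'n^'n" and k :: 'n
  assumes A: "pos_def A"
  defines "B \<equiv> \<chi> i j. if i = k \<and> j = k then A $ k $ k else A $ i $ j - A $ i $ k * A $ k $ j / A $ k $ k"
  defines "g \<equiv> \<lambda>x. (A *v x) $ k / A $ k $ k - x $ k"
  shows "x \<bullet> (A *v x) = (g x *\<^sub>R axis k 1 + x) \<bullet> (B *v (g x *\<^sub>R axis k 1 + x))"
    and "det B = det A" and "pos_def B" and "g (x + r *\<^sub>R axis k 1) = g x"
proof -
  have kk: "A $ k $ k > 0" by (rule pos_def_diag[OF A])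
  have sym: "A $ i $ j = A $ j $ i" for i j using A by (auto simp: pos_def_def)
  define S where "S = (\<chi> i j. if i = k then A $ k $ j / A $ k $ k else if i = j then 1 else 0)"
  have S: "S *v x = g x *\<^sub>R axis k 1 + x" for x
    by (vector S_def g_def matrix_vector_mult_def axis_def)
      (auto simp: sum_divide_distrib if_distrib[of "\<lambda>c. c * _"] cong: if_cong)
  have BS: "(B ** S) $ i $ j = (if i = k then A $ k $ j else A $ i $ j - A $ i $ k * A $ k $ j / A $ k $ k)" for i j
  proof -
    have "(B ** S) $ i $ j = B $ i $ k * S $ k $ j + (\<Sum>l\<in>UNIV - {k}. B $ i $ l * S $ l $ j)"
      by (simp add: matrix_matrix_mult_def sum.remove[of _ k])
    also have "(\<Sum>l\<in>UNIV - {k}. B $ i $ l * S $ l $ j) = (\<Sum>l\<in>UNIV - {k}. if l = j then B $ i $ j else 0)"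
      by (intro sum.cong) (auto simp: S_def)
    also have "\<dots> = (if j = k then 0 else B $ i $ j)" by (simp add: sum.delta)
    finally show ?thesis using kk by (auto simp: B_def S_def)
  qed
  have S_row: "S $ k $ i = A $ k $ i / A $ k $ k" for i by (simp add: S_def)
  have SBS: "transpose S ** (B ** S) = A"
  proof (vector, clarify)
    fix i j
    have "(transpose S ** (B ** S)) $ i $ j
        = S $ k $ i * (B ** S) $ k $ j + (\<Sum>l\<in>UNIV - {k}. S $ l $ i * (B ** S) $ l $ j)"
      by (subst matrix_matrix_mult_def) (simp add: transpose_def sum.remove[of _ k])
    also have "(\<Sum>l\<in>UNIV - {k}. S $ l $ i * (B ** S) $ l $ j) = (\<Sum>l\<in>UNIV - {k}. if l = i then (B ** S) $ i $ j else 0)"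
      by (intro sum.cong) (auto simp: S_def)
    also have "\<dots> = (if i = k then 0 else (B ** S) $ i $ j)" by (simp add: sum.delta)
    finally show "(transpose S ** (B ** S)) $ i $ j = A $ i $ j"
      using kk by (simp add: BS S_row sym[of k i])
  qed
  have quad: "x \<bullet> (A *v x) = (S *v x) \<bullet> (B *v (S *v x))" for x
    by (metis SBS dot_lmul_matrix matrix_vector_mul_assoc vector_transpose_matrix)
  then show "x \<bullet> (A *v x) = (g x *\<^sub>R axis k 1 + x) \<bullet> (B *v (g x *\<^sub>R axis k 1 + x))" by (simp add: S)
  \<comment> \<open>\<open>S\<close> differs from the identity only in row \<open>k\<close>, and
    there by a combination of the other rows, which leaves the determinant unchanged.\<close>
  have "det S = 1"
  proof -
    define v where "v = S $ k - axis k 1"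
    have "v \<in> vec.span {row j (mat 1 :: real^'n^'n) | j. j \<noteq> k}"
    proof -
      have "v = (\<Sum>j\<in>UNIV - {k}. (v $ j) *s row j (mat 1))"
        using kk by (vector v_def S_def row_def mat_def axis_def)
            (auto simp: sum.delta sum_divide_distrib[symmetric] if_distrib[of "\<lambda>c. _ * c"] cong: if_cong)
      also have "\<dots> \<in> vec.span {row j (mat 1 :: real^'n^'n) | j. j \<noteq> k}"
        by (intro vec.span_sum vec.span_scale vec.span_base) auto
      finally show ?thesis .
    qed
    then have "det (\<chi> i. if i = k then row k (mat 1 :: real^'n^'n) + v else row i (mat 1)) = 1"
      by (subst det_row_span) auto
    also have "(\<chi> i. if i = k then row k (mat 1 :: real^'n^'n) + v else row i (mat 1)) = S"
      by (vector v_def S_def row_def mat_def axis_def)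
    finally show ?thesis .
  qed
  then show "det B = det A" using SBS by (metis det_mul det_transpose mult_1 mult.commute)
  show gk: "g (x + r *\<^sub>R axis k 1) = g x" for r x
    using kk by (simp add: g_def matrix_vector_right_distrib matrix_vector_mult_scaleR
        matrix_vector_mult_basis column_def field_simps)
  show "pos_def B"
    unfolding pos_def_def
  proof (intro conjI allI impI)
    fix i j show "B $ i $ j = B $ j $ i" by (auto simp: B_def sym)
  next
    fix z :: "real^'n" assume z: "z \<noteq> 0"
    define w where "w = z + (- g z) *\<^sub>R axis k 1"
    have "S *v w = z" unfolding S by (simp add: w_def gk[of _ "- g z", simplified])
    moreover from this z have "w \<noteq> 0" by auto
    ultimately show "z \<bullet> (B *v z) > 0" using quad[of w] A by (auto simp: pos_def_def)
  qed
qed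

text \<open>Induction on a set \<open>K\<close> of coordinates outside of which all off-diagonal
  entries vanish: completing the square at \<open>k\<close> removes \<open>k\<close> from
  \<open>K\<close> without changing the determinant or the integral. For empty \<open>K\<close> the
  form is diagonal and the integral is a product. Positivity of the determinant comes out of the
  same induction.\<close>

lemma gaussian_integral:
  fixes A :: "real^'n^'n"
  assumes "pos_def A"
  shows "det A > 0"
    and "(\<integral>\<^sup>+x. ennreal (exp (- (x \<bullet> (A *v x)) / 2)) \<partial>lborel) = ennreal (sqrt ((2 * pi) ^ CARD('n) / det A))"
proof -
  have "det A > 0 \<and> (\<integral>\<^sup>+x. ennreal (exp (- (x \<bullet> (A *v x)) / 2)) \<partial>lborel) = ennreal (sqrt ((2 * pi) ^ CARD('n) / det A))"
    if "finite K" "pos_def A" "\<And>i j. i \<noteq> j \<Longrightarrow> i \<notin> K \<or> j \<notin> K \<Longrightarrow> A $ i $ j = 0" for K and A :: "real^'n^'n"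
    using that
  proof (induction K arbitrary: A)
    case empty
    have off: "A $ i $ j = 0" if "i \<noteq> j" for i j using empty that by auto
    have dA: "A $ i $ i > 0" for i using empty by (auto intro: pos_def_diag)
    have det: "det A = (\<Prod>i\<in>UNIV. A $ i $ i)" by (rule det_diagonal) (rule off)
    have quad: "x \<bullet> (A *v x) = (\<Sum>i\<in>UNIV. A $ i $ i * (x $ i)\<^sup>2)" for x
    proof -
      have "(\<Sum>j\<in>UNIV. A $ i $ j * x $ i * x $ j) = A $ i $ i * (x $ i)\<^sup>2" for i
        by (subst sum.remove[of _ i]) (auto simp: off power2_eq_square intro!: sum.neutral)
      then show ?thesis by (simp add: quad_form_expand)
    qed
    have "(\<integral>\<^sup>+x. ennreal (exp (- (x \<bullet> (A *v x)) / 2)) \<partial>lborel)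
        = (\<integral>\<^sup>+x. ennreal (\<Prod>i\<in>UNIV. exp (- (A $ i $ i * (x $ i)\<^sup>2) / 2)) \<partial>lborel)"
      by (simp add: quad exp_sum[symmetric] sum_divide_distrib sum_negf)
    also have "\<dots> = (\<Prod>i\<in>UNIV. \<integral>\<^sup>+x. ennreal (exp (- (A $ i $ i * x\<^sup>2) / 2)) \<partial>lborel)"
      by (rule nn_integral_lborel_prod_cart[of "\<lambda>i x. exp (- (A $ i $ i * x\<^sup>2) / 2)"]) auto
    also have "\<dots> = ennreal (\<Prod>i\<in>UNIV. sqrt (2 * pi / A $ i $ i))"
      using dA by (subst nn_integral_exp_square) (auto simp: prod_ennreal less_imp_le)
    also have "(\<Prod>i\<in>UNIV. sqrt (2 * pi / A $ i $ i)) = sqrt ((2 * pi) ^ CARD('n) / det A)"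
    proof -
      have "(\<Prod>i\<in>I. sqrt (f i)) = sqrt (\<Prod>i\<in>I. f i)" if "finite I" for I :: "'n set" and f
        using that by induction (simp_all add: real_sqrt_mult)
      then show ?thesis by (simp add: det prod_dividef)
    qed
    finally show ?case using dA by (simp add: det prod_pos)
  next
    case (insert k K)
    define B where "B = (\<chi> i j. if i = k \<and> j = k then A $ k $ k else A $ i $ j - A $ i $ k * A $ k $ j / A $ k $ k)"
    define g where "g = (\<lambda>x. (A *v x) $ k / A $ k $ k - x $ k)"
    note sq = complete_square[OF insert.prems(1), where k = k, folded B_def g_def]
    have [measurable]: "g \<in> borel_measurable borel" unfolding g_def by measurable
    have kk: "A $ k $ k > 0" by (rule pos_def_diag[OF insert.prems(1)])
    have gk: "g (x + r *\<^sub>R axis k 1) = g x" for x r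
      using sq(4)[of x r] by (simp add: g_def)
    have "B $ i $ j = 0" if "i \<noteq> j" "i \<notin> K \<or> j \<notin> K" for i j
      using that kk insert.prems(2)[of i j] insert.prems(2)[of i k] insert.prems(2)[of k j]
      by (cases "i = k"; cases "j = k") (auto simp: B_def)
    from insert.IH[OF sq(3) this]
    have B: "det A > 0" "(\<integral>\<^sup>+x. ennreal (exp (- (x \<bullet> (B *v x)) / 2)) \<partial>lborel) = ennreal (sqrt ((2 * pi) ^ CARD('n) / det A))"
      by (simp_all add: sq(2))
    have "(\<integral>\<^sup>+x. ennreal (exp (- (x \<bullet> (A *v x)) / 2)) \<partial>lborel)
       = (\<integral>\<^sup>+x. ennreal (exp (- ((g x *\<^sub>R axis k 1 + x) \<bullet> (B *v (g x *\<^sub>R axis k 1 + x))) / 2)) \<partial>lborel)"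
      by (subst sq(1)) (simp add: g_def)
    also have "\<dots> = (\<integral>\<^sup>+x. ennreal (exp (- (x \<bullet> (B *v x)) / 2)) \<partial>lborel)"
      by (rule nn_integral_lborel_shear[where f = "\<lambda>x. ennreal (exp (- (x \<bullet> (B *v x)) / 2))" and e = "axis k 1"])
        (simp_all add: gk)
    finally show ?case using B by simp
  qed
  from this[of UNIV A] assms show "det A > 0"
    "(\<integral>\<^sup>+x. ennreal (exp (- (x \<bullet> (A *v x)) / 2)) \<partial>lborel) = ennreal (sqrt ((2 * pi) ^ CARD('n) / det A))"
    by auto
qed

lemma pos_def_invertible: "pos_def A \<Longrightarrow> invertible A"
  using gaussian_integral(1)[of A] by (simp add: invertible_det_nz)

lemma pos_def_inverse_vec:
  fixes A :: "real^'n^'n"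
  assumes "pos_def A"
  shows "A *v (matrix_inv A *v v) = v" "matrix_inv A *v (A *v v) = v"
proof -
  have "A ** matrix_inv A = mat 1 \<and> matrix_inv A ** A = mat 1"
    unfolding matrix_inv_def using pos_def_invertible[OF assms] unfolding invertible_def by (rule someI_ex)
  then show "A *v (matrix_inv A *v v) = v" "matrix_inv A *v (A *v v) = v"
    by (simp_all add: matrix_vector_mul_assoc)
qed

lemma bilinear_form_sym:
  fixes A :: "real^'n^'n"
  assumes "\<And>i j. A $ i $ j = A $ j $ i"
  shows "x \<bullet> (A *v z) = z \<bullet> (A *v x)"
proof -
  have "transpose A = A" using assms by (simp add: vec_eq_iff transpose_def)
  then show ?thesis by (metis dot_lmul_matrix vector_transpose_matrix inner_commute)
qed

lemma quad_form_diff: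
  fixes A :: "real^'n^'n"
  assumes "\<And>i j. A $ i $ j = A $ j $ i"
  shows "(x - m) \<bullet> (A *v (x - m)) = x \<bullet> (A *v x) - 2 * (x \<bullet> (A *v m)) + m \<bullet> (A *v m)"
  using bilinear_form_sym[OF assms, of m x]
  by (simp add: matrix_vector_mult_diff_distrib inner_diff_left inner_diff_right)

text \<open>In Gaussian terms, with \<open>A\<close> the precision matrix, conditioning on the other
  coordinates cannot increase the variance of the k-th one. Here \<open>z\<close> is the k-th column
  of the inverse, and the claim is nonnegativity of the form at
  \<open>z - axis k 1 / A_kk\<close>.\<close>

lemma inverse_diag_ge:
  fixes A :: "real^'n^'n"
  assumes A: "pos_def A" and z: "A *v z = axis k 1"
  shows "1 / A $ k $ k \<le> z $ k"
proof -
  have kk: "A $ k $ k > 0" by (rule pos_def_diag[OF A])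
  have sym: "A $ i $ j = A $ j $ i" for i j using A by (auto simp: pos_def_def)
  define r where "r = 1 / A $ k $ k"
  define w where "w = z - r *\<^sub>R axis k 1"
  have "0 \<le> w \<bullet> (A *v w)" using A by (cases "w = 0") (auto simp: pos_def_def intro: less_imp_le)
  also have "w \<bullet> (A *v w) = z \<bullet> (A *v z) - 2 * (z \<bullet> (A *v (r *\<^sub>R axis k 1))) + (r *\<^sub>R axis k 1) \<bullet> (A *v (r *\<^sub>R axis k 1))"
    unfolding w_def by (rule quad_form_diff[OF sym])
  also have "z \<bullet> (A *v (r *\<^sub>R axis k 1)) = r"
    by (subst bilinear_form_sym[OF sym]) (simp add: z inner_axis)
  also have "(r *\<^sub>R axis k 1) \<bullet> (A *v (r *\<^sub>R axis k 1)) = r"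
    using kk by (simp add: r_def inner_axis' matrix_vector_mult_scaleR matrix_vector_mult_basis column_def)
  also have "z \<bullet> (A *v z) = z $ k" by (simp add: z inner_axis)
  finally show ?thesis by (simp add: r_def)
qed

text \<open>The determinant is affine in row \<open>k\<close>, so the update adds \<open>s\<close>
  times the k-th diagonal cofactor \<open>D\<close>. By Cramer's rule \<open>D / det A\<close> is
  the diagonal entry of the inverse, which is at least \<open>1 / A $ k $ k\<close>.\<close>

lemma det_rank_one_update:
  fixes A :: "real^'n^'n"
  assumes A: "pos_def A" and s: "s \<ge> 0"
  shows "det A * (1 + s / A $ k $ k) \<le> det (\<chi> i j. if i = k \<and> j = k then A $ k $ k + s else A $ i $ j)"
proof -
  define z where "z = matrix_inv A *v axis k 1"
  have dA: "det A > 0" by (rule gaussian_integral(1)[OF A])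
  have z: "A *v z = axis k 1" unfolding z_def by (rule pos_def_inverse_vec(1)[OF A])
  have sym: "A $ i $ j = A $ j $ i" for i j using A by (auto simp: pos_def_def)
  define D where "D = det (\<chi> i j. if j = k then axis k 1 $ i else A $ i $ j)"
  have "z = (\<chi> l. det (\<chi> i j. if j = l then axis k 1 $ i else A $ i $ j) / det A)"
    using cramer[of A z "axis k 1"] z dA by simp
  from arg_cong[OF this, of "\<lambda>v. v $ k"] have zk: "z $ k = D / det A" by (simp add: D_def)
  \<comment> \<open>Cramer's rule replaces a column, the row expansion below a row; symmetry of
    \<open>A\<close> makes the two determinants equal.\<close>
  have D: "D = det (\<chi> i. if i = k then axis k 1 else A $ i)"
  proof -
    have "transpose (\<chi> i j. if j = k then axis k 1 $ i else A $ i $ j) = (\<chi> i. if i = k then axis k 1 else A $ i)"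
      by (auto simp: vec_eq_iff transpose_def intro: sym)
    from arg_cong[OF this, of det] show ?thesis by (simp add: D_def)
  qed
  have "(\<chi> i j. if i = k \<and> j = k then A $ k $ k + s else A $ i $ j)
      = (\<chi> i. if i = k then A $ i + s *s axis k 1 else A $ i)"
    by (auto simp: vec_eq_iff axis_def)
  also have "det \<dots> = det (\<chi> i. if i = k then A $ i else A $ i) + s * D"
    unfolding D det_row_add det_row_mul ..
  also have "(\<chi> i. if i = k then A $ i else A $ i) = A" by vector
  finally have det: "det (\<chi> i j. if i = k \<and> j = k then A $ k $ k + s else A $ i $ j) = det A + s * D" .
  have "1 / A $ k $ k \<le> D / det A" using inverse_diag_ge[OF A z] zk by simp
  then have "det A * (1 / A $ k $ k) \<le> D" using dA by (simp add: field_simps)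
  then have "s * (det A * (1 / A $ k $ k)) \<le> s * D" using s by (rule mult_left_mono)
  then show ?thesis unfolding det by (simp add: algebra_simps)
qed

text \<open>The normal density parametrized by its precision matrix: \<open>Amat X lam\<close>
  depends explicitly on \<open>lam\<close>, while its inverse does not.\<close>

definition gauss_prec :: "real^'n \<Rightarrow> real^'n^'n \<Rightarrow> real^'n \<Rightarrow> real" where
  "gauss_prec \<mu> P x = exp (- ((x - \<mu>) \<bullet> (P *v (x - \<mu>))) / 2) / sqrt ((2 * pi) ^ CARD('n) / det P)"

lemma nn_integral_exp_quad_shift:
  fixes P :: "real^'n^'n"
  assumes "pos_def P"
  shows "(\<integral>\<^sup>+x. ennreal (exp (- ((x - \<mu>) \<bullet> (P *v (x - \<mu>))) / 2)) \<partial>lborel) = ennreal (sqrt ((2 * pi) ^ CARD('n) / det P))"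
  using nn_integral_lborel_translate[of "\<lambda>x. ennreal (exp (- (x \<bullet> (P *v x)) / 2))" "- \<mu>"] gaussian_integral(2)[OF assms]
  by simp

lemma measurable_gauss_prec[measurable]: "gauss_prec \<mu> P \<in> borel_measurable borel"
  unfolding gauss_prec_def[abs_def] by measurable

lemma gauss_prec_nonneg: "pos_def P \<Longrightarrow> 0 \<le> gauss_prec \<mu> P x"
  using gaussian_integral(1)[of P] by (simp add: gauss_prec_def)

text \<open>Common pattern of the Gaussian estimates: once the integrand is dominated by a multiple
  of another Gaussian kernel, the bound is that multiple times a ratio of normalising
  constants.\<close>

lemma nn_integral_gauss_prec_mult:
  fixes P :: "real^'n^'n"
  assumes P: "pos_def P" and h[measurable]: "h \<in> borel_measurable borel" "\<And>x. 0 \<le> h x"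
    and Q: "pos_def Q" and C: "C \<ge> 0"
    and le: "\<And>x. exp (- ((x - \<mu>) \<bullet> (P *v (x - \<mu>))) / 2) * h x \<le> C * exp (- ((x - m) \<bullet> (Q *v (x - m))) / 2)"
  shows "(\<integral>\<^sup>+x. ennreal (gauss_prec \<mu> P x) * ennreal (h x) \<partial>lborel) \<le> ennreal (C * sqrt (det P / det Q))"
proof -
  define N where "N = sqrt ((2 * pi) ^ CARD('n) / det P)"
  have dP: "det P > 0" and dQ: "det Q > 0" using gaussian_integral(1) P Q by auto
  have N: "N > 0" using dP by (simp add: N_def)
  have "(\<integral>\<^sup>+x. ennreal (gauss_prec \<mu> P x) * ennreal (h x) \<partial>lborel)
     \<le> (\<integral>\<^sup>+x. ennreal (C / N) * ennreal (exp (- ((x - m) \<bullet> (Q *v (x - m))) / 2)) \<partial>lborel)"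
  proof (rule nn_integral_mono)
    fix x :: "real^'n"
    have "exp (- ((x - \<mu>) \<bullet> (P *v (x - \<mu>))) / 2) * h x / N \<le> C * exp (- ((x - m) \<bullet> (Q *v (x - m))) / 2) / N"
      using le[of x] N by (intro divide_right_mono) auto
    then have "ennreal (gauss_prec \<mu> P x * h x) \<le> ennreal (C / N * exp (- ((x - m) \<bullet> (Q *v (x - m))) / 2))"
      by (intro ennreal_leI) (simp add: gauss_prec_def N_def)
    then show "ennreal (gauss_prec \<mu> P x) * ennreal (h x) \<le> ennreal (C / N) * ennreal (exp (- ((x - m) \<bullet> (Q *v (x - m))) / 2))"
      using gauss_prec_nonneg[OF P] h(2) C N by (simp add: ennreal_mult[symmetric])
  qed
  also have "\<dots> = ennreal (C / N) * ennreal (sqrt ((2 * pi) ^ CARD('n) / det Q))"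
    by (subst nn_integral_cmult, measurable, subst nn_integral_exp_quad_shift[OF Q]) (rule refl)
  also have "\<dots> = ennreal (C * sqrt (det P / det Q))"
    using C N dP dQ by (simp add: ennreal_mult[symmetric] N_def real_sqrt_divide)
  finally show ?thesis .
qed

lemma nn_integral_gauss_prec:
  fixes P :: "real^'n^'n"
  assumes P: "pos_def P"
  shows "(\<integral>\<^sup>+x. ennreal (gauss_prec \<mu> P x) \<partial>lborel) = 1"
proof -
  define N where "N = sqrt ((2 * pi) ^ CARD('n) / det P)"
  have N: "N > 0" using gaussian_integral(1)[OF P] by (simp add: N_def)
  have "(\<integral>\<^sup>+x. ennreal (gauss_prec \<mu> P x) \<partial>lborel)
     = (\<integral>\<^sup>+x. ennreal (1 / N) * ennreal (exp (- ((x - \<mu>) \<bullet> (P *v (x - \<mu>))) / 2)) \<partial>lborel)"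
  proof (rule nn_integral_cong)
    fix x
    have "gauss_prec \<mu> P x = 1 / N * exp (- ((x - \<mu>) \<bullet> (P *v (x - \<mu>))) / 2)"
      by (simp add: gauss_prec_def N_def)
    then show "ennreal (gauss_prec \<mu> P x) = ennreal (1 / N) * ennreal (exp (- ((x - \<mu>) \<bullet> (P *v (x - \<mu>))) / 2))"
      using N by (simp only: ennreal_mult[symmetric] less_imp_le divide_nonneg_pos zero_le_one exp_ge_zero)
  qed
  also have "\<dots> = ennreal (1 / N) * ennreal N"
    by (subst nn_integral_cmult, measurable, subst nn_integral_exp_quad_shift[OF P]) (simp only: N_def)
  also have "\<dots> = 1" using N by (simp add: ennreal_mult[symmetric])
  finally show ?thesis .
qed

text \<open>The exponential raises the entry \<open>P $ k $ k\<close> by \<open>s\<close> and moves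
  the centre to \<open>m\<close>. The constant left by completing the square is nonnegative and is
  dropped, so the bound no longer involves the mean: the centred case is the worst. Bounding the
  ratio of determinants through the diagonal entry then removes the correlations as well.\<close>

lemma nn_integral_gauss_prec_exp:
  fixes P :: "real^'n^'n"
  assumes P: "pos_def P" and s: "s \<ge> 0"
  shows "(\<integral>\<^sup>+x. ennreal (gauss_prec \<mu> P x) * ennreal (exp (- (s * (x $ k)\<^sup>2 / 2))) \<partial>lborel)
    \<le> ennreal ((1 + s / P $ k $ k) powr (- (1/2)))"
proof -
  define Q where "Q = (\<chi> i j. if i = k \<and> j = k then P $ k $ k + s else P $ i $ j)"
  have kk: "P $ k $ k > 0" by (rule pos_def_diag[OF P])
  have sym: "P $ i $ j = P $ j $ i" for i j using P by (auto simp: pos_def_def)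
  have Qvec: "Q *v x = P *v x + (s * x $ k) *\<^sub>R axis k 1" for x
  proof (rule vec_eq_iff[THEN iffD2], rule allI)
    fix i
    have "(\<Sum>j\<in>UNIV. Q $ i $ j * x $ j) = (\<Sum>j\<in>UNIV. P $ i $ j * x $ j + (if j = k then (if i = k then s * x $ k else 0) else 0))"
      by (intro sum.cong) (auto simp: Q_def algebra_simps)
    also have "\<dots> = (\<Sum>j\<in>UNIV. P $ i $ j * x $ j) + (if i = k then s * x $ k else 0)"
      by (simp add: sum.distrib)
    finally show "(Q *v x) $ i = (P *v x + (s * x $ k) *\<^sub>R axis k 1) $ i"
      by (simp add: matrix_vector_mult_def axis_def)
  qed
  have quad: "x \<bullet> (Q *v x) = x \<bullet> (P *v x) + s * (x $ k)\<^sup>2" for x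
    by (simp add: Qvec inner_add_right inner_axis power2_eq_square)
  have Q: "pos_def Q"
    unfolding pos_def_def
  proof (intro conjI allI impI)
    show "Q $ i $ j = Q $ j $ i" for i j by (auto simp: Q_def sym)
    show "x \<noteq> 0 \<Longrightarrow> x \<bullet> (Q *v x) > 0" for x
      using P s unfolding quad pos_def_def by (simp add: add_pos_nonneg)
  qed
  have symQ: "Q $ i $ j = Q $ j $ i" for i j using Q by (auto simp: pos_def_def)
  define m where "m = matrix_inv Q *v (P *v \<mu>)"
  have Qm: "Q *v m = P *v \<mu>" unfolding m_def by (rule pos_def_inverse_vec(1)[OF Q])
  define G where "G x = (x - \<mu>) \<bullet> (P *v (x - \<mu>)) + s * (x $ k)\<^sup>2" for x
  have G: "G x = (x - m) \<bullet> (Q *v (x - m)) + (\<mu> \<bullet> (P *v \<mu>) - m \<bullet> (Q *v m))" for x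
    using quad_form_diff[of P x \<mu>, OF sym] quad_form_diff[of Q x m, OF symQ] quad[of x] by (simp add: G_def Qm)
  have P0: "0 \<le> x \<bullet> (P *v x)" for x using P by (cases "x = 0") (auto simp: pos_def_def intro: less_imp_le)
  \<comment> \<open>The left-over constant is the value of \<open>G\<close> at its minimizer
    \<open>m\<close>, and \<open>G\<close> is a sum of nonnegative terms.\<close>
  have "0 \<le> G m" using P0[of "m - \<mu>"] s by (simp add: G_def)
  then have le: "(x - m) \<bullet> (Q *v (x - m)) \<le> G x" for x unfolding G[of m] G[of x] by simp
  have "(\<integral>\<^sup>+x. ennreal (gauss_prec \<mu> P x) * ennreal (exp (- (s * (x $ k)\<^sup>2 / 2))) \<partial>lborel)
    \<le> ennreal (1 * sqrt (det P / det Q))"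
  proof (rule nn_integral_gauss_prec_mult[OF P _ _ Q, where m = m])
    fix x
    have "exp (- ((x - \<mu>) \<bullet> (P *v (x - \<mu>))) / 2) * exp (- (s * (x $ k)\<^sup>2 / 2)) = exp (- G x / 2)"
      by (simp add: exp_add[symmetric] G_def add_divide_distrib diff_divide_distrib)
    also have "\<dots> \<le> 1 * exp (- ((x - m) \<bullet> (Q *v (x - m))) / 2)" using le[of x] by simp
    finally show "exp (- ((x - \<mu>) \<bullet> (P *v (x - \<mu>))) / 2) * exp (- (s * (x $ k)\<^sup>2 / 2)) \<le> 1 * exp (- ((x - m) \<bullet> (Q *v (x - m))) / 2)" .
  qed auto
  also have "\<dots> \<le> ennreal ((1 + s / P $ k $ k) powr (- (1/2)))"
  proof (rule ennreal_leI)
    have dP: "det P > 0" by (rule gaussian_integral(1)[OF P])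
    have pos: "1 + s / P $ k $ k > 0" using s kk by (simp add: add_pos_nonneg)
    have "det P * (1 + s / P $ k $ k) \<le> det Q" unfolding Q_def by (rule det_rank_one_update[OF P s])
    then have "det P / det Q \<le> 1 / (1 + s / P $ k $ k)"
      using pos gaussian_integral(1)[OF Q] by (simp add: pos_divide_le_eq pos_le_divide_eq mult.commute)
    then have "sqrt (det P / det Q) \<le> sqrt (1 / (1 + s / P $ k $ k))" by (rule real_sqrt_le_mono)
    also have "\<dots> = (1 + s / P $ k $ k) powr (- (1/2))"
      using pos by (simp add: powr_minus powr_half_sqrt real_sqrt_divide inverse_eq_divide)
    finally show "1 * sqrt (det P / det Q) \<le> (1 + s / P $ k $ k) powr (- (1/2))" by simp
  qed
  finally show ?thesis .
qed

lemma pos_def_scaleR: "pos_def P \<Longrightarrow> r > 0 \<Longrightarrow> pos_def (r *\<^sub>R P)"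
  by (auto simp: pos_def_def scaleR_matrix_vector_assoc[symmetric])

lemma det_scaleR: "det (r *\<^sub>R A) = r ^ CARD('n) * det (A :: real^'n^'n)"
proof -
  have "r *\<^sub>R A = (\<chi> i. r *s A $ i)" by vector
  then show ?thesis using det_rows_mul[of "\<lambda>_. r" "\<lambda>i. A $ i"] by simp
qed

text \<open>The exact value is the dimension; the crude inequality
  \<open>q \<le> 4 * exp (q / 4)\<close> already gives a bound uniform in \<open>P\<close> and in
  the mean, at the price of halving the precision.\<close>

lemma nn_integral_gauss_prec_quad:
  fixes P :: "real^'n^'n"
  assumes P: "pos_def P"
  shows "(\<integral>\<^sup>+x. ennreal (gauss_prec \<mu> P x) * ennreal ((x - \<mu>) \<bullet> (P *v (x - \<mu>))) \<partial>lborel)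
    \<le> ennreal (4 * sqrt (2 ^ CARD('n)))"
proof -
  have P0: "0 \<le> x \<bullet> (P *v x)" for x using P by (cases "x = 0") (auto simp: pos_def_def intro: less_imp_le)
  have "(\<integral>\<^sup>+x. ennreal (gauss_prec \<mu> P x) * ennreal ((x - \<mu>) \<bullet> (P *v (x - \<mu>))) \<partial>lborel)
     \<le> ennreal (4 * sqrt (det P / det ((1/2) *\<^sub>R P)))"
  proof (rule nn_integral_gauss_prec_mult[OF P _ _ pos_def_scaleR[OF P], where m = \<mu>])
    fix x
    define q where "q = (x - \<mu>) \<bullet> (P *v (x - \<mu>))"
    have "q / 4 \<le> exp (q / 4)" using exp_ge_add_one_self[of "q / 4"] by linarith
    then have "exp (- q / 2) * q \<le> exp (- q / 2) * (4 * exp (q / 4))" by (intro mult_left_mono) auto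
    also have "\<dots> = 4 * exp (- (q / 2) / 2)" by (simp add: exp_add[symmetric])
    finally show "exp (- ((x - \<mu>) \<bullet> (P *v (x - \<mu>))) / 2) * ((x - \<mu>) \<bullet> (P *v (x - \<mu>)))
       \<le> 4 * exp (- ((x - \<mu>) \<bullet> (((1/2) *\<^sub>R P) *v (x - \<mu>))) / 2)"
      unfolding q_def by (simp add: scaleR_matrix_vector_assoc[symmetric])
  qed (use P0 in auto)
  also have "det P / det ((1/2) *\<^sub>R P) = 2 ^ CARD('n)"
    using gaussian_integral(1)[OF P] by (simp add: det_scaleR power_divide)
  finally show ?thesis .
qed

lemma matrix_inv_unique:
  fixes A :: "real^'n^'n"
  assumes "A ** B = mat 1" "B ** A = mat 1"
  shows "matrix_inv A = B"
proof -
  have "\<exists>B. A ** B = mat 1 \<and> B ** A = mat 1" using assms by (intro exI[of _ B]) simp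
  then have "A ** matrix_inv A = mat 1 \<and> matrix_inv A ** A = mat 1"
    unfolding matrix_inv_def by (rule someI_ex)
  then have "B ** (A ** matrix_inv A) = B" by simp
  then show ?thesis unfolding matrix_mul_assoc assms(2) by simp
qed

lemma mvn_density_eq:
  fixes A :: "real^'n^'n"
  assumes A: "pos_def A" and s: "s > 0"
  shows "mvn_density \<mu> (s *\<^sub>R matrix_inv A) x = gauss_prec \<mu> ((1 / s) *\<^sub>R A) x"
proof -
  have AB: "A ** matrix_inv A = mat 1" "matrix_inv A ** A = mat 1"
    using pos_def_inverse_vec[OF A] by (simp_all add: matrix_eq matrix_vector_mul_assoc[symmetric])
  have "matrix_inv (s *\<^sub>R matrix_inv A) = (1 / s) *\<^sub>R A"
  proof -
    have "(s *\<^sub>R matrix_inv A) ** ((1 / s) *\<^sub>R A) = mat 1" "((1 / s) *\<^sub>R A) ** (s *\<^sub>R matrix_inv A) = mat 1"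
      using s AB by (simp_all add: matrix_scalar_ac)
    then show ?thesis by (rule matrix_inv_unique)
  qed
  moreover have "det (s *\<^sub>R matrix_inv A) = 1 / det ((1 / s) *\<^sub>R A)"
  proof -
    have "det A * det (matrix_inv A) = 1" using AB(1) by (metis det_I det_mul)
    then show ?thesis using s gaussian_integral(1)[OF A] by (simp add: det_scaleR field_simps)
  qed
  ultimately show ?thesis by (simp add: mvn_density_def gauss_prec_def)
qed

section \<open>Inverse gamma and beta prime integrals\<close>

lemma nn_integral_scale_pos:
  fixes f :: "real \<Rightarrow> ennreal"
  assumes [measurable]: "f \<in> borel_measurable borel" and c: "c > 0"
  shows "(\<integral>\<^sup>+x\<in>{0<..}. f (c * x) \<partial>lborel) = ennreal (1 / c) * (\<integral>\<^sup>+x\<in>{0<..}. f x \<partial>lborel)"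
proof -
  have "(\<integral>\<^sup>+x\<in>{0<..}. f x \<partial>lborel) = ennreal c * (\<integral>\<^sup>+x. f (0 + c * x) * indicator {0<..} (0 + c * x) \<partial>lborel)"
    using nn_integral_real_affine[of "\<lambda>x. f x * indicator {0<..} x" c 0] c by simp
  also have "(\<integral>\<^sup>+x. f (0 + c * x) * indicator {0<..} (0 + c * x) \<partial>lborel) = (\<integral>\<^sup>+x\<in>{0<..}. f (c * x) \<partial>lborel)"
    using c by (intro nn_integral_cong) (auto simp: indicator_def zero_less_mult_iff)
  finally have "ennreal (1 / c) * (\<integral>\<^sup>+x\<in>{0<..}. f x \<partial>lborel)
      = (ennreal (1 / c) * ennreal c) * (\<integral>\<^sup>+x\<in>{0<..}. f (c * x) \<partial>lborel)"
    by (simp add: mult.assoc)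
  then show ?thesis using c by (simp add: ennreal_mult[symmetric])
qed

lemma nn_integral_Gamma:
  assumes a: "a > 0" and b: "b > (0::real)"
  shows "(\<integral>\<^sup>+t\<in>{0<..}. ennreal (t powr (a - 1) * exp (- (b * t))) \<partial>lborel) = ennreal (Gamma a * b powr (- a))"
proof -
  have "ennreal (Gamma a) = (\<integral>\<^sup>+t\<in>{0<..}. ennreal (t powr (a - 1) * exp (- t)) \<partial>lborel)"
    unfolding Gamma_conv_nn_integral_real[OF a]
    by (intro nn_integral_cong) (auto simp: indicator_def exp_minus field_simps order_le_less)
  then have "ennreal (b powr (1 - a)) * (ennreal (1 / b) * ennreal (Gamma a))
      = ennreal (b powr (1 - a)) * (\<integral>\<^sup>+t\<in>{0<..}. ennreal ((b * t) powr (a - 1) * exp (- (b * t))) \<partial>lborel)"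
    using b by (subst nn_integral_scale_pos[of "\<lambda>t. ennreal (t powr (a - 1) * exp (- t))"]) auto
  also have "\<dots> = (\<integral>\<^sup>+t\<in>{0<..}. ennreal (t powr (a - 1) * exp (- (b * t))) \<partial>lborel)"
    using b by (subst nn_integral_cmult[symmetric])
      (auto simp: indicator_def powr_mult ennreal_mult[symmetric] powr_add[symmetric] intro!: nn_integral_cong)
  also have "ennreal (b powr (1 - a)) * (ennreal (1 / b) * ennreal (Gamma a)) = ennreal (Gamma a * b powr (- a))"
    using a b by (simp add: ennreal_mult[symmetric] powr_diff powr_minus Gamma_real_pos field_simps)
  finally show ?thesis by simp
qed


text \<open>The Haar measure of the multiplicative group.  Averaging against \<open>y * exp (- y)\<close>
  reduces its invariance under inversion to the invariance under scaling.\<close>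

definition haar_pos :: "real measure" where
  "haar_pos = density lborel (\<lambda>x. indicator {0<..} x * ennreal (1 / x))"

lemma sets_haar_pos[simp, measurable_cong]: "sets haar_pos = sets borel"
  by (simp add: haar_pos_def)

lemma nn_integral_haar_pos:
  assumes [measurable]: "f \<in> borel_measurable borel"
  shows "(\<integral>\<^sup>+x. f x \<partial>haar_pos) = (\<integral>\<^sup>+x\<in>{0<..}. f x * ennreal (1 / x) \<partial>lborel)"
  unfolding haar_pos_def by (subst nn_integral_density) (auto simp: mult_ac)

lemma sigma_finite_haar_pos: "sigma_finite_measure haar_pos"
  unfolding haar_pos_def
  by (subst sigma_finite_measure.sigma_finite_iff_density_finite[OF sigma_finite_lborel]) (auto simp: indicator_def)

lemma nn_integral_haar_pos_scale:
  assumes [measurable]: "f \<in> borel_measurable borel" and c: "c > 0"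
  shows "(\<integral>\<^sup>+x. f (c * x) \<partial>haar_pos) = (\<integral>\<^sup>+x. f x \<partial>haar_pos)"
proof -
  have "(\<integral>\<^sup>+x. f (c * x) \<partial>haar_pos) = (\<integral>\<^sup>+x\<in>{0<..}. (f (c * x) * ennreal (c / (c * x))) \<partial>lborel)"
    using c by (subst nn_integral_haar_pos) (auto simp: indicator_def intro!: nn_integral_cong)
  also have "\<dots> = ennreal (1 / c) * (\<integral>\<^sup>+x\<in>{0<..}. (f x * ennreal (c / x)) \<partial>lborel)"
    using c by (intro nn_integral_scale_pos) auto
  also have "\<dots> = (\<integral>\<^sup>+x. ennreal (1 / c) * (f x * ennreal (c / x) * indicator {0<..} x) \<partial>lborel)"
    by (rule nn_integral_cmult[symmetric]) measurable
  also have "\<dots> = (\<integral>\<^sup>+x. f x \<partial>haar_pos)"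
  proof (subst nn_integral_haar_pos, simp, rule nn_integral_cong)
    fix x :: real
    have "ennreal (1 / c) * ennreal (c / x) = ennreal (1 / x)" if "x > 0"
      using c that by (simp add: ennreal_mult[symmetric])
    then show "ennreal (1 / c) * (f x * ennreal (c / x) * indicator {0<..} x) = f x * ennreal (1 / x) * indicator {0<..} x"
      by (cases "x > 0") (simp_all add: mult.left_commute[of _ "f x"] del: times_divide_eq_right)
  qed
  finally show ?thesis .
qed

lemma nn_integral_haar_pos_inverse:
  assumes [measurable]: "f \<in> borel_measurable borel"
  shows "(\<integral>\<^sup>+x. f (1 / x) \<partial>haar_pos) = (\<integral>\<^sup>+x. f x \<partial>haar_pos)"
proof -
  interpret haar: sigma_finite_measure haar_pos by (rule sigma_finite_haar_pos)
  interpret pair_sigma_finite haar_pos haar_pos ..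
  have AE0: "AE x in haar_pos. x > 0"
    unfolding haar_pos_def by (subst AE_density) (auto simp: indicator_def)
  define w where "w y = ennreal (y * exp (- y))" for y :: real
  have [measurable]: "w \<in> borel_measurable borel" unfolding w_def[abs_def] by measurable
  have "(\<integral>\<^sup>+y. w y \<partial>haar_pos) = (\<integral>\<^sup>+y\<in>{0<..}. ennreal (y powr (1 - 1) * exp (- (1 * y))) \<partial>lborel)"
    by (subst nn_integral_haar_pos) (auto simp: w_def ennreal_mult[symmetric] indicator_def intro!: nn_integral_cong)
  then have w1: "(\<integral>\<^sup>+y. w y \<partial>haar_pos) = 1" by (simp only: nn_integral_Gamma[of 1 1]) simp
  \<comment> \<open>Inserting \<open>w (x * y)\<close> costs nothing, because its Haar integral over
    \<open>y\<close> is 1. After the exchange of integrals, rescaling \<open>x\<close> turns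
    \<open>f (1 / x)\<close> into \<open>f (y / x)\<close>, whose integral over \<open>y\<close> is
    the same for every \<open>x\<close>.\<close>
  have "(\<integral>\<^sup>+x. f (1 / x) \<partial>haar_pos) = (\<integral>\<^sup>+x. \<integral>\<^sup>+y. f (1 / x) * w (x * y) \<partial>haar_pos \<partial>haar_pos)"
    using AE0 by (intro nn_integral_cong_AE)
      (auto elim!: AE_mp simp: nn_integral_cmult nn_integral_haar_pos_scale w1)
  also have "\<dots> = (\<integral>\<^sup>+y. \<integral>\<^sup>+x. f (1 / x) * w (x * y) \<partial>haar_pos \<partial>haar_pos)"
    by (rule Fubini') measurable
  also have "\<dots> = (\<integral>\<^sup>+y. \<integral>\<^sup>+x. f (y / x) * w x \<partial>haar_pos \<partial>haar_pos)"
  proof (rule nn_integral_cong_AE, rule AE_mp[OF AE0], intro AE_I2 impI)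
    fix y :: real assume "y > 0"
    then show "(\<integral>\<^sup>+x. f (1 / x) * w (x * y) \<partial>haar_pos) = (\<integral>\<^sup>+x. f (y / x) * w x \<partial>haar_pos)"
      using nn_integral_haar_pos_scale[of "\<lambda>x. f (y / x) * w x" y] by (simp add: mult.commute)
  qed
  also have "\<dots> = (\<integral>\<^sup>+x. \<integral>\<^sup>+y. f (y / x) * w x \<partial>haar_pos \<partial>haar_pos)"
    by (rule Fubini') measurable
  also have "\<dots> = (\<integral>\<^sup>+x. (\<integral>\<^sup>+y. f y \<partial>haar_pos) * w x \<partial>haar_pos)"
  proof (rule nn_integral_cong_AE, rule AE_mp[OF AE0], intro AE_I2 impI)
    fix x :: real assume "x > 0"
    then show "(\<integral>\<^sup>+y. f (y / x) * w x \<partial>haar_pos) = (\<integral>\<^sup>+y. f y \<partial>haar_pos) * w x"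
      using nn_integral_haar_pos_scale[of f "1 / x"] by (simp add: nn_integral_multc)
  qed
  also have "\<dots> = (\<integral>\<^sup>+y. f y \<partial>haar_pos)" by (simp add: nn_integral_cmult w1)
  finally show ?thesis .
qed

text \<open>Haar invariance is applied to \<open>f x * x\<close>: this factor cancels the Haar
  weight on one side, and on the other it becomes \<open>1 / x\<close> and completes the
  Jacobian.\<close>

lemma nn_integral_inverse_pos:
  fixes f :: "real \<Rightarrow> ennreal"
  assumes [measurable]: "f \<in> borel_measurable borel"
  shows "(\<integral>\<^sup>+x\<in>{0<..}. f (1 / x) * ennreal (1 / x\<^sup>2) \<partial>lborel) = (\<integral>\<^sup>+x\<in>{0<..}. f x \<partial>lborel)"
proof -
  have "(\<integral>\<^sup>+x. f (1 / x) * ennreal (1 / x) \<partial>haar_pos) = (\<integral>\<^sup>+x\<in>{0<..}. f (1 / x) * ennreal (1 / x\<^sup>2) \<partial>lborel)"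
    by (subst nn_integral_haar_pos)
      (auto simp: indicator_def mult.assoc ennreal_mult[symmetric] power2_eq_square intro!: nn_integral_cong)
  moreover have "(\<integral>\<^sup>+x. f x * ennreal x \<partial>haar_pos) = (\<integral>\<^sup>+x\<in>{0<..}. f x \<partial>lborel)"
    by (subst nn_integral_haar_pos)
      (auto simp: indicator_def mult.assoc ennreal_mult[symmetric] intro!: nn_integral_cong)
  ultimately show ?thesis
    using nn_integral_haar_pos_inverse[of "\<lambda>x. f x * ennreal x"] by simp
qed

section \<open>Inverse gamma moments, Laplace transforms and the beta prime integral\<close>

lemma ig_density_nonneg: "\<alpha> > 0 \<Longrightarrow> 0 \<le> ig_density \<alpha> \<beta> x"
  by (simp add: ig_density_def Gamma_real_pos less_imp_le)

text \<open>The reciprocal of an inverse gamma variable is gamma distributed, so the moment is a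
  ratio of two Gamma integrals.\<close>

lemma nn_integral_ig_powr:
  assumes \<alpha>: "\<alpha> > 0" and \<beta>: "\<beta> > 0" and e: "\<alpha> + e > 0"
  shows "(\<integral>\<^sup>+x. ennreal (ig_density \<alpha> \<beta> x) * ennreal (x powr (- e)) \<partial>lborel)
    = ennreal (Gamma (\<alpha> + e) / Gamma \<alpha> * \<beta> powr (- e))"
proof -
  define f where "f t = ennreal (\<beta> powr \<alpha> / Gamma \<alpha>) * ennreal (t powr (\<alpha> + e - 1) * exp (- (\<beta> * t)))" for t :: real
  have [measurable]: "f \<in> borel_measurable borel" unfolding f_def[abs_def] by measurable
  note G = Gamma_real_pos[OF \<alpha>]
  have "ennreal (ig_density \<alpha> \<beta> x) * ennreal (x powr (- e)) = f (1 / x) * ennreal (1 / x\<^sup>2)" if "x > 0" for x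
  proof -
    have inv: "(1 / x) powr b = x powr (- b)" for b
      using that by (simp add: powr_minus_divide powr_divide)
    have "1 / x\<^sup>2 = x powr (- 2)" using that by (simp add: powr_minus_divide)
    then have "x powr (- \<alpha> - 1) * x powr (- e) = (1 / x) powr (\<alpha> + e - 1) * (1 / x\<^sup>2)"
      unfolding inv by (simp only: powr_add[symmetric]) (rule arg_cong[where f = "\<lambda>b. x powr b"], simp)
    moreover have "(\<beta> powr \<alpha> * x powr (- \<alpha> - 1) * exp (- \<beta> / x) / Gamma \<alpha>) * x powr (- e)
      = \<beta> powr \<alpha> / Gamma \<alpha> * exp (- \<beta> / x) * (x powr (- \<alpha> - 1) * x powr (- e))" by simp
    ultimately have "(\<beta> powr \<alpha> * x powr (- \<alpha> - 1) * exp (- \<beta> / x) / Gamma \<alpha>) * x powr (- e)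
      = \<beta> powr \<alpha> / Gamma \<alpha> * ((1 / x) powr (\<alpha> + e - 1) * exp (- (\<beta> * (1 / x)))) * (1 / x\<^sup>2)"
      by (simp only:) simp
    then show ?thesis
      using that G by (simp add: f_def ig_density_def ennreal_mult[symmetric] del: times_divide_eq_right times_divide_eq_left)
  qed
  then have "(\<integral>\<^sup>+x. ennreal (ig_density \<alpha> \<beta> x) * ennreal (x powr (- e)) \<partial>lborel)
      = (\<integral>\<^sup>+x\<in>{0<..}. f (1 / x) * ennreal (1 / x\<^sup>2) \<partial>lborel)"
    by (intro nn_integral_cong) (auto simp: indicator_def ig_density_def)
  also have "\<dots> = (\<integral>\<^sup>+t\<in>{0<..}. f t \<partial>lborel)" by (rule nn_integral_inverse_pos) measurable
  also have "\<dots> = ennreal (\<beta> powr \<alpha> / Gamma \<alpha>) * ennreal (Gamma (\<alpha> + e) * \<beta> powr (- (\<alpha> + e)))"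
    unfolding nn_integral_Gamma[OF e \<beta>, symmetric] f_def mult.assoc by (rule nn_integral_cmult) measurable
  also have "\<dots> = ennreal (Gamma (\<alpha> + e) / Gamma \<alpha> * \<beta> powr (- e))"
  proof -
    have "\<beta> powr \<alpha> * \<beta> powr (- (\<alpha> + e)) = \<beta> powr (- e)" by (simp add: powr_add[symmetric])
    then have "\<beta> powr \<alpha> / Gamma \<alpha> * (Gamma (\<alpha> + e) * \<beta> powr (- (\<alpha> + e))) = Gamma (\<alpha> + e) / Gamma \<alpha> * \<beta> powr (- e)"
      by simp
    then show ?thesis using G Gamma_real_pos[OF e] by (subst ennreal_mult[symmetric]) auto
  qed
  finally show ?thesis .
qed

lemma measurable_ig_density[measurable (raw)]:
  assumes [measurable]: "f \<in> borel_measurable M" "g \<in> borel_measurable M"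
  shows "(\<lambda>x. ig_density \<alpha> (f x) (g x)) \<in> borel_measurable M"
  unfolding ig_density_def by measurable

lemma nn_integral_ig:
  "\<alpha> > 0 \<Longrightarrow> \<beta> > 0 \<Longrightarrow> (\<integral>\<^sup>+x. ennreal (ig_density \<alpha> \<beta> x) \<partial>lborel) = 1"
proof -
  assume \<alpha>: "\<alpha> > 0" and \<beta>: "\<beta> > 0"
  have "(\<integral>\<^sup>+x. ennreal (ig_density \<alpha> \<beta> x) \<partial>lborel) = (\<integral>\<^sup>+x. ennreal (ig_density \<alpha> \<beta> x) * ennreal (x powr (- 0)) \<partial>lborel)"
    by (intro nn_integral_cong) (auto simp: ig_density_def)
  then show ?thesis using nn_integral_ig_powr[of \<alpha> \<beta> 0] \<alpha> \<beta> Gamma_real_pos[OF \<alpha>] by simp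
qed

text \<open>This is the Laplace transform of the reciprocal variable, which is exponential with rate
  \<open>q\<close>: the extra factor only shifts the rate to \<open>q + w\<close>.\<close>

lemma nn_integral_ig_exp:
  assumes q: "q > 0" and w: "w \<ge> 0"
  shows "(\<integral>\<^sup>+x. ennreal (ig_density 1 q x) * ennreal (exp (- (w / x))) \<partial>lborel) = ennreal (q / (q + w))"
proof -
  have "(\<integral>\<^sup>+x. ennreal (ig_density 1 q x) * ennreal (exp (- (w / x))) \<partial>lborel)
      = (\<integral>\<^sup>+x. ennreal (q / (q + w)) * ennreal (ig_density 1 (q + w) x) \<partial>lborel)"
  proof (rule nn_integral_cong)
    fix x :: real
    have "exp (- q / x) * exp (- (w / x)) = exp (- (q + w) / x)"
      by (simp add: exp_add[symmetric] diff_divide_distrib)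
    then have "ig_density 1 q x * exp (- (w / x)) = q / (q + w) * ig_density 1 (q + w) x"
      using q w by (simp add: ig_density_def)
    then show "ennreal (ig_density 1 q x) * ennreal (exp (- (w / x))) = ennreal (q / (q + w)) * ennreal (ig_density 1 (q + w) x)"
      using q w by (simp add: ennreal_mult[symmetric] ig_density_nonneg)
  qed
  also have "\<dots> = ennreal (q / (q + w))"
    using q w nn_integral_ig[of 1 "q + w"] by (subst nn_integral_cmult) auto
  finally show ?thesis .
qed

text \<open>Writing \<open>(1 + s * l) powr (- w)\<close> as a Gamma integral over \<open>v\<close>
  and exchanging the order leaves a Gamma integral in \<open>s\<close>, followed by another one in
  \<open>v\<close>; convergence of the latter requires \<open>d < w\<close>.\<close>

lemma nn_integral_beta_prime:
  assumes d: "0 < d" "d < w" and l: "l > 0"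
  shows "(\<integral>\<^sup>+s\<in>{0<..}. ennreal (s powr (d - 1) * (1 + s * l) powr (- w)) \<partial>lborel)
    = ennreal (l powr (- d) * Gamma d * Gamma (w - d) / Gamma w)"
proof -
  have w: "w > 0" using d by simp
  note G = Gamma_real_pos[OF w] Gamma_real_pos[OF d(1)]
  have "ennreal (Gamma w) * (\<integral>\<^sup>+s\<in>{0<..}. ennreal (s powr (d - 1) * (1 + s * l) powr (- w)) \<partial>lborel)
    = (\<integral>\<^sup>+s. \<integral>\<^sup>+v. ennreal (s powr (d - 1) * v powr (w - 1) * exp (- ((1 + s * l) * v))) * indicator {0<..} v * indicator {0<..} s \<partial>lborel \<partial>lborel)"
  proof (subst nn_integral_cmult[symmetric], measurable, rule nn_integral_cong)
    fix s :: real
    have "ennreal (Gamma w) * ennreal (s powr (d - 1) * (1 + s * l) powr (- w))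
      = ennreal (s powr (d - 1)) * (\<integral>\<^sup>+v\<in>{0<..}. ennreal (v powr (w - 1) * exp (- ((1 + s * l) * v))) \<partial>lborel)" if "s > 0"
    proof -
      have "1 + s * l > 0" using that l by (simp add: add_pos_pos)
      then show ?thesis using G w by (subst nn_integral_Gamma) (auto simp: ennreal_mult[symmetric] mult.left_commute)
    qed
    also have "ennreal (s powr (d - 1)) * (\<integral>\<^sup>+v\<in>{0<..}. ennreal (v powr (w - 1) * exp (- ((1 + s * l) * v))) \<partial>lborel)
      = (\<integral>\<^sup>+v\<in>{0<..}. ennreal (s powr (d - 1) * v powr (w - 1) * exp (- ((1 + s * l) * v))) \<partial>lborel)"
      by (subst nn_integral_cmult[symmetric]) (auto simp: ennreal_mult mult.assoc intro!: nn_integral_cong)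
    finally show "ennreal (Gamma w) * (ennreal (s powr (d - 1) * (1 + s * l) powr (- w)) * indicator {0<..} s)
      = (\<integral>\<^sup>+v. ennreal (s powr (d - 1) * v powr (w - 1) * exp (- ((1 + s * l) * v))) * indicator {0<..} v * indicator {0<..} s \<partial>lborel)"
      by (cases "s > 0") (auto simp: mult.assoc[symmetric])
  qed
  also have "\<dots> = (\<integral>\<^sup>+v. \<integral>\<^sup>+s. ennreal (s powr (d - 1) * v powr (w - 1) * exp (- ((1 + s * l) * v))) * indicator {0<..} v * indicator {0<..} s \<partial>lborel \<partial>lborel)"
    by (rule lborel_pair.Fubini') measurable
  also have "\<dots> = (\<integral>\<^sup>+v\<in>{0<..}. ennreal (Gamma d * l powr (- d)) * ennreal (v powr (w - d - 1) * exp (- (1 * v))) \<partial>lborel)"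
  proof (rule nn_integral_cong)
    fix v :: real
    have split: "s powr (d - 1) * v powr (w - 1) * exp (- ((1 + s * l) * v))
        = (v powr (w - 1) * exp (- v)) * (s powr (d - 1) * exp (- ((l * v) * s)))" for s
      by (simp add: exp_add[symmetric] algebra_simps)
    have "(\<integral>\<^sup>+s. ennreal (s powr (d - 1) * v powr (w - 1) * exp (- ((1 + s * l) * v))) * indicator {0<..} v * indicator {0<..} s \<partial>lborel)
      = ennreal (v powr (w - 1) * exp (- v)) * (\<integral>\<^sup>+s\<in>{0<..}. ennreal (s powr (d - 1) * exp (- ((l * v) * s))) \<partial>lborel)" if "v > 0"
      using that unfolding split by (subst nn_integral_cmult[symmetric])
        (auto simp: ennreal_mult mult.assoc intro!: nn_integral_cong)
    also have "ennreal (v powr (w - 1) * exp (- v)) * (\<integral>\<^sup>+s\<in>{0<..}. ennreal (s powr (d - 1) * exp (- ((l * v) * s))) \<partial>lborel)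
      = ennreal (Gamma d * l powr (- d)) * ennreal (v powr (w - d - 1) * exp (- (1 * v)))" if "v > 0"
    proof -
      have "v powr (w - 1) * v powr (- d) = v powr (w - d - 1)" by (simp add: powr_add[symmetric] algebra_simps)
      then have "v powr (w - 1) * exp (- v) * (Gamma d * (l * v) powr (- d)) = Gamma d * l powr (- d) * (v powr (w - d - 1) * exp (- (1 * v)))"
        using l that by (simp add: powr_mult)
      then show ?thesis using that l d G by (subst nn_integral_Gamma) (auto simp: ennreal_mult[symmetric])
    qed
    finally show "(\<integral>\<^sup>+s. ennreal (s powr (d - 1) * v powr (w - 1) * exp (- ((1 + s * l) * v))) * indicator {0<..} v * indicator {0<..} s \<partial>lborel)
      = ennreal (Gamma d * l powr (- d)) * ennreal (v powr (w - d - 1) * exp (- (1 * v))) * indicator {0<..} v"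
      by (cases "v > 0") auto
  qed
  also have "\<dots> = ennreal (Gamma d * l powr (- d)) * ennreal (Gamma (w - d) * 1 powr (- (w - d)))"
    unfolding mult.assoc by (subst nn_integral_cmult, measurable, subst nn_integral_Gamma) (use d in auto)
  finally have *: "ennreal (Gamma w) * (\<integral>\<^sup>+s\<in>{0<..}. ennreal (s powr (d - 1) * (1 + s * l) powr (- w)) \<partial>lborel)
     = ennreal (Gamma d * l powr (- d)) * ennreal (Gamma (w - d) * 1 powr (- (w - d)))" .
  have "(\<integral>\<^sup>+s\<in>{0<..}. ennreal (s powr (d - 1) * (1 + s * l) powr (- w)) \<partial>lborel)
     = ennreal (1 / Gamma w) * (ennreal (Gamma w) * (\<integral>\<^sup>+s\<in>{0<..}. ennreal (s powr (d - 1) * (1 + s * l) powr (- w)) \<partial>lborel))"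
    using G by (simp add: mult.assoc[symmetric] ennreal_mult[symmetric])
  also have "\<dots> = ennreal (l powr (- d) * Gamma d * Gamma (w - d) / Gamma w)"
    unfolding * using G Gamma_real_pos[of "w - d"] d by (simp add: ennreal_mult[symmetric] field_simps)
  finally show ?thesis .
qed

section \<open>The conditional law of the global scale\<close>

lemma nn_integral_pi_tau_kernel:
  assumes "a > 0" "b > 0" "c > (0::real)"
  shows "(\<integral>\<^sup>+t\<in>{0<..}. ennreal (t powr (a - 1) * (c + t) powr (-(a + b))) \<partial>lborel)
    = ennreal (c powr (- b) * Gamma a * Gamma b / Gamma (a + b))"
proof -
  have eq: "t powr (a - 1) * (c + t) powr (-(a + b)) = c powr (-(a + b)) * (t powr (a - 1) * (1 + t * (1 / c)) powr (-(a + b)))" if "t > 0" for t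
  proof -
    have "c + t = c * (1 + t * (1 / c))" using assms by (simp add: field_simps)
    then have "(c + t) powr (-(a + b)) = c powr (-(a + b)) * (1 + t * (1 / c)) powr (-(a + b))"
      using that assms by (metis powr_mult)
    then show ?thesis by simp
  qed
  have "(\<integral>\<^sup>+t\<in>{0<..}. ennreal (t powr (a - 1) * (c + t) powr (-(a + b))) \<partial>lborel)
    = (\<integral>\<^sup>+t. ennreal (c powr (-(a + b))) * (ennreal (t powr (a - 1) * (1 + t * (1 / c)) powr (-(a + b))) * indicator {0<..} t) \<partial>lborel)"
    by (intro nn_integral_cong) (auto simp: indicator_def eq ennreal_mult[symmetric] simp del: minus_add_distrib)
  also have "\<dots> = ennreal (c powr (-(a + b))) * ennreal ((1 / c) powr (- a) * Gamma a * Gamma (a + b - a) / Gamma (a + b))"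
    using assms by (subst nn_integral_cmult, measurable, subst nn_integral_beta_prime) auto
  also have "\<dots> = ennreal (c powr (-(a + b)) * ((1 / c) powr (- a) * Gamma a * Gamma (a + b - a) / Gamma (a + b)))"
    using assms by (intro ennreal_mult[symmetric]) (auto simp: Gamma_real_pos less_imp_le)
  also have "(1 / c) powr (- a) = c powr a" using assms by (simp add: powr_minus_divide powr_divide)
  also have "c powr (-(a + b)) * (c powr a * Gamma a * Gamma (a + b - a) / Gamma (a + b))
     = (c powr (-(a + b)) * c powr a) * Gamma a * Gamma b / Gamma (a + b)" by simp
  also have "c powr (-(a + b)) * c powr a = c powr (- b)" by (simp add: powr_add[symmetric])
  finally show ?thesis .
qed

lemma C_abc_pos:
  assumes "a > 0" "b > 0" "c > (0::real)"
  shows "C_abc a b c > 0"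
proof -
  have "ennreal (indicator {0<..} t * (t powr (a - 1) * (c + t) powr (-(a + b))))
      = ennreal (t powr (a - 1) * (c + t) powr (-(a + b))) * indicator {0<..} t" for t
    by (auto simp: indicator_def)
  then have "C_abc a b c = c powr (- b) * Gamma a * Gamma b / Gamma (a + b)"
    unfolding C_abc_def using assms
    by (subst integral_eq_nn_integral) (simp_all add: nn_integral_pi_tau_kernel Gamma_real_pos less_imp_le del: ennreal_indicator minus_add_distrib)
  then show ?thesis using assms by (simp add: Gamma_real_pos)
qed

lemma pi_tau_nonneg: "a > 0 \<Longrightarrow> b > 0 \<Longrightarrow> c > 0 \<Longrightarrow> 0 \<le> pi_tau a b c t"
  using C_abc_pos[of a b c] by (simp add: pi_tau_def)

lemma measurable_pi_tau[measurable]: "pi_tau a b c \<in> borel_measurable borel"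
  unfolding pi_tau_def[abs_def] by measurable

lemma nn_integral_pi_tau:
  assumes "a > 0" "b > 0" "c > (0::real)"
  shows "(\<integral>\<^sup>+t. ennreal (pi_tau a b c t) \<partial>lborel) < \<infinity>"
proof -
  note C = C_abc_pos[OF assms]
  have "(\<integral>\<^sup>+t. ennreal (pi_tau a b c t) \<partial>lborel)
      = (\<integral>\<^sup>+t. ennreal (1 / C_abc a b c) * (ennreal (t powr (a - 1) * (c + t) powr (-(a + b))) * indicator {0<..} t) \<partial>lborel)"
    using C by (intro nn_integral_cong) (auto simp: pi_tau_def indicator_def ennreal_mult[symmetric])
  also have "\<dots> < \<infinity>"
    using assms by (subst nn_integral_cmult, measurable, subst nn_integral_pi_tau_kernel) (auto simp: ennreal_mult_less_top)
  finally show ?thesis .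
qed

text \<open>The double sum of \<open>(w j - w k) * (u j - u k)\<close> is nonnegative term by term.
  A pairwise sign condition takes the place of monotone sequences, since the coordinates of
  \<open>lam\<close> come in no particular order.\<close>

lemma chebyshev_sum_finite:
  fixes w u :: "'i \<Rightarrow> real"
  assumes "\<And>j k. j \<in> I \<Longrightarrow> k \<in> I \<Longrightarrow> 0 \<le> (w j - w k) * (u j - u k)"
  shows "(\<Sum>k\<in>I. w k) * (\<Sum>k\<in>I. u k) \<le> real (card I) * (\<Sum>k\<in>I. w k * u k)"
proof -
  have "0 \<le> (\<Sum>j\<in>I. \<Sum>k\<in>I. (w j - w k) * (u j - u k))"
    by (intro sum_nonneg assms)
  also have "\<dots> = (\<Sum>j\<in>I. \<Sum>k\<in>I. w j * u j) - (\<Sum>j\<in>I. \<Sum>k\<in>I. w j * u k)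
      - (\<Sum>j\<in>I. \<Sum>k\<in>I. u j * w k) + (\<Sum>j\<in>I. \<Sum>k\<in>I. w k * u k)"
    by (simp only: left_diff_distrib right_diff_distrib sum_subtractf mult.commute[of "u _" "w _"])
  also have "\<dots> = 2 * (real (card I) * (\<Sum>k\<in>I. w k * u k)) - 2 * ((\<Sum>k\<in>I. w k) * (\<Sum>k\<in>I. u k))"
  proof -
    have "(\<Sum>j\<in>I. \<Sum>k\<in>I. w j * u j) = real (card I) * (\<Sum>k\<in>I. w k * u k)"
      by (simp add: sum_distrib_left)
    then show ?thesis unfolding sum_product[symmetric] by (simp add: mult.commute[of "sum u I"])
  qed
  finally show ?thesis by simp
qed

locale tau_law =
  fixes a b c :: real and lam :: "real^'p"
  assumes a: "a > 0" and b: "b > 0" and c: "c > 0" and lam: "\<And>k. lam $ k > 0"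
begin

abbreviation (input) "f \<equiv> tau_unnorm a b c lam"

lemma measurable_f[measurable]: "f \<in> borel_measurable borel"
  unfolding tau_unnorm_def[abs_def] by measurable

lemma f_nonneg: "0 \<le> f t"
  using pi_tau_nonneg[OF a b c, of t] lam by (auto simp: tau_unnorm_def intro!: mult_nonneg_nonneg prod_nonneg divide_nonneg_pos add_pos_pos)

lemma f_pos: "t > 0 \<Longrightarrow> f t > 0"
  using C_abc_pos[OF a b c] a b c lam
  by (auto simp: tau_unnorm_def pi_tau_def add_pos_pos intro!: mult_pos_pos prod_pos divide_pos_pos)

text \<open>By the arithmetic-geometric mean inequality each factor of the product is bounded in
  \<open>t\<close>, so the prior dominates. This yields integrability, the decay at both ends in the
  integration by parts, and an upper bound for the normaliser that the minorization uses.\<close>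

lemma f_le: "f t \<le> pi_tau a b c t * (\<Prod>k\<in>UNIV. 1 / (2 * sqrt (lam $ k)))"
proof (cases "t > 0")
  case True
  have "t powr (1/2) / (lam $ k + t) \<le> 1 / (2 * sqrt (lam $ k))" for k
  proof -
    have "2 * sqrt (lam $ k) * sqrt t \<le> lam $ k + t"
      using sum_squares_ge_zero[of "sqrt (lam $ k) - sqrt t" 0] lam[of k] True
      by (simp add: power2_eq_square[symmetric] power2_diff)
    then show ?thesis using True lam[of k] by (simp add: powr_half_sqrt field_simps)
  qed
  then show ?thesis
    using True lam pi_tau_nonneg[OF a b c, of t] unfolding tau_unnorm_def
    by (auto intro!: mult_left_mono prod_mono divide_nonneg_pos add_pos_pos)
next
  case False
  have "0 \<le> (\<Prod>k\<in>UNIV. 1 / (2 * sqrt (lam $ k)))"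
    using lam by (intro prod_nonneg) (auto simp: less_imp_le)
  then show ?thesis using False pi_tau_nonneg[OF a b c, of t] by (simp add: tau_unnorm_def)
qed

lemma f_integrable: "integrable lborel f"
proof -
  have "integrable lborel (pi_tau a b c)"
    using nn_integral_pi_tau[OF a b c] pi_tau_nonneg[OF a b c] by (intro integrableI_nonneg) auto
  then have "integrable lborel (\<lambda>t. pi_tau a b c t * (\<Prod>k\<in>UNIV. 1 / (2 * sqrt (lam $ k))))" by simp
  then show ?thesis
  proof (rule Bochner_Integration.integrable_bound)
    have "norm (f t) \<le> norm (pi_tau a b c t * (\<Prod>k\<in>UNIV. 1 / (2 * sqrt (lam $ k))))" for t
      using order_trans[OF f_le abs_ge_self, of t] f_nonneg[of t] by simp
    then show "AE t in lborel. norm (f t) \<le> norm (pi_tau a b c t * (\<Prod>k\<in>UNIV. 1 / (2 * sqrt (lam $ k))))" by simp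
  qed simp
qed

definition "Z = (\<integral>t. f t \<partial>lborel)"

lemma Z_pos: "Z > 0"
proof -
  have "Z \<noteq> 0"
  proof
    assume "Z = 0"
    then have "AE t in lborel. f t = 0"
      using integral_nonneg_eq_0_iff_AE[OF f_integrable] f_nonneg by (simp add: Z_def)
    then have "AE t in lborel. t \<notin> {0<..<1::real}" by (rule eventually_mono) (use f_pos in force)
    moreover have "{t::real. 0 < t \<and> t < 1} = {0<..<1}" by auto
    ultimately have "emeasure lborel {0<..<1::real} = 0"
      by (subst (asm) AE_iff_measurable[OF _ refl]) auto
    then show False by simp
  qed
  moreover have "Z \<ge> 0" unfolding Z_def by (intro integral_nonneg_AE) (simp add: f_nonneg)
  ultimately show ?thesis by simp
qed

lemma Z_le: "Z \<le> (\<integral>t. pi_tau a b c t \<partial>lborel) * (\<Prod>k\<in>UNIV. 1 / (2 * sqrt (lam $ k)))"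
proof -
  have "integrable lborel (pi_tau a b c)"
    using nn_integral_pi_tau[OF a b c] pi_tau_nonneg[OF a b c] by (intro integrableI_nonneg) auto
  then have "Z \<le> (\<integral>t. pi_tau a b c t * (\<Prod>k\<in>UNIV. 1 / (2 * sqrt (lam $ k))) \<partial>lborel)"
    unfolding Z_def by (intro integral_mono f_integrable f_le) simp
  then show ?thesis by simp
qed

lemma tau_density_eq: "tau_density a b c lam t = f t / Z"
  by (simp add: tau_density_def Z_def)

lemma tau_density_nonneg: "0 \<le> tau_density a b c lam t"
  using f_nonneg Z_pos by (simp add: tau_density_eq)

lemma measurable_tau_density1[measurable]: "tau_density a b c lam \<in> borel_measurable borel"
  unfolding tau_density_eq[abs_def] by measurable

definition "T = density lborel (\<lambda>t. ennreal (tau_density a b c lam t))"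

lemma sets_T[simp, measurable_cong]: "sets T = sets borel" by (simp add: T_def)

lemma prob_T: "prob_space T"
proof (rule prob_spaceI)
  have "(\<integral>\<^sup>+t. ennreal (tau_density a b c lam t) \<partial>lborel) = ennreal (\<integral>t. tau_density a b c lam t \<partial>lborel)"
    using f_integrable by (intro nn_integral_eq_integral) (auto simp: tau_density_eq[abs_def] f_nonneg Z_pos less_imp_le)
  also have "(\<integral>t. tau_density a b c lam t \<partial>lborel) = 1"
    using Z_pos by (simp add: tau_density_eq Z_def[symmetric])
  finally show "emeasure T (space T) = 1"
    by (simp add: T_def emeasure_density)
qed

lemma AE_T_pos: "AE t in T. t > 0"
  unfolding T_def by (subst AE_density) (auto simp: tau_density_eq tau_unnorm_def)

sublocale T: prob_space T by (rule prob_T)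

lemma T_integrable_bounded:
  fixes h :: "real \<Rightarrow> real"
  assumes "h \<in> borel_measurable borel" "\<And>t. t > 0 \<Longrightarrow> \<bar>h t\<bar> \<le> B"
  shows "integrable T h"
  using assms AE_T_pos by (intro T.integrable_const_bound[where B = B]) (auto elim!: eventually_mono)

lemma T_integral_mono:
  fixes h g :: "real \<Rightarrow> real"
  assumes "integrable T h" "integrable T g" "\<And>t. t > 0 \<Longrightarrow> h t \<le> g t"
  shows "(\<integral>t. h t \<partial>T) \<le> (\<integral>t. g t \<partial>T)"
  using assms AE_T_pos by (intro integral_mono_AE) (auto elim!: eventually_mono)

text \<open>The integrand is, up to normalisation, the derivative of \<open>t * f t * (\<tau> / (\<tau> + t)) powr \<epsilon>\<close>,
  which vanishes at both ends of the half line.\<close>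

lemma integration_by_parts:
  assumes \<tau>: "\<tau> > 0" and \<epsilon>: "\<epsilon> \<ge> 0"
  shows "(\<integral>t. (\<tau> / (\<tau> + t)) powr \<epsilon> * (a + real CARD('p) / 2 - (a + b) * (t / (c + t)) - \<epsilon> * (t / (\<tau> + t))
       - (\<Sum>k\<in>UNIV. t / (t + lam $ k))) \<partial>T) = 0"
proof -
  define p where "p = real CARD('p)"
  define C where "C = C_abc a b c"
  have C0: "C > 0" unfolding C_def by (rule C_abc_pos[OF a b c])
  define \<phi> where "\<phi> t = (\<tau> / (\<tau> + t)) powr \<epsilon>" for t
  \<comment> \<open>\<open>exp (L t) / C\<close> equals \<open>t * f t * \<phi> t\<close>; the term
    \<open>p / 2\<close> collects the square roots of \<open>t\<close> from the product. The extra
    factor \<open>t\<close> makes the logarithmic derivative \<open>t * L'(t)\<close> equal to the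
    bounded function \<open>B\<close>.\<close>
  define L where "L t = (a + p / 2) * ln t - (a + b) * ln (c + t) - (\<Sum>k\<in>UNIV. ln (lam $ k + t)) + \<epsilon> * (ln \<tau> - ln (\<tau> + t))" for t
  define B where "B t = a + p / 2 - (a + b) * (t / (c + t)) - \<epsilon> * (t / (\<tau> + t)) - (\<Sum>k\<in>UNIV. t / (t + lam $ k))" for t
  define F where "F t = exp (L t) / C" for t
  have \<phi>01: "0 \<le> \<phi> t" "\<phi> t \<le> 1" if "t > 0" for t
    using that \<tau> \<epsilon> by (auto simp: \<phi>_def intro!: powr_le1)
  have expL: "exp (L t) = t powr (a + p / 2) * (c + t) powr (-(a + b)) * (\<Prod>k\<in>UNIV. 1 / (lam $ k + t)) * \<phi> t" if "t > 0" for t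
  proof -
    have "exp (- (\<Sum>k\<in>UNIV. ln (lam $ k + t))) = (\<Prod>k\<in>UNIV. 1 / (lam $ k + t))"
      using lam that by (simp add: sum_negf[symmetric] exp_sum exp_minus inverse_eq_divide add_pos_pos)
    moreover have "\<phi> t = exp (\<epsilon> * (ln \<tau> - ln (\<tau> + t)))"
      using that \<tau> by (simp add: \<phi>_def powr_def ln_div)
    moreover have "L t = (a + p / 2) * ln t + (-(a + b)) * ln (c + t) + (- (\<Sum>k\<in>UNIV. ln (lam $ k + t))) + \<epsilon> * (ln \<tau> - ln (\<tau> + t))"
      by (simp add: L_def algebra_simps)
    moreover have "t powr (a + p / 2) = exp ((a + p / 2) * ln t)" "(c + t) powr (-(a + b)) = exp ((-(a + b)) * ln (c + t))"
      using that c by (simp_all add: powr_def)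
    ultimately show ?thesis by (simp only: exp_add)
  qed
  have tf: "F t = t * f t * \<phi> t" if "t > 0" for t
  proof -
    have "t powr (a + p / 2) = t * t powr (a - 1) * (\<Prod>k\<in>(UNIV::'p set). t powr (1/2))"
    proof -
      have "(\<Prod>k\<in>(UNIV::'p set). t powr (1/2)) = t powr (p / 2)"
        using that by (simp add: p_def powr_realpow[symmetric] powr_powr)
      moreover have "t * t powr (a - 1) = t powr a" using that by (simp add: powr_diff)
      ultimately show ?thesis by (simp add: powr_add)
    qed
    then show ?thesis
      using that unfolding F_def expL[OF that]
      by (simp add: tau_unnorm_def pi_tau_def C_def[symmetric] prod_dividef mult_ac)
  qed
  have der: "(F has_real_derivative f t * \<phi> t * B t) (at t)" if "t > 0" for t
  proof -
    have ln1: "((\<lambda>t. ln (q + t)) has_real_derivative 1 / (q + t)) (at t)" if "q > 0" for q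
      using that \<open>t > 0\<close> by (auto intro!: derivative_eq_intros)
    have "(L has_real_derivative (a + p / 2) * (1 / t) - (a + b) * (1 / (c + t)) - (\<Sum>k\<in>UNIV. 1 / (lam $ k + t)) + \<epsilon> * (0 - 1 / (\<tau> + t))) (at t)"
      unfolding L_def[abs_def] using that c \<tau> lam
      by (intro DERIV_diff DERIV_add DERIV_cmult DERIV_sum DERIV_const ln1 DERIV_ln_divide)
    then have "(L has_real_derivative (a + p / 2) / t - (a + b) / (c + t) - (\<Sum>k\<in>UNIV. 1 / (lam $ k + t)) - \<epsilon> / (\<tau> + t)) (at t)"
      by simp
        then have "(F has_real_derivative exp (L t) * ((a + p / 2) / t - (a + b) / (c + t) - (\<Sum>k\<in>UNIV. 1 / (lam $ k + t)) - \<epsilon> / (\<tau> + t)) / C) (at t)"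
      unfolding F_def[abs_def] by (intro DERIV_cdivide DERIV_chain2[OF DERIV_exp])
    also have "exp (L t) * ((a + p / 2) / t - (a + b) / (c + t) - (\<Sum>k\<in>UNIV. 1 / (lam $ k + t)) - \<epsilon> / (\<tau> + t)) / C
       = F t / t * (t * ((a + p / 2) / t - (a + b) / (c + t) - (\<Sum>k\<in>UNIV. 1 / (lam $ k + t)) - \<epsilon> / (\<tau> + t)))"
      using that by (simp add: F_def)
    also have "t * ((a + p / 2) / t - (a + b) / (c + t) - (\<Sum>k\<in>UNIV. 1 / (lam $ k + t)) - \<epsilon> / (\<tau> + t)) = B t"
      using that by (simp add: B_def right_diff_distrib sum_distrib_left add.commute mult.commute)
    also have "F t / t = f t * \<phi> t" using that by (simp add: tf)
    finally show ?thesis .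
  qed
  have Bb: "\<bar>B t\<bar> \<le> (a + p / 2) + (a + b) + \<epsilon> + p" if "t > 0" for t
  proof -
    have 1: "0 \<le> t / (c + t)" "t / (c + t) \<le> 1" "0 \<le> t / (\<tau> + t)" "t / (\<tau> + t) \<le> 1"
      using that c \<tau> by auto
    have "0 \<le> (\<Sum>k\<in>UNIV. t / (t + lam $ k))" using that lam by (intro sum_nonneg) (auto intro!: divide_nonneg_pos add_pos_pos)
    moreover have "(\<Sum>k\<in>(UNIV::'p set). t / (t + lam $ k)) \<le> (\<Sum>k\<in>(UNIV::'p set). 1)"
      using that lam by (intro sum_mono) (auto simp: divide_le_eq add_pos_pos less_imp_le)
    moreover have "0 \<le> (a + b) * (t / (c + t))" "(a + b) * (t / (c + t)) \<le> (a + b)"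
      using 1 a b by (auto simp: mult_left_le simp del: times_divide_eq_right)
    moreover have "0 \<le> \<epsilon> * (t / (\<tau> + t))" "\<epsilon> * (t / (\<tau> + t)) \<le> \<epsilon>"
      using 1 \<epsilon> by (auto simp: mult_left_le simp del: times_divide_eq_right)
    moreover have "0 \<le> a + p / 2" "0 \<le> p" using a by (auto simp: p_def)
    moreover have "(\<Sum>k\<in>(UNIV::'p set). 1) = p" by (simp add: p_def)
    ultimately show ?thesis unfolding B_def abs_le_iff by linarith
  qed
  have [measurable]: "B \<in> borel_measurable borel" "\<phi> \<in> borel_measurable borel"
    unfolding B_def[abs_def] \<phi>_def[abs_def] by measurable
  have int: "integrable lborel (\<lambda>t. f t * \<phi> t * B t)"
  proof -
    define K where "K = (a + p / 2) + (a + b) + \<epsilon> + p"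
    have K: "\<bar>B t\<bar> \<le> K" if "t > 0" for t using Bb[OF that] by (simp add: K_def)
    have K0: "0 \<le> K" using K[of 1] by simp
    have bd: "norm (f t * \<phi> t * B t) \<le> norm (K * f t)" for t
    proof (cases "t > 0")
      case True
      have "\<bar>f t\<bar> * (\<bar>\<phi> t\<bar> * \<bar>B t\<bar>) \<le> \<bar>f t\<bar> * (1 * K)"
        using \<phi>01[OF True] K[OF True] by (intro mult_left_mono mult_mono) auto
      also have "\<dots> = norm (K * f t)" using K0 by (simp add: abs_mult)
      finally show ?thesis by (simp add: abs_mult mult.assoc)
    qed (simp add: tau_unnorm_def)
    have "integrable lborel (\<lambda>t. K * f t)" using f_integrable by simp
    then show ?thesis
      by (rule Bochner_Integration.integrable_bound) (use bd in auto)
  qed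
  define M where "M = (\<Prod>k\<in>UNIV. 1 / (2 * sqrt (lam $ k))) / C"
  have M0: "M \<ge> 0" using C0 lam by (auto simp: M_def less_imp_le intro!: divide_nonneg_pos prod_nonneg)
  \<comment> \<open>The majorant is of order \<open>t powr a\<close> at 0 and
    \<open>t powr (- b)\<close> at infinity, so both boundary terms vanish because \<open>a\<close>
    and \<open>b\<close> are positive.\<close>
  have Fle: "0 \<le> F t" "F t \<le> M * (t powr a * (c + t) powr (-(a + b)))" if "t > 0" for t
  proof -
    show "0 \<le> F t" using that f_nonneg[of t] \<phi>01[OF that] by (simp add: tf)
    have "F t \<le> t * f t * 1" unfolding tf[OF that] using that f_nonneg[of t] \<phi>01[OF that] by (intro mult_left_mono) auto
    also have "\<dots> \<le> t * (pi_tau a b c t * (\<Prod>k\<in>UNIV. 1 / (2 * sqrt (lam $ k))))"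
      using that f_le[of t] by simp
    also have "\<dots> = M * ((t * t powr (a - 1)) * (c + t) powr (-(a + b)))"
      using that by (simp add: pi_tau_def M_def C_def)
    also have "t * t powr (a - 1) = t powr a" using that by (simp add: powr_diff)
    finally show "F t \<le> M * (t powr a * (c + t) powr (-(a + b)))" .
  qed
  have lim0: "(F \<longlongrightarrow> 0) (at_right 0)"
  proof (rule tendsto_sandwich)
    show "eventually (\<lambda>t. 0 \<le> F t) (at_right 0)"
      using Fle by (auto simp: eventually_at_filter)
    show "eventually (\<lambda>t. F t \<le> M * (t powr a * c powr (-(a + b)))) (at_right 0)"
    proof (rule eventually_at_rightI[of 0 1])
      fix t :: real assume "t \<in> {0<..<1}"
      then have t: "t > 0" by simp
      have "(c + t) powr (-(a + b)) \<le> c powr (-(a + b))"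
        using t a b c by (intro powr_mono2') auto
      then have "M * (t powr a * (c + t) powr (-(a + b))) \<le> M * (t powr a * c powr (-(a + b)))"
        using M0 by (intro mult_left_mono) auto
      then show "F t \<le> M * (t powr a * c powr (-(a + b)))" using Fle(2)[OF t] by linarith
    qed simp
    have "((\<lambda>t. M * (t powr a * c powr (-(a + b)))) \<longlongrightarrow> M * (0 powr a * c powr (-(a + b)))) (at_right 0)"
      using a by (intro tendsto_intros) (auto simp: eventually_at_filter)
    then show "((\<lambda>t. M * (t powr a * c powr (-(a + b)))) \<longlongrightarrow> 0) (at_right 0)" by simp
  qed simp
  have limtop: "(F \<longlongrightarrow> 0) at_top"
  proof (rule tendsto_sandwich)
    show "eventually (\<lambda>t. 0 \<le> F t) at_top"
      using eventually_gt_at_top[of 0] by eventually_elim (rule Fle)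
    show "eventually (\<lambda>t. F t \<le> M * t powr (- b)) at_top"
      using eventually_gt_at_top[of 0]
    proof eventually_elim
      fix t :: real assume t: "0 < t"
      have "(c + t) powr (-(a + b)) \<le> t powr (-(a + b))"
        using t a b c by (intro powr_mono2') auto
      then have "M * (t powr a * (c + t) powr (-(a + b))) \<le> M * (t powr a * t powr (-(a + b)))"
        using M0 by (intro mult_left_mono) auto
      also have "t powr a * t powr (-(a + b)) = t powr (- b)" by (simp add: powr_add[symmetric])
      finally show "F t \<le> M * t powr (- b)" using Fle(2)[OF t] by linarith
    qed
    have "((\<lambda>t. M * t powr (- b)) \<longlongrightarrow> M * 0) at_top"
      by (intro tendsto_mult tendsto_const tendsto_neg_powr) (use b in \<open>auto simp: filterlim_ident\<close>)
    then show "((\<lambda>t. M * t powr (- b)) \<longlongrightarrow> 0) at_top" by simp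
  qed simp
  \<comment> \<open>On the open half line the integrand is \<open>F t / t * B t\<close>, and
    \<open>F\<close> is already known to be differentiable there; \<open>f\<close> itself is defined
    by cases.\<close>
  have cont: "isCont (\<lambda>t. f t * \<phi> t * B t) t" if "t > 0" for t
  proof -
    have "isCont (\<lambda>t. F t / t * B t) t"
    proof -
      have "isCont F t" using der[OF that] by (rule DERIV_isCont)
      moreover have "isCont B t" unfolding B_def[abs_def] using that c \<tau> lam
        by (intro continuous_intros) (auto simp: add_pos_pos less_imp_neq[symmetric])
      ultimately show ?thesis using that by (intro continuous_intros) auto
    qed
    moreover have "eventually (\<lambda>s. F s / s * B s = f s * \<phi> s * B s) (nhds t)"
      using eventually_nhds_in_open[of "{0<..}" t] that by (auto elim!: eventually_mono simp: tf)
    ultimately show ?thesis by (simp add: isCont_cong)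
  qed
  have "(LBINT t=0..\<infinity>. f t * \<phi> t * B t) = 0 - 0"
  proof (rule interval_integral_FTC_integrable[where F = F])
    fix t :: real assume "0 < ereal t" "ereal t < \<infinity>"
    then have t: "t > 0" by simp
    show "(F has_vector_derivative f t * \<phi> t * B t) (at t)"
      using der[OF t] by (simp add: has_real_derivative_iff_has_vector_derivative)
    show "isCont (\<lambda>t. f t * \<phi> t * B t) t" by (rule cont[OF t])
  next
    show "set_integrable lborel (einterval 0 \<infinity>) (\<lambda>t. f t * \<phi> t * B t)"
      unfolding set_integrable_def using int by (intro integrable_mult_indicator) auto
    show "((F \<circ> real_of_ereal) \<longlongrightarrow> 0) (at_right 0)"
      unfolding zero_ereal_def ereal_tendsto_simps using lim0 by simp
    show "((F \<circ> real_of_ereal) \<longlongrightarrow> 0) (at_left \<infinity>)"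
      unfolding ereal_tendsto_simps using limtop by simp
  qed simp
  then have "(LBINT t:{0<..}. f t * \<phi> t * B t) = 0" by (simp add: interval_integral_to_infinity_eq zero_ereal_def)
  also have "(LBINT t:{0<..}. f t * \<phi> t * B t) = (\<integral>t. f t * \<phi> t * B t \<partial>lborel)"
    unfolding set_lebesgue_integral_def
    by (intro Bochner_Integration.integral_cong) (auto simp: indicator_def tau_unnorm_def)
  finally have zero: "(\<integral>t. f t * \<phi> t * B t \<partial>lborel) = 0" .
  have "(\<integral>t. \<phi> t * B t \<partial>T) = (\<integral>t. tau_density a b c lam t * (\<phi> t * B t) \<partial>lborel)"
    unfolding T_def by (subst integral_density) (auto simp: tau_density_nonneg)
  also have "\<dots> = (\<integral>t. (f t * \<phi> t * B t) / Z \<partial>lborel)"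
    by (intro Bochner_Integration.integral_cong) (auto simp: tau_density_eq)
  also have "\<dots> = 0" using zero by simp
  finally show ?thesis by (simp add: \<phi>_def B_def p_def)
qed

end

section \<open>Weighted means of the ratios t / (t + lam_k)\<close>

context tau_law begin

abbreviation (input) "u k t \<equiv> t / (t + lam $ k)"

lemma u_bounds: "t > 0 \<Longrightarrow> 0 \<le> u k t" "t > 0 \<Longrightarrow> u k t \<le> 1"
  using lam[of k] by (auto simp: divide_le_eq)

lemma u_integrable: "integrable T (u k)"
proof (rule T_integrable_bounded[where B = 1])
  fix t :: real assume "t > 0"
  then show "\<bar>u k t\<bar> \<le> 1" using u_bounds[of t k] unfolding abs_le_iff by linarith
qed measurable

lemma weighted_u_integral:
  "integrable T (\<lambda>t. \<Sum>k\<in>UNIV. w k * u k t)"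
  "(\<integral>t. (\<Sum>k\<in>UNIV. w k * u k t) \<partial>T) = (\<Sum>k\<in>UNIV. w k * (\<integral>t. u k t \<partial>T))"
  by (intro Bochner_Integration.integrable_sum integrable_mult_right u_integrable)
    (subst Bochner_Integration.integral_sum, intro integrable_mult_right u_integrable, simp only: integral_mult_right_zero)

lemma u_antimono: "t > 0 \<Longrightarrow> lam $ j \<le> lam $ k \<Longrightarrow> u k t \<le> u j t"
  using lam[of j] lam[of k] by (intro divide_left_mono) auto

text \<open>The weight \<open>\<phi>\<close> separates the two regimes: where it is small, \<open>t\<close> dominates every small
  \<open>lam $ k\<close> and \<open>u k t\<close> is close to 1; where it is close to 1, \<open>t / (c + t)\<close> is negligible and the
  integrated identity gives the average of the \<open>u k\<close>.  Chebyshev's sum inequality passes from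
  the average to the weighted mean.\<close>

lemma weighted_u_lower:
  assumes \<delta>: "0 < \<delta>" "\<delta> < 1" and \<tau>: "\<tau> > 0" and \<epsilon>: "0 < \<epsilon>" "\<epsilon> \<le> 1"
  defines "p \<equiv> real CARD('p)" and "W \<equiv> (\<Sum>k\<in>UNIV. (lam $ k) powr (- \<delta>))"
  shows "W * (min 1 ((a + p / 2) / p) - ((a + b) * (\<tau> / c) powr \<epsilon> + \<epsilon>) / p) - p * \<tau> powr (- \<delta>)
    \<le> (\<Sum>k\<in>UNIV. (lam $ k) powr (- \<delta>) * (\<integral>t. u k t \<partial>T))"
proof -
  define w where "w k = (lam $ k) powr (- \<delta>)" for k
  define \<theta> where "\<theta> = a + p / 2"
  define \<phi> where "\<phi> t = (\<tau> / (\<tau> + t)) powr \<epsilon>" for t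
  define R where "R t = \<phi> t * (\<theta> - (a + b) * (t / (c + t)) - \<epsilon> * (t / (\<tau> + t)) - (\<Sum>k\<in>UNIV. u k t))" for t
  define e where "e = (a + b) * (\<tau> / c) powr \<epsilon> + \<epsilon>"
  have p: "p > 0" by (simp add: p_def)
  have w0: "w k > 0" for k using lam[of k] by (simp add: w_def)
  have W: "W = (\<Sum>k\<in>UNIV. w k)" by (simp add: W_def w_def)
  have W0: "W \<ge> 0" unfolding W by (intro sum_nonneg less_imp_le w0)
  have ER: "(\<integral>t. R t \<partial>T) = 0"
    unfolding R_def \<phi>_def \<theta>_def p_def by (rule integration_by_parts) (use \<tau> \<epsilon> in auto)
  have \<phi>01: "0 \<le> \<phi> t" "\<phi> t \<le> 1" and \<phi>_ge: "\<tau> / (\<tau> + t) \<le> \<phi> t" if "t > 0" for t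
  proof -
    show "0 \<le> \<phi> t" by (simp add: \<phi>_def)
    show "\<phi> t \<le> 1" unfolding \<phi>_def using that \<tau> \<epsilon> by (intro powr_le1) auto
    have "(\<tau> / (\<tau> + t)) powr 1 \<le> (\<tau> / (\<tau> + t)) powr \<epsilon>"
      using that \<tau> \<epsilon> by (intro powr_mono') auto
    then show "\<tau> / (\<tau> + t) \<le> \<phi> t" using that \<tau> by (simp add: \<phi>_def)
  qed
  \<comment> \<open>The bound has to be small uniformly in \<open>t\<close>. Since \<epsilon> is at
    most 1, both factors are dominated by powers with the same exponent \<epsilon>, and
    \<open>t\<close> cancels between \<open>\<tau> / t\<close> and \<open>t / c\<close>.\<close>
  have \<phi>c: "\<phi> t * (t / (c + t)) \<le> (\<tau> / c) powr \<epsilon>" if t: "t > 0" for t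
  proof -
    have "\<phi> t \<le> (\<tau> / t) powr \<epsilon>"
      unfolding \<phi>_def using t \<tau> \<epsilon> by (intro powr_mono2) (auto intro!: divide_left_mono)
    moreover have "t / (c + t) \<le> (t / c) powr \<epsilon>"
    proof (cases "t \<ge> c")
      case True
      have "t / (c + t) \<le> 1" using t c by simp
      also have "\<dots> \<le> (t / c) powr \<epsilon>" using True c \<epsilon> by (intro ge_one_powr_ge_zero) auto
      finally show ?thesis .
    next
      case False
      have "t / (c + t) \<le> (t / c) powr 1" using t c by (simp add: frac_le)
      also have "\<dots> \<le> (t / c) powr \<epsilon>" using t c False \<epsilon> by (intro powr_mono') auto
      finally show ?thesis .
    qed
    ultimately have "\<phi> t * (t / (c + t)) \<le> (\<tau> / t) powr \<epsilon> * (t / c) powr \<epsilon>"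
      using t c by (intro mult_mono) auto
    also have "\<dots> = (\<tau> / t * (t / c)) powr \<epsilon>"
      using t c \<tau> by (simp only: powr_mult)
    also have "\<tau> / t * (t / c) = \<tau> / c" using t by simp
    finally show ?thesis .
  qed
  \<comment> \<open>If \<open>lam $ k\<close> is at least \<tau>, the weight alone is small enough.
    Otherwise the two factors combine to at most \<open>lam $ k / \<tau>\<close>, and \<delta> < 1
    makes \<open>(lam $ k) powr (1 - \<delta>)\<close> increasing, so that its value at \<tau>
    bounds it.\<close>
  have small: "w k * ((1 - \<phi> t) * (1 - u k t)) \<le> \<tau> powr (- \<delta>)" if t: "t > 0" for k t
  proof (cases "lam $ k \<ge> \<tau>")
    case True
    have "w k * ((1 - \<phi> t) * (1 - u k t)) \<le> w k * 1"
      using \<phi>01[OF t] u_bounds[OF t, of k] w0[of k] by (intro mult_left_mono mult_le_one) auto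
    also have "w k \<le> \<tau> powr (- \<delta>)"
      unfolding w_def using True \<tau> \<delta> by (intro powr_mono2') auto
    finally show ?thesis by simp
  next
    case False
    have 1: "1 - \<phi> t \<le> t / (\<tau> + t)"
    proof -
      have "t / (\<tau> + t) = 1 - \<tau> / (\<tau> + t)" using t \<tau> by (simp add: field_simps)
      then show ?thesis using \<phi>_ge[OF t] by simp
    qed
    have "1 - u k t = lam $ k / (t + lam $ k)" using t lam[of k] by (simp add: field_simps)
    then have "(1 - \<phi> t) * (1 - u k t) \<le> (t / (\<tau> + t)) * (lam $ k / (t + lam $ k))"
      using 1 u_bounds[OF t, of k] \<phi>01[OF t] t \<tau> lam[of k] by (intro mult_mono) auto
    also have "\<dots> = (t / (t + lam $ k)) * (lam $ k / (\<tau> + t))" by (simp add: mult.commute)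
    also have "\<dots> \<le> 1 * (lam $ k / \<tau>)"
      using t \<tau> lam[of k] u_bounds[OF t, of k] by (intro mult_mono divide_left_mono) auto
    finally have "w k * ((1 - \<phi> t) * (1 - u k t)) \<le> w k * (lam $ k / \<tau>)"
      using w0[of k] by (intro mult_left_mono) auto
    also have "\<dots> = (lam $ k) powr (1 - \<delta>) / \<tau>"
      using lam[of k] by (simp add: w_def powr_diff powr_minus field_simps)
    also have "\<dots> \<le> \<tau> powr (1 - \<delta>) / \<tau>"
      using False lam[of k] \<delta> \<tau> by (intro divide_right_mono powr_mono2) auto
    also have "\<dots> = \<tau> powr (- \<delta>)"
      using \<tau> by (simp add: powr_diff powr_minus field_simps)
    finally show ?thesis .
  qed
  \<comment> \<open>\<open>R\<close> has mean zero under \<open>T\<close>, so its multiple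
    \<open>W / p * R t\<close> may be carried through the pointwise estimate and disappears on
    integration.\<close>
  have pointwise: "W * (min 1 (\<theta> / p) - e / p) - p * \<tau> powr (- \<delta>) - W / p * R t
      \<le> (\<Sum>k\<in>UNIV. w k * u k t)" if t: "t > 0" for t
  proof -
    define S where "S = (\<Sum>k\<in>UNIV. u k t)"
    define G where "G = (\<Sum>k\<in>UNIV. w k * u k t)"
    have "W * S \<le> real (card (UNIV::'p set)) * G"
      unfolding W S_def G_def
    proof (rule chebyshev_sum_finite)
      fix j k
      show "0 \<le> (w j - w k) * (u j t - u k t)"
      proof (cases "lam $ j \<le> lam $ k")
        case True
        then have "w k \<le> w j" unfolding w_def using lam[of j] \<delta> by (intro powr_mono2') auto
        then show ?thesis using u_antimono[OF t True] by simp
      next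
        case False
        then have "w j \<le> w k" unfolding w_def using lam[of k] \<delta> by (intro powr_mono2') auto
        then show ?thesis using u_antimono[OF t, of k j] False by (simp add: mult_nonpos_nonpos)
      qed
    qed
    then have "\<phi> t * (W / p * S) \<le> \<phi> t * G"
      using \<phi>01[OF t] p by (intro mult_left_mono) (simp_all add: p_def field_simps)
    moreover have "(1 - \<phi> t) * W - p * \<tau> powr (- \<delta>) \<le> (1 - \<phi> t) * G"
    proof -
      have "(1 - \<phi> t) * W - (1 - \<phi> t) * G = (\<Sum>k\<in>UNIV. w k * ((1 - \<phi> t) * (1 - u k t)))"
        by (simp add: W G_def sum_distrib_left sum_subtractf[symmetric] algebra_simps)
      also have "\<dots> \<le> (\<Sum>k\<in>(UNIV::'p set). \<tau> powr (- \<delta>))" by (intro sum_mono small t)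
      also have "\<dots> = p * \<tau> powr (- \<delta>)" by (simp add: p_def)
      finally show ?thesis by simp
    qed
    ultimately have 1: "W * (\<phi> t * S / p + (1 - \<phi> t)) - p * \<tau> powr (- \<delta>) \<le> G"
      by (simp add: algebra_simps)
    have 2: "\<phi> t * \<theta> - e - R t \<le> \<phi> t * S"
    proof -
      have "(a + b) * (\<phi> t * (t / (c + t))) \<le> (a + b) * (\<tau> / c) powr \<epsilon>"
        using \<phi>c[OF t] a b by (intro mult_left_mono) auto
      moreover have "\<epsilon> * (\<phi> t * (t / (\<tau> + t))) \<le> \<epsilon> * 1"
        using \<epsilon> t \<tau> \<phi>01[OF t] by (intro mult_left_mono mult_le_one) auto
      moreover have "\<phi> t * S = \<phi> t * \<theta> - (a + b) * (\<phi> t * (t / (c + t))) - \<epsilon> * (\<phi> t * (t / (\<tau> + t))) - R t"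
        by (simp add: R_def S_def algebra_simps)
      ultimately show ?thesis by (simp add: e_def)
    qed
    \<comment> \<open>The right-hand side is a convex combination of \<open>\<theta> / p\<close> and
      1 with weights \<open>\<phi> t\<close> and \<open>1 - \<phi> t\<close>, hence at least the
      smaller of the two.\<close>
    have "min 1 (\<theta> / p) \<le> \<phi> t * (\<theta> / p) + (1 - \<phi> t) * 1"
    proof -
      have "\<phi> t * min 1 (\<theta> / p) + (1 - \<phi> t) * min 1 (\<theta> / p) \<le> \<phi> t * (\<theta> / p) + (1 - \<phi> t) * 1"
        using \<phi>01[OF t] by (intro add_mono mult_left_mono) auto
      then show ?thesis by (simp add: algebra_simps)
    qed
    moreover have "(\<phi> t * \<theta> - e - R t) / p \<le> \<phi> t * S / p"
      using 2 p by (intro divide_right_mono) auto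
    ultimately have "min 1 (\<theta> / p) - e / p - R t / p \<le> \<phi> t * S / p + (1 - \<phi> t)"
      by (simp add: diff_divide_distrib)
    then have "W * (min 1 (\<theta> / p) - e / p - R t / p) \<le> W * (\<phi> t * S / p + (1 - \<phi> t))"
      using W0 by (rule mult_left_mono)
    with 1 show ?thesis unfolding G_def[symmetric] by (simp add: algebra_simps)
  qed
  have [measurable]: "R \<in> borel_measurable borel"
    unfolding R_def[abs_def] \<phi>_def by measurable
  have Rb: "\<bar>R t\<bar> \<le> \<theta> + (a + b) + \<epsilon> + p" if t: "t > 0" for t
  proof -
    have "0 \<le> (\<Sum>k\<in>UNIV. u k t)" by (intro sum_nonneg u_bounds t)
    moreover have "(\<Sum>k\<in>UNIV. u k t) \<le> (\<Sum>k\<in>(UNIV::'p set). 1)" by (intro sum_mono u_bounds t)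
    moreover have "0 \<le> (a + b) * (t / (c + t))" "(a + b) * (t / (c + t)) \<le> (a + b) * 1"
      using a b c t by (auto intro!: mult_left_mono simp del: times_divide_eq_right)
    moreover have "0 \<le> \<epsilon> * (t / (\<tau> + t))" "\<epsilon> * (t / (\<tau> + t)) \<le> \<epsilon> * 1"
      using \<epsilon> \<tau> t by (auto intro!: mult_left_mono simp del: times_divide_eq_right)
    moreover have "0 \<le> \<theta>" using a by (simp add: \<theta>_def p_def)
    moreover have "(\<Sum>k\<in>(UNIV::'p set). 1) = p" by (simp add: p_def)
    moreover have "\<bar>\<theta> - x - y - S\<bar> \<le> \<theta> + (a + b) + \<epsilon> + p"
      if "0 \<le> S" "S \<le> p" "0 \<le> x" "x \<le> (a + b) * 1" "0 \<le> y" "y \<le> \<epsilon> * 1" "0 \<le> \<theta>" for S x y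
      using that[unfolded mult_1_right] a b p \<epsilon> by linarith
    ultimately have "\<bar>\<theta> - (a + b) * (t / (c + t)) - \<epsilon> * (t / (\<tau> + t)) - (\<Sum>k\<in>UNIV. u k t)\<bar> \<le> \<theta> + (a + b) + \<epsilon> + p"
      by metis
    then have "\<bar>\<phi> t\<bar> * \<bar>\<theta> - (a + b) * (t / (c + t)) - \<epsilon> * (t / (\<tau> + t)) - (\<Sum>k\<in>UNIV. u k t)\<bar> \<le> 1 * (\<theta> + (a + b) + \<epsilon> + p)"
      using \<phi>01[OF t] by (intro mult_mono) auto
    then show ?thesis by (simp add: R_def abs_mult)
  qed
  have Ri: "integrable T R" by (rule T_integrable_bounded[OF _ Rb]) auto
  have "(\<integral>t. W * (min 1 (\<theta> / p) - e / p) - p * \<tau> powr (- \<delta>) - W / p * R t \<partial>T)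
      \<le> (\<integral>t. (\<Sum>k\<in>UNIV. w k * u k t) \<partial>T)"
    by (rule T_integral_mono[OF _ _ pointwise]) (use Ri weighted_u_integral(1) in auto)
  also have "(\<integral>t. (\<Sum>k\<in>UNIV. w k * u k t) \<partial>T) = (\<Sum>k\<in>UNIV. w k * (\<integral>t. u k t \<partial>T))"
    by (rule weighted_u_integral(2))
  also have "(\<integral>t. W * (min 1 (\<theta> / p) - e / p) - p * \<tau> powr (- \<delta>) - W / p * R t \<partial>T)
     = W * (min 1 (\<theta> / p) - e / p) - p * \<tau> powr (- \<delta>)"
    using Ri ER T.prob_space by simp
  finally show ?thesis by (simp add: w_def \<theta>_def e_def)
qed

text \<open>Here no separation is needed: if \<open>lam $ k \<ge> c\<close> then \<open>1 - u k t \<ge> c / (c + t)\<close>, so the negative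
  term in the identity for the sum of the \<open>1 - u k\<close> is itself dominated by the quantity to be bounded.\<close>

lemma weighted_u_upper:
  assumes \<delta>: "0 < \<delta>"
  defines "p \<equiv> real CARD('p)" and "W \<equiv> (\<Sum>k\<in>UNIV. (lam $ k) powr \<delta>)"
  shows "(\<Sum>k\<in>UNIV. (lam $ k) powr \<delta> * (\<integral>t. u k t \<partial>T))
    \<le> (1 - (p / 2 + b) / (p + a + b)) * W + (a + b) * p * c powr \<delta> / (p + a + b)"
proof -
  define w where "w k = (lam $ k) powr \<delta>" for k
  \<comment> \<open>The unweighted identity: exponent 0, with 1 as a placeholder for the
    scale.\<close>
  define R where "R t = (1 / (1 + t)) powr 0 * (a + p / 2 - (a + b) * (t / (c + t)) - 0 * (t / (1 + t)) - (\<Sum>k\<in>UNIV. u k t))" for t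
  have p: "p > 0" by (simp add: p_def)
  have w0: "w k > 0" for k using lam[of k] by (simp add: w_def)
  have W: "W = (\<Sum>k\<in>UNIV. w k)" by (simp add: W_def w_def)
  have W0: "W \<ge> 0" unfolding W by (intro sum_nonneg less_imp_le w0)
  have ER: "(\<integral>t. R t \<partial>T) = 0"
    unfolding R_def p_def by (rule integration_by_parts) auto
  have R: "R t = a + p / 2 - (a + b) * (t / (c + t)) - (\<Sum>k\<in>UNIV. u k t)" if "t > 0" for t
    using that by (simp add: R_def)
  have pointwise: "(p + a + b) * (\<Sum>k\<in>UNIV. w k * u k t)
      \<le> (p + a + b) * W - W * (p / 2 + b) + (a + b) * p * c powr \<delta> - W * R t" if t: "t > 0" for t
  proof -
    define S where "S = (\<Sum>k\<in>UNIV. u k t)"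
    define G where "G = (\<Sum>k\<in>UNIV. w k * (1 - u k t))"
    have "W * (\<Sum>k\<in>UNIV. 1 - u k t) \<le> real (card (UNIV::'p set)) * G"
      unfolding W G_def
    proof (rule chebyshev_sum_finite)
      fix j k
      show "0 \<le> (w j - w k) * ((1 - u j t) - (1 - u k t))"
      proof (cases "lam $ j \<le> lam $ k")
        case True
        then have "w j \<le> w k" unfolding w_def using lam[of j] \<delta> by (intro powr_mono2) auto
        then show ?thesis using u_antimono[OF t True] by (intro mult_nonpos_nonpos) auto
      next
        case False
        then have "w k \<le> w j" unfolding w_def using lam[of k] \<delta> by (intro powr_mono2) auto
        then show ?thesis using u_antimono[OF t, of k j] False by simp
      qed
    qed
    then have 1: "W * (p - S) \<le> p * G" by (simp add: sum_subtractf S_def p_def)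
    have 2: "W * (c / (c + t)) - p * c powr \<delta> \<le> G"
    proof -
      have "w k * (c / (c + t)) - c powr \<delta> \<le> w k * (1 - u k t)" for k
      proof (cases "lam $ k \<ge> c")
        case True
        have "c / (c + t) \<le> lam $ k / (t + lam $ k)" using True c t lam[of k] by (simp add: field_simps)
        also have "\<dots> = 1 - u k t" using t lam[of k] by (simp add: field_simps)
        finally have "w k * (c / (c + t)) \<le> w k * (1 - u k t)" using w0[of k] by (intro mult_left_mono) auto
        then show ?thesis using powr_ge_zero[of c \<delta>] by linarith
      next
        case False
        have "w k * (c / (c + t)) \<le> w k * 1" using w0[of k] c t by (intro mult_left_mono) auto
        also have "w k \<le> c powr \<delta>" unfolding w_def using False lam[of k] \<delta> by (intro powr_mono2) auto
        finally have "w k * (c / (c + t)) \<le> c powr \<delta>" by simp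
        moreover have "0 \<le> w k * (1 - u k t)" using w0[of k] u_bounds[OF t, of k] by simp
        ultimately show ?thesis by linarith
      qed
      then have "(\<Sum>k\<in>UNIV. w k * (c / (c + t)) - c powr \<delta>) \<le> G" unfolding G_def by (intro sum_mono)
      then show ?thesis by (simp add: sum_subtractf W sum_distrib_right p_def sum_divide_distrib)
    qed
    have ct: "t / (c + t) = 1 - c / (c + t)" using t c by (simp add: field_simps)
    have S: "p - S = p / 2 + b - (a + b) * (c / (c + t)) + R t"
      unfolding R[OF t] S_def ct by (simp add: algebra_simps)
    \<comment> \<open>Adding \<open>a + b\<close> times the second estimate to the first cancels the
      terms with \<open>c / (c + t)\<close>. This is the origin of the denominator
      \<open>p + a + b\<close>.\<close>
    have "W * (p / 2 + b - (a + b) * (c / (c + t)) + R t) + (a + b) * (W * (c / (c + t)) - p * c powr \<delta>) \<le> p * G + (a + b) * G"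
      using 1 2 a b unfolding S[symmetric] by (intro add_mono mult_left_mono) auto
    moreover have "G = W - (\<Sum>k\<in>UNIV. w k * u k t)"
      by (simp add: G_def W right_diff_distrib sum_subtractf)
    ultimately show ?thesis by (simp add: algebra_simps)
  qed
  have Ri: "integrable T R"
  proof -
    have "integrable T (\<lambda>t. a + p / 2 - (a + b) * (t / (c + t)) - (\<Sum>k\<in>UNIV. u k t))"
    proof (intro Bochner_Integration.integrable_diff integrable_mult_right Bochner_Integration.integrable_sum u_integrable)
      show "integrable T (\<lambda>t. t / (c + t))"
        by (rule T_integrable_bounded[where B = 1]) (use c in auto)
    qed auto
    then show ?thesis
      by (rule integrable_cong_AE_imp)
        (use AE_T_pos in \<open>auto elim!: eventually_mono simp: R R_def[abs_def]\<close>)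
  qed
  have Gi: "integrable T (\<lambda>t. (p + a + b) * (\<Sum>k\<in>UNIV. w k * u k t))"
    by (intro integrable_mult_right weighted_u_integral(1))
  have "(\<integral>t. (p + a + b) * (\<Sum>k\<in>UNIV. w k * u k t) \<partial>T)
      \<le> (\<integral>t. (p + a + b) * W - W * (p / 2 + b) + (a + b) * p * c powr \<delta> - W * R t \<partial>T)"
    by (rule T_integral_mono[OF Gi _ pointwise]) (use Ri in auto)
  also have "(\<integral>t. (p + a + b) * (\<Sum>k\<in>UNIV. w k * u k t) \<partial>T) = (p + a + b) * (\<Sum>k\<in>UNIV. w k * (\<integral>t. u k t \<partial>T))"
    by (simp only: integral_mult_right_zero weighted_u_integral(2))
  also have "(\<integral>t. (p + a + b) * W - W * (p / 2 + b) + (a + b) * p * c powr \<delta> - W * R t \<partial>T)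
     = (p + a + b) * W - W * (p / 2 + b) + (a + b) * p * c powr \<delta>"
    using Ri ER T.prob_space by simp
  finally have "(p + a + b) * (\<Sum>k\<in>UNIV. w k * (\<integral>t. u k t \<partial>T)) \<le> \<dots>" .
  then have "(\<Sum>k\<in>UNIV. w k * (\<integral>t. u k t \<partial>T)) \<le> ((p + a + b) * W - W * (p / 2 + b) + (a + b) * p * c powr \<delta>) / (p + a + b)"
    using p a b by (simp add: pos_le_divide_eq mult.commute)
  also have "\<dots> = (1 - (p / 2 + b) / (p + a + b)) * W + (a + b) * p * c powr \<delta> / (p + a + b)"
  proof -
    have "(q * W - W * h + B) / q = (1 - h / q) * W + B / q" if "q > 0" for q h B :: real
      using that by (simp add: field_simps)
    from this[of "p + a + b"] show ?thesis using p a b by simp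
  qed
  finally show ?thesis by (simp add: w_def)
qed

end

text \<open>The weight parameters are fixed so that the two error terms use up half of the margin
  above \<open>ln 2\<close>; \<open>m\<close> is the midpoint. The order of quantifiers matters:
  \<open>m\<close> is independent of \<delta>, which can therefore be chosen afterwards, whereas the
  additive constant depends on \<delta>.\<close>

lemma weighted_u_lower_uniform:
  fixes a b c :: real
  assumes a: "a > 0" and b: "b > 0" and c: "c > 0" and ap: "a / real CARD('p) > ln 2 - 1/2"
  obtains m where "m > ln 2"
    "\<And>\<delta>. 0 < \<delta> \<Longrightarrow> \<delta> < 1 \<Longrightarrow> \<exists>B\<ge>0. \<forall>lam :: real^'p. (\<forall>k. lam $ k > 0) \<longrightarrow>
      m * (\<Sum>k\<in>UNIV. (lam $ k) powr (- \<delta>)) - B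
        \<le> (\<Sum>k\<in>UNIV. (lam $ k) powr (- \<delta>) * (\<integral>t. t / (t + lam $ k) \<partial>tau_law.T a b c lam))"
proof -
  define p where "p = real CARD('p)"
  have p: "p > 0" by (simp add: p_def)
  define \<mu> where "\<mu> = min 1 ((a + p / 2) / p)"
  have \<mu>: "\<mu> > ln 2"
    using ap p ln_2_less_1 by (simp add: \<mu>_def p_def[symmetric] add_divide_distrib)
  \<comment> \<open>Each error term gets a quarter of the margin \<open>p * (\<mu> - ln 2)\<close>:
    \<epsilon> directly, and \<tau> as the solution of
    \<open>(\<tau> / c) powr \<epsilon> = x\<close>.\<close>
  define \<epsilon> where "\<epsilon> = min 1 (p * (\<mu> - ln 2) / 4)"
  have \<epsilon>: "0 < \<epsilon>" "\<epsilon> \<le> 1" "\<epsilon> \<le> p * (\<mu> - ln 2) / 4" using p \<mu> by (auto simp: \<epsilon>_def)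
  define x where "x = p * (\<mu> - ln 2) / (4 * (a + b))"
  define \<tau> where "\<tau> = c * x powr (1 / \<epsilon>)"
  have x: "x > 0" using p \<mu> a b by (auto simp: x_def)
  then have \<tau>: "\<tau> > 0" using c by (simp add: \<tau>_def)
  have "(\<tau> / c) powr \<epsilon> = x powr (1 / \<epsilon> * \<epsilon>)" using c by (simp add: \<tau>_def powr_powr)
  then have "(\<tau> / c) powr \<epsilon> = x" using x \<epsilon> by simp
  moreover have "(a + b) * x = p * (\<mu> - ln 2) / 4"
  proof -
    have "q * (P / (4 * q)) = P / 4" if "q > 0" for q P :: real using that by simp
    from this[of "a + b"] show ?thesis using a b by (simp add: x_def)
  qed
  ultimately have e: "(a + b) * (\<tau> / c) powr \<epsilon> = p * (\<mu> - ln 2) / 4" by simp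
  have "((a + b) * (\<tau> / c) powr \<epsilon> + \<epsilon>) / p \<le> (p * (\<mu> - ln 2) / 2) / p"
    using \<epsilon> p unfolding e by (intro divide_right_mono) auto
  also have "\<dots> = (\<mu> - ln 2) / 2" using p by simp
  finally have le: "(\<mu> + ln 2) / 2 \<le> \<mu> - ((a + b) * (\<tau> / c) powr \<epsilon> + \<epsilon>) / p"
    by (simp add: field_simps)
  show thesis
  proof (rule that[of "(\<mu> + ln 2) / 2"])
    show "ln 2 < (\<mu> + ln 2) / 2" using \<mu> by simp
    fix \<delta> :: real assume \<delta>: "0 < \<delta>" "\<delta> < 1"
    show "\<exists>B\<ge>0. \<forall>lam :: real^'p. (\<forall>k. lam $ k > 0) \<longrightarrow>
      (\<mu> + ln 2) / 2 * (\<Sum>k\<in>UNIV. (lam $ k) powr (- \<delta>)) - B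
        \<le> (\<Sum>k\<in>UNIV. (lam $ k) powr (- \<delta>) * (\<integral>t. t / (t + lam $ k) \<partial>tau_law.T a b c lam))"
    proof (intro exI[of _ "p * \<tau> powr (- \<delta>)"] conjI allI impI)
      show "0 \<le> p * \<tau> powr (- \<delta>)" using p by simp
      fix lam :: "real^'p" assume lam: "\<forall>k. lam $ k > 0"
      interpret tau_law a b c lam using a b c lam by unfold_locales auto
      have "(\<mu> + ln 2) / 2 * (\<Sum>k\<in>UNIV. (lam $ k) powr (- \<delta>))
          \<le> (\<mu> - ((a + b) * (\<tau> / c) powr \<epsilon> + \<epsilon>) / p) * (\<Sum>k\<in>UNIV. (lam $ k) powr (- \<delta>))"
        using le by (intro mult_right_mono sum_nonneg) auto
      then show "(\<mu> + ln 2) / 2 * (\<Sum>k\<in>UNIV. (lam $ k) powr (- \<delta>)) - p * \<tau> powr (- \<delta>)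
        \<le> (\<Sum>k\<in>UNIV. (lam $ k) powr (- \<delta>) * (\<integral>t. t / (t + lam $ k) \<partial>T))"
        using weighted_u_lower[OF \<delta> \<tau> \<epsilon>(1,2)]
        unfolding \<mu>_def p_def by (simp add: mult.commute)
    qed
  qed
qed

section \<open>One step of the sampler\<close>

lemma Amat_mult_vec: "Amat X lam *v x = transpose X *v (X *v x) + (\<chi> k. x $ k / lam $ k)"
proof -
  have "Psi lam *v x = (\<chi> k. x $ k / lam $ k)"
    by (simp add: Psi_def vec_eq_iff matrix_vector_mult_def if_distrib[of "\<lambda>c. c * _"] cong: if_cong)
  then show ?thesis
    by (simp add: Amat_def matrix_vector_mult_add_rdistrib matrix_vector_mul_assoc)
qed

lemma Amat_quad: "x \<bullet> (Amat X lam *v x) = (X *v x) \<bullet> (X *v x) + (\<Sum>k\<in>UNIV. (x $ k)\<^sup>2 / lam $ k)"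
proof -
  have "x \<bullet> (transpose X *v (X *v x)) = (X *v x) \<bullet> (X *v x)"
    by (metis dot_lmul_matrix vector_transpose_matrix)
  then show ?thesis
    by (simp add: Amat_mult_vec inner_add_right inner_vec_def[of x "vec_lambda _"] power2_eq_square)
qed

lemma Amat_sym: "Amat X lam $ i $ j = Amat X lam $ j $ i"
  by (simp add: Amat_def Psi_def matrix_matrix_mult_def transpose_def mult.commute)

lemma Amat_pos_def:
  fixes X :: "real^'p^'n"
  assumes "\<And>k. lam $ k > 0"
  shows "pos_def (Amat X lam)"
  unfolding pos_def_def
proof (intro conjI allI impI)
  fix x :: "real^'p" assume "x \<noteq> 0"
  then obtain k where k: "x $ k \<noteq> 0" by (auto simp: vec_eq_iff)
  have "0 < (\<Sum>k\<in>UNIV. (x $ k)\<^sup>2 / lam $ k)"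
    by (rule sum_pos2[of _ k]) (use k assms less_imp_le[OF assms] in auto)
  then show "x \<bullet> (Amat X lam *v x) > 0" unfolding Amat_quad by (simp add: add_nonneg_pos)
qed (rule Amat_sym)

lemma nn_integral_prod_ig_coord:
  fixes r :: "'p::finite \<Rightarrow> real" and h :: "real \<Rightarrow> real"
  assumes r: "\<And>k. r k > 0" and [measurable]: "h \<in> borel_measurable borel" and h: "\<And>x. 0 \<le> h x"
  shows "(\<integral>\<^sup>+l. ennreal (\<Prod>k\<in>UNIV. ig_density 1 (r k) (l $ k)) * ennreal (h (l $ j)) \<partial>lborel)
    = (\<integral>\<^sup>+x. ennreal (ig_density 1 (r j) x) * ennreal (h x) \<partial>lborel)"
proof -
  define f where "f i x = ig_density 1 (r i) x * (if i = j then h x else 1)" for i x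
  have f: "(\<integral>\<^sup>+x. ennreal (f i x) \<partial>lborel) = (if i = j then (\<integral>\<^sup>+x. ennreal (ig_density 1 (r j) x) * ennreal (h x) \<partial>lborel) else 1)" for i
    using nn_integral_ig[of 1 "r i"] r h by (auto simp: f_def ennreal_mult ig_density_nonneg)
  have "(\<Prod>k\<in>UNIV. ig_density 1 (r k) (l $ k)) * h (l $ j) = (\<Prod>k\<in>UNIV. f k (l $ k))" for l
    by (simp add: f_def prod.distrib prod.delta)
  then have "ennreal (\<Prod>k\<in>UNIV. ig_density 1 (r k) (l $ k)) * ennreal (h (l $ j)) = ennreal (\<Prod>k\<in>UNIV. f k (l $ k))" for l
    using h by (simp add: ennreal_mult''[symmetric])
  then have "(\<integral>\<^sup>+l. ennreal (\<Prod>k\<in>UNIV. ig_density 1 (r k) (l $ k)) * ennreal (h (l $ j)) \<partial>lborel)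
      = (\<integral>\<^sup>+l. ennreal (\<Prod>k\<in>UNIV. f k (l $ k)) \<partial>lborel)" by simp
  also have "\<dots> = (\<Prod>i\<in>UNIV. \<integral>\<^sup>+x. ennreal (f i x) \<partial>lborel)"
    by (rule nn_integral_lborel_prod_cart) (auto simp: f_def ig_density_nonneg h)
  also have "\<dots> = (\<integral>\<^sup>+x. ennreal (ig_density 1 (r j) x) * ennreal (h x) \<partial>lborel)" by (simp add: f prod.delta)
  finally show ?thesis .
qed

lemma nn_integral_prod_ig_powr:
  fixes r :: "'p::finite \<Rightarrow> real"
  assumes r: "\<And>k. r k > 0" and e: "e < 1"
  shows "(\<integral>\<^sup>+l. ennreal (\<Prod>k\<in>UNIV. ig_density 1 (r k) (l $ k)) * ennreal ((l $ j) powr e) \<partial>lborel)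
    = ennreal (Gamma (1 - e) * r j powr e)"
  using nn_integral_prod_ig_coord[OF r, where h = "\<lambda>x. x powr e" and j = j] nn_integral_ig_powr[of 1 "r j" "- e"] r e by simp

lemma nn_integral_prod_ig:
  fixes r :: "'p::finite \<Rightarrow> real"
  assumes r: "\<And>k. r k > 0"
  shows "(\<integral>\<^sup>+l. ennreal (\<Prod>k\<in>UNIV. ig_density 1 (r k) (l $ k)) \<partial>lborel) = 1"
  using nn_integral_prod_ig_coord[OF r, where h = "\<lambda>_. 1"] nn_integral_ig[of 1] r by simp

locale horseshoe_step = tau_law a b c lam
  for a b c :: real and lam :: "real^'p" +
  fixes y :: "real^'n" and X :: "real^'p^'n" and a' b' :: real
  assumes XX: "invertible (transpose X ** X)" and a': "a' > 0" and b': "b' > 0"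
begin

definition "A = Amat X lam"
definition "\<mu> = matrix_inv A *v (transpose X *v y)"
definition "ig_shape = real CARD('n) / 2 + a'"
definition "ig_scale = (y \<bullet> y - (transpose X *v y) \<bullet> \<mu>) / 2 + b'"

lemma pos_def_A: "pos_def A"
  unfolding A_def by (rule Amat_pos_def) (rule lam)

lemma A_mu: "A *v \<mu> = transpose X *v y"
  unfolding \<mu>_def by (rule pos_def_inverse_vec(1)[OF pos_def_A])

lemma mu_inner: "(transpose X *v y) \<bullet> \<mu> = (X *v \<mu>) \<bullet> y"
  by (metis dot_lmul_matrix inner_commute vector_transpose_matrix)

text \<open>The prior part of \<open>\<mu> \<bullet> (A *v \<mu>)\<close> is dropped. By
  Cauchy-Schwarz the fitted vector is then no longer than \<open>y\<close>, whatever
  \<open>lam\<close> is; from here come all bounds on the posterior mean and on the scale that are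
  uniform in \<open>lam\<close>.\<close>

lemma X_mu_le: "(X *v \<mu>) \<bullet> (X *v \<mu>) \<le> (X *v \<mu>) \<bullet> y"
proof -
  have "(X *v \<mu>) \<bullet> (X *v \<mu>) \<le> \<mu> \<bullet> (A *v \<mu>)"
    unfolding A_def Amat_quad using lam by (auto intro!: sum_nonneg simp: less_imp_le)
  also have "\<dots> = (X *v \<mu>) \<bullet> y" unfolding A_mu by (metis mu_inner inner_commute)
  finally show ?thesis .
qed

lemma ig_shape_pos: "ig_shape > 0" using a' by (simp add: ig_shape_def add_nonneg_pos)

lemma ig_scale_bounds: "b' \<le> ig_scale" "ig_scale \<le> (y \<bullet> y) / 2 + b'"
proof -
  have "0 \<le> (y - X *v \<mu>) \<bullet> (y - X *v \<mu>)" by simp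
  then have "(X *v \<mu>) \<bullet> y \<le> y \<bullet> y"
    using X_mu_le by (simp add: inner_diff_left inner_diff_right inner_commute)
  then show "b' \<le> ig_scale" unfolding ig_scale_def mu_inner by simp
  have "0 \<le> (X *v \<mu>) \<bullet> y" using X_mu_le inner_ge_zero[of "X *v \<mu>"] by linarith
  then show "ig_scale \<le> (y \<bullet> y) / 2 + b'" unfolding ig_scale_def mu_inner by simp
qed

lemma ig_scale_pos: "ig_scale > 0" using ig_scale_bounds b' by simp

text \<open>Given \<open>lam\<close>, the pairs \<open>(s2, \<beta>)\<close> and \<open>(t, nu)\<close> are independent; \<open>M1\<close> and \<open>M2\<close> are their laws, and
  \<open>dens3\<close> is the conditional density of the new value of \<open>lam\<close>.\<close>

definition dens1 :: "real \<times> (real^'p) \<Rightarrow> real" where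
  "dens1 = (\<lambda>(s2, \<beta>). ig_density ig_shape ig_scale s2 *
     (exp (- ((\<beta> - \<mu>) \<bullet> (A *v (\<beta> - \<mu>))) / (2 * s2)) / sqrt ((2 * pi) ^ CARD('p) * s2 ^ CARD('p) / det A)))"

definition dens2 :: "real \<times> (real^'p) \<Rightarrow> real" where
  "dens2 = (\<lambda>(t, nu). tau_density a b c lam t * (\<Prod>k\<in>UNIV. ig_density 1 (1 + t / lam $ k) (nu $ k)))"

definition dens3 :: "real \<times> (real^'p) \<Rightarrow> real \<times> (real^'p) \<Rightarrow> (real^'p) \<Rightarrow> real" where
  "dens3 = (\<lambda>(s2, \<beta>) (t, nu) l. \<Prod>k\<in>UNIV. ig_density 1 ((\<beta> $ k)\<^sup>2 / (2 * s2) + t / nu $ k) (l $ k))"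

definition "M1 = density (lborel \<Otimes>\<^sub>M lborel) (\<lambda>x. ennreal (dens1 x))"
definition "M2 = density (lborel \<Otimes>\<^sub>M lborel) (\<lambda>x. ennreal (dens2 x))"

lemma measurable_dens[measurable]:
  "dens1 \<in> borel_measurable (borel \<Otimes>\<^sub>M borel)" "dens2 \<in> borel_measurable (borel \<Otimes>\<^sub>M borel)"
  unfolding dens1_def dens2_def split_beta' by measurable

lemma measurable_dens3[measurable (raw)]:
  assumes [measurable]: "g1 \<in> M \<rightarrow>\<^sub>M borel \<Otimes>\<^sub>M borel" "g2 \<in> M \<rightarrow>\<^sub>M borel \<Otimes>\<^sub>M borel" "g3 \<in> M \<rightarrow>\<^sub>M borel"
  shows "(\<lambda>x. dens3 (g1 x) (g2 x) (g3 x)) \<in> borel_measurable M"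
  unfolding dens3_def split_beta' by measurable

lemma sets_M[simp, measurable_cong]: "sets M1 = sets (borel \<Otimes>\<^sub>M borel)" "sets M2 = sets (borel \<Otimes>\<^sub>M borel)"
  by (auto simp: M1_def M2_def intro!: sets_pair_measure_cong)

text \<open>Two forms of one density: the right-hand side, used in \<open>dens1\<close>, is visibly
  measurable jointly in \<open>s2\<close> and \<beta>, while the left-hand side is the form to which
  the Gaussian integrals apply.\<close>

lemma gauss_prec_A:
  assumes "s2 > 0"
  shows "gauss_prec \<mu> ((1 / s2) *\<^sub>R A) \<beta> =
    exp (- ((\<beta> - \<mu>) \<bullet> (A *v (\<beta> - \<mu>))) / (2 * s2)) / sqrt ((2 * pi) ^ CARD('p) * s2 ^ CARD('p) / det A)"
proof -
  have "(2 * pi) ^ CARD('p) / ((1 / s2) ^ CARD('p) * det A) = (2 * pi) ^ CARD('p) * s2 ^ CARD('p) / det A"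
    using assms gaussian_integral(1)[OF pos_def_A] by (simp add: power_divide)
  then show ?thesis using assms
    unfolding gauss_prec_def det_scaleR by (simp add: scaleR_matrix_vector_assoc[symmetric] mult.commute)
qed

lemma dens1_eq: "dens1 (s2, \<beta>) = ig_density ig_shape ig_scale s2 * gauss_prec \<mu> ((1 / s2) *\<^sub>R A) \<beta>"
  by (cases "s2 > 0") (simp_all add: dens1_def gauss_prec_A, simp add: ig_density_def)

lemma pos_def_A_scaled: "s2 > 0 \<Longrightarrow> pos_def ((1 / s2) *\<^sub>R A)"
  by (intro pos_def_scaleR pos_def_A) simp

lemma nn_integral_M1:
  assumes [measurable]: "g1 \<in> borel_measurable (borel \<Otimes>\<^sub>M borel)"
  shows "(\<integral>\<^sup>+x. g1 x \<partial>M1) = (\<integral>\<^sup>+s2. ennreal (ig_density ig_shape ig_scale s2) *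
     (\<integral>\<^sup>+\<beta>. ennreal (gauss_prec \<mu> ((1 / s2) *\<^sub>R A) \<beta>) * g1 (s2, \<beta>) \<partial>lborel) \<partial>lborel)"
proof -
  have "(\<integral>\<^sup>+x. g1 x \<partial>M1) = (\<integral>\<^sup>+x. ennreal (dens1 x) * g1 x \<partial>(lborel \<Otimes>\<^sub>M lborel))"
    unfolding M1_def by (rule nn_integral_density) measurable
  also have "\<dots> = (\<integral>\<^sup>+s2. \<integral>\<^sup>+\<beta>. ennreal (dens1 (s2, \<beta>)) * g1 (s2, \<beta>) \<partial>lborel \<partial>lborel)"
    by (rule lborel.nn_integral_fst[symmetric]) measurable
  also have "\<dots> = (\<integral>\<^sup>+s2. ennreal (ig_density ig_shape ig_scale s2) *
     (\<integral>\<^sup>+\<beta>. ennreal (gauss_prec \<mu> ((1 / s2) *\<^sub>R A) \<beta>) * g1 (s2, \<beta>) \<partial>lborel) \<partial>lborel)"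
    by (intro nn_integral_cong, subst nn_integral_cmult[symmetric])
      (auto simp: dens1_eq ennreal_mult' ig_density_nonneg ig_shape_pos mult.assoc)
  finally show ?thesis .
qed

lemma nn_integral_M2:
  assumes [measurable]: "g1 \<in> borel_measurable (borel \<Otimes>\<^sub>M borel)"
  shows "(\<integral>\<^sup>+x. g1 x \<partial>M2) = (\<integral>\<^sup>+t. (\<integral>\<^sup>+nu. ennreal (\<Prod>k\<in>UNIV. ig_density 1 (1 + t / lam $ k) (nu $ k)) * g1 (t, nu) \<partial>lborel) \<partial>T)"
proof -
  have "(\<integral>\<^sup>+x. g1 x \<partial>M2) = (\<integral>\<^sup>+x. ennreal (dens2 x) * g1 x \<partial>(lborel \<Otimes>\<^sub>M lborel))"
    unfolding M2_def by (rule nn_integral_density) measurable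
  also have "\<dots> = (\<integral>\<^sup>+t. \<integral>\<^sup>+nu. ennreal (dens2 (t, nu)) * g1 (t, nu) \<partial>lborel \<partial>lborel)"
    by (rule lborel.nn_integral_fst[symmetric]) measurable
  also have "\<dots> = (\<integral>\<^sup>+t. ennreal (tau_density a b c lam t) *
     (\<integral>\<^sup>+nu. ennreal (\<Prod>k\<in>UNIV. ig_density 1 (1 + t / lam $ k) (nu $ k)) * g1 (t, nu) \<partial>lborel) \<partial>lborel)"
    by (intro nn_integral_cong, subst nn_integral_cmult[symmetric])
      (auto simp: dens2_def ennreal_mult' tau_density_nonneg mult.assoc)
  also have "\<dots> = (\<integral>\<^sup>+t. (\<integral>\<^sup>+nu. ennreal (\<Prod>k\<in>UNIV. ig_density 1 (1 + t / lam $ k) (nu $ k)) * g1 (t, nu) \<partial>lborel) \<partial>T)"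
    unfolding T_def by (rule nn_integral_density[symmetric]) measurable
  finally show ?thesis .
qed

lemma nn_integral_M1_le:
  assumes [measurable]: "g1 \<in> borel_measurable (borel \<Otimes>\<^sub>M borel)"
    and le: "\<And>s2. s2 > 0 \<Longrightarrow> (\<integral>\<^sup>+\<beta>. ennreal (gauss_prec \<mu> ((1 / s2) *\<^sub>R A) \<beta>) * g1 (s2, \<beta>) \<partial>lborel) \<le> B"
  shows "(\<integral>\<^sup>+x. g1 x \<partial>M1) \<le> B"
proof -
  have "(\<integral>\<^sup>+x. g1 x \<partial>M1) \<le> (\<integral>\<^sup>+s2. ennreal (ig_density ig_shape ig_scale s2) * B \<partial>lborel)"
    unfolding nn_integral_M1[OF assms(1)]
  proof (rule nn_integral_mono)
    fix s2 :: real
    show "ennreal (ig_density ig_shape ig_scale s2) * (\<integral>\<^sup>+\<beta>. ennreal (gauss_prec \<mu> ((1 / s2) *\<^sub>R A) \<beta>) * g1 (s2, \<beta>) \<partial>lborel)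
      \<le> ennreal (ig_density ig_shape ig_scale s2) * B"
      by (cases "s2 > 0") (auto intro!: mult_left_mono le simp: ig_density_def)
  qed
  also have "\<dots> = B" by (simp add: nn_integral_multc nn_integral_ig ig_shape_pos ig_scale_pos)
  finally show ?thesis .
qed

lemma prob_M1: "prob_space M1"
proof (rule prob_spaceI)
  have "(\<integral>\<^sup>+x. 1 \<partial>M1) = (\<integral>\<^sup>+s2. ennreal (ig_density ig_shape ig_scale s2) \<partial>lborel)"
    unfolding nn_integral_M1[OF borel_measurable_const]
  proof (rule nn_integral_cong)
    fix s2 :: real
    show "ennreal (ig_density ig_shape ig_scale s2) * (\<integral>\<^sup>+\<beta>. ennreal (gauss_prec \<mu> ((1 / s2) *\<^sub>R A) \<beta>) * 1 \<partial>lborel) = ennreal (ig_density ig_shape ig_scale s2)"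
      by (cases "s2 > 0") (auto simp: nn_integral_gauss_prec[OF pos_def_A_scaled], simp add: ig_density_def)
  qed
  then show "emeasure M1 (space M1) = 1" by (simp add: nn_integral_ig ig_shape_pos ig_scale_pos)
qed

lemma nu_rate_pos: "t > 0 \<Longrightarrow> 1 + t / lam $ k > 0"
  using lam[of k] by (simp add: add_pos_pos)

lemma prob_M2: "prob_space M2"
proof (rule prob_spaceI)
  have "(\<integral>\<^sup>+x. 1 \<partial>M2) = (\<integral>\<^sup>+t. 1 \<partial>T)"
    unfolding nn_integral_M2[OF borel_measurable_const]
    using AE_T_pos by (intro nn_integral_cong_AE) (auto elim!: eventually_mono simp: nn_integral_prod_ig nu_rate_pos)
  then show "emeasure M2 (space M2) = 1" using T.emeasure_space_1 by simp
qed

lemma AE_M1: "AE x in M1. fst x > 0"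
proof -
  have "fst x > 0" if "dens1 x \<noteq> 0" for x
    using that by (cases x) (auto simp: dens1_eq ig_density_def split: if_splits)
  then show ?thesis unfolding M1_def by (subst AE_density) (auto intro!: AE_I2)
qed

lemma AE_M2: "AE x in M2. fst x > 0 \<and> (\<forall>k. snd x $ k > 0)"
proof -
  have "fst x > 0 \<and> (\<forall>k. snd x $ k > 0)" if "dens2 x \<noteq> 0" for x
    using that by (cases x) (auto simp: dens2_def tau_density_eq tau_unnorm_def prod_zero_iff ig_density_def split: if_splits)
  then show ?thesis unfolding M2_def by (subst AE_density) (auto intro!: AE_I2)
qed

end

lemma nn_integral_lborel_pair:
  fixes h :: "'a::euclidean_space \<times> 'b::euclidean_space \<Rightarrow> ennreal"
  assumes "h \<in> borel_measurable borel"
  shows "(\<integral>\<^sup>+p. h p \<partial>lborel) = (\<integral>\<^sup>+x. \<integral>\<^sup>+z. h (x, z) \<partial>lborel \<partial>lborel)"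
proof -
  have [measurable]: "h \<in> borel_measurable (borel \<Otimes>\<^sub>M borel)" using assms by (simp add: borel_prod)
  show ?thesis by (subst lborel_prod[symmetric], subst lborel.nn_integral_fst) simp_all
qed

text \<open>The tangent at 1 of a concave power. It is the weighted arithmetic-geometric mean
  inequality for \<open>u\<close> and 1, where \<open>m\<close> is the logarithm of their weighted
  geometric mean and \<open>1 + x \<le> exp x\<close> is applied to both normalised terms.\<close>

lemma powr_le_affine:
  assumes "0 < u" "0 \<le> \<delta>" "\<delta> \<le> (1::real)"
  shows "u powr \<delta> \<le> 1 - \<delta> * (1 - u)"
proof -
  define m where "m = \<delta> * ln u"
  have "\<delta> * (1 + (ln u - m)) + (1 - \<delta>) * (1 + (- m)) \<le> \<delta> * exp (ln u - m) + (1 - \<delta>) * exp (- m)"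
    using assms by (intro add_mono mult_left_mono exp_ge_add_one_self) auto
  then have "1 \<le> \<delta> * exp (ln u - m) + (1 - \<delta>) * exp (- m)"
    by (simp add: m_def algebra_simps)
  then have "exp m * 1 \<le> exp m * (\<delta> * exp (ln u - m) + (1 - \<delta>) * exp (- m))" by (intro mult_left_mono) auto
  also have "\<dots> = \<delta> * u + (1 - \<delta>)"
    using assms by (simp add: distrib_left exp_diff exp_minus field_simps)
  finally show ?thesis using assms by (simp add: m_def powr_def algebra_simps)
qed

text \<open>After division by \<open>x + z\<close> both summands lie between 0 and 1, where lowering
  the exponent from 1 to \<delta> can only increase them.\<close>

lemma powr_add_le:
  assumes "0 \<le> x" "0 \<le> z" "0 < \<delta>" "\<delta> \<le> (1::real)"
  shows "(x + z) powr \<delta> \<le> x powr \<delta> + z powr \<delta>"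
proof (cases "x + z > 0")
  case True
  have "x / (x + z) \<le> (x / (x + z)) powr \<delta>" "z / (x + z) \<le> (z / (x + z)) powr \<delta>"
    using assms True powr_mono'[of \<delta> 1 "x / (x + z)"] powr_mono'[of \<delta> 1 "z / (x + z)"] by auto
  then have "1 \<le> (x / (x + z)) powr \<delta> + (z / (x + z)) powr \<delta>"
  proof -
    have "x / (x + z) + z / (x + z) = 1" using True by (simp add: add_divide_distrib[symmetric])
    then show ?thesis using \<open>x / (x + z) \<le> _\<close> \<open>z / (x + z) \<le> _\<close> by linarith
  qed
  also have "\<dots> = (x powr \<delta> + z powr \<delta>) / (x + z) powr \<delta>"
    using assms True by (simp add: powr_divide add_divide_distrib)
  finally show ?thesis using True by (simp add: pos_le_divide_eq)
next
  case False
  then have "x = 0" "z = 0" using assms by auto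
  then show ?thesis by simp
qed

section \<open>Laplace transforms and moments of the two blocks\<close>

context horseshoe_step begin

lemma A_diag: "A $ k $ k = (transpose X ** X) $ k $ k + 1 / lam $ k" and A_diag_pos: "A $ k $ k > 0"
  and XX_diag: "0 \<le> (transpose X ** X) $ k $ k"
proof -
  show "A $ k $ k = (transpose X ** X) $ k $ k + 1 / lam $ k" by (simp add: A_def Amat_def Psi_def)
  show "A $ k $ k > 0" by (rule pos_def_diag[OF pos_def_A])
  show "0 \<le> (transpose X ** X) $ k $ k" by (simp add: matrix_matrix_mult_def transpose_def sum_nonneg)
qed

text \<open>The precision of \<beta> is \<open>A / s2\<close> and the exponent is also divided by
  \<open>s2\<close>, so the variance cancels: the bound holds for every \<open>s2\<close> and
  survives averaging.\<close>

lemma M1_exp: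
  assumes s: "s \<ge> 0"
  shows "(\<integral>\<^sup>+x. ennreal (exp (- (s * ((snd x $ k)\<^sup>2 / (2 * fst x))))) \<partial>M1) \<le> ennreal ((1 + s / A $ k $ k) powr (- (1/2)))"
proof (rule nn_integral_M1_le)
  fix s2 :: real assume s2: "s2 > 0"
  have "(\<integral>\<^sup>+\<beta>. ennreal (gauss_prec \<mu> ((1 / s2) *\<^sub>R A) \<beta>) * ennreal (exp (- (s / s2 * (\<beta> $ k)\<^sup>2 / 2))) \<partial>lborel)
    \<le> ennreal ((1 + (s / s2) / ((1 / s2) *\<^sub>R A) $ k $ k) powr (- (1/2)))"
    using s s2 by (intro nn_integral_gauss_prec_exp pos_def_A_scaled) auto
  then show "(\<integral>\<^sup>+\<beta>. ennreal (gauss_prec \<mu> ((1 / s2) *\<^sub>R A) \<beta>) * ennreal (exp (- (s * ((snd (s2, \<beta>) $ k)\<^sup>2 / (2 * fst (s2, \<beta>)))))) \<partial>lborel)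
    \<le> ennreal ((1 + s / A $ k $ k) powr (- (1/2)))"
    using s2 by (simp add: mult.commute)
qed measurable

text \<open>The point is that the bound is free of \<open>lam\<close>. The Gram matrix alone
  contributes precision at least \<open>m\<close> in every direction, which controls the fluctuation
  of \<beta> around \<mu> and, through the fitted values, \<mu> itself; \<open>1 / s2\<close> has a
  finite mean because the inverse gamma scale is at least \<open>b'\<close>.\<close>

lemma M1_square:
  assumes m: "m > 0" "\<And>x. m * (x \<bullet> x) \<le> (X *v x) \<bullet> (X *v x)"
  shows "(\<integral>\<^sup>+x. ennreal ((snd x $ k)\<^sup>2 / (2 * fst x)) \<partial>M1)
    \<le> ennreal (y \<bullet> y / m * (Gamma (ig_shape + 1) / Gamma ig_shape / b') + 4 * sqrt (2 ^ CARD('p)) / m)"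
proof -
  define B where "B = 4 * sqrt (2 ^ CARD('p)) / m"
  have B0: "B \<ge> 0" using m by (simp add: B_def)
  have quad: "m * (x \<bullet> x) \<le> x \<bullet> (A *v x)" for x
  proof -
    have "0 \<le> (\<Sum>k\<in>UNIV. (x $ k)\<^sup>2 / lam $ k)" using lam by (intro sum_nonneg) (auto simp: less_imp_le)
    then show ?thesis using m(2)[of x] unfolding A_def Amat_quad by linarith
  qed
  have "m * (\<mu> \<bullet> \<mu>) \<le> y \<bullet> y"
  proof -
    have "0 \<le> (y - X *v \<mu>) \<bullet> (y - X *v \<mu>)" by simp
    then have "(X *v \<mu>) \<bullet> y \<le> y \<bullet> y"
      using X_mu_le by (simp add: inner_diff_left inner_diff_right inner_commute)
    then show ?thesis using m(2)[of \<mu>] X_mu_le by linarith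
  qed
  then have mu: "\<mu> \<bullet> \<mu> \<le> y \<bullet> y / m" using m by (simp add: pos_le_divide_eq mult.commute)
  have pw: "(\<beta> $ k)\<^sup>2 / (2 * s2) \<le> y \<bullet> y / m * (1 / s2) + 1 / m * ((\<beta> - \<mu>) \<bullet> (((1 / s2) *\<^sub>R A) *v (\<beta> - \<mu>)))"
    if s2: "s2 > 0" for s2 \<beta>
  proof -
    have "(\<beta> $ k)\<^sup>2 \<le> \<beta> \<bullet> \<beta>"
      unfolding inner_vec_def by (rule order_trans[OF _ member_le_sum[of k]]) (auto simp: power2_eq_square)
    also have "\<dots> \<le> 2 * (\<mu> \<bullet> \<mu>) + 2 * ((\<beta> - \<mu>) \<bullet> (\<beta> - \<mu>))"
      using inner_ge_zero[of "\<beta> - 2 *\<^sub>R \<mu>"]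
      by (simp add: inner_diff_left inner_diff_right inner_commute)
    also have "(\<beta> - \<mu>) \<bullet> (\<beta> - \<mu>) \<le> (\<beta> - \<mu>) \<bullet> (A *v (\<beta> - \<mu>)) / m"
      using quad[of "\<beta> - \<mu>"] m by (simp add: pos_le_divide_eq mult.commute)
    finally have "(\<beta> $ k)\<^sup>2 \<le> 2 * (y \<bullet> y / m + (\<beta> - \<mu>) \<bullet> (A *v (\<beta> - \<mu>)) / m)" using mu by simp
    then have "(\<beta> $ k)\<^sup>2 / (2 * s2) \<le> 2 * (y \<bullet> y / m + (\<beta> - \<mu>) \<bullet> (A *v (\<beta> - \<mu>)) / m) / (2 * s2)"
      using s2 by (intro divide_right_mono) auto
    also have "\<dots> = y \<bullet> y / m * (1 / s2) + 1 / m * ((\<beta> - \<mu>) \<bullet> (((1 / s2) *\<^sub>R A) *v (\<beta> - \<mu>)))"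
      using s2 by (simp add: scaleR_matrix_vector_assoc[symmetric] add_divide_distrib mult.commute)
    finally show ?thesis .
  qed
  have inner: "(\<integral>\<^sup>+\<beta>. ennreal (gauss_prec \<mu> ((1 / s2) *\<^sub>R A) \<beta>) * ennreal ((\<beta> $ k)\<^sup>2 / (2 * s2)) \<partial>lborel)
      \<le> ennreal (y \<bullet> y / m * (1 / s2) + B)" if s2: "s2 > 0" for s2
  proof -
    note P = pos_def_A_scaled[OF s2]
    define q where "q \<beta> = (\<beta> - \<mu>) \<bullet> (((1 / s2) *\<^sub>R A) *v (\<beta> - \<mu>))" for \<beta>
    have [measurable]: "q \<in> borel_measurable borel" unfolding q_def[abs_def] by measurable
    have q0: "0 \<le> q \<beta>" for \<beta> using P by (cases "\<beta> = \<mu>") (auto simp: pos_def_def q_def intro!: less_imp_le)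
    have yy: "0 \<le> y \<bullet> y / m * (1 / s2)" using m s2 by simp
    have "(\<integral>\<^sup>+\<beta>. ennreal (gauss_prec \<mu> ((1 / s2) *\<^sub>R A) \<beta>) * ennreal ((\<beta> $ k)\<^sup>2 / (2 * s2)) \<partial>lborel)
      \<le> (\<integral>\<^sup>+\<beta>. ennreal (gauss_prec \<mu> ((1 / s2) *\<^sub>R A) \<beta>) * ennreal (y \<bullet> y / m * (1 / s2))
           + ennreal (1 / m) * (ennreal (gauss_prec \<mu> ((1 / s2) *\<^sub>R A) \<beta>) * ennreal (q \<beta>)) \<partial>lborel)"
    proof (rule nn_integral_mono)
      fix \<beta> :: "real^'p"
      have "ennreal ((\<beta> $ k)\<^sup>2 / (2 * s2)) \<le> ennreal (y \<bullet> y / m * (1 / s2) + 1 / m * q \<beta>)"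
        using pw[OF s2, of \<beta>] unfolding q_def by (rule ennreal_leI)
      also have "\<dots> = ennreal (y \<bullet> y / m * (1 / s2)) + ennreal (1 / m) * ennreal (q \<beta>)"
        using yy q0 m by (subst ennreal_plus) (auto simp: ennreal_mult simp del: times_divide_eq_left)
      finally have "ennreal (gauss_prec \<mu> ((1 / s2) *\<^sub>R A) \<beta>) * ennreal ((\<beta> $ k)\<^sup>2 / (2 * s2))
        \<le> ennreal (gauss_prec \<mu> ((1 / s2) *\<^sub>R A) \<beta>) * (ennreal (y \<bullet> y / m * (1 / s2)) + ennreal (1 / m) * ennreal (q \<beta>))"
        by (rule mult_left_mono) simp
      then show "ennreal (gauss_prec \<mu> ((1 / s2) *\<^sub>R A) \<beta>) * ennreal ((\<beta> $ k)\<^sup>2 / (2 * s2))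
        \<le> ennreal (gauss_prec \<mu> ((1 / s2) *\<^sub>R A) \<beta>) * ennreal (y \<bullet> y / m * (1 / s2))
           + ennreal (1 / m) * (ennreal (gauss_prec \<mu> ((1 / s2) *\<^sub>R A) \<beta>) * ennreal (q \<beta>))"
        by (simp only: distrib_left mult.left_commute)
    qed
    also have "\<dots> = ennreal (y \<bullet> y / m * (1 / s2))
        + ennreal (1 / m) * (\<integral>\<^sup>+\<beta>. ennreal (gauss_prec \<mu> ((1 / s2) *\<^sub>R A) \<beta>) * ennreal (q \<beta>) \<partial>lborel)"
      by (simp add: nn_integral_add nn_integral_cmult nn_integral_multc nn_integral_gauss_prec[OF P])
    also have "\<dots> \<le> ennreal (y \<bullet> y / m * (1 / s2)) + ennreal (1 / m) * ennreal (4 * sqrt (2 ^ CARD('p)))"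
      using nn_integral_gauss_prec_quad[OF P, of \<mu>] unfolding q_def by (intro add_left_mono mult_left_mono) auto
    also have "\<dots> = ennreal (y \<bullet> y / m * (1 / s2) + B)"
    proof -
      have "ennreal (1 / m) * ennreal (4 * sqrt (2 ^ CARD('p))) = ennreal B"
        using m by (subst ennreal_mult[symmetric]) (auto simp: B_def)
      then show ?thesis using yy B0 by (simp only: ennreal_plus)
    qed
    finally show ?thesis .
  qed
  have "(\<integral>\<^sup>+x. ennreal ((snd x $ k)\<^sup>2 / (2 * fst x)) \<partial>M1)
     \<le> (\<integral>\<^sup>+s2. ennreal (y \<bullet> y / m) * (ennreal (ig_density ig_shape ig_scale s2) * ennreal (s2 powr (- 1)))
         + ennreal (ig_density ig_shape ig_scale s2) * ennreal B \<partial>lborel)"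
  proof (subst nn_integral_M1, measurable, rule nn_integral_mono)
    fix s2 :: real
    show "ennreal (ig_density ig_shape ig_scale s2) * (\<integral>\<^sup>+\<beta>. ennreal (gauss_prec \<mu> ((1 / s2) *\<^sub>R A) \<beta>) * ennreal ((snd (s2, \<beta>) $ k)\<^sup>2 / (2 * fst (s2, \<beta>))) \<partial>lborel)
      \<le> ennreal (y \<bullet> y / m) * (ennreal (ig_density ig_shape ig_scale s2) * ennreal (s2 powr (- 1)))
         + ennreal (ig_density ig_shape ig_scale s2) * ennreal B"
    proof (cases "s2 > 0")
      case True
      have "ennreal (ig_density ig_shape ig_scale s2) * (\<integral>\<^sup>+\<beta>. ennreal (gauss_prec \<mu> ((1 / s2) *\<^sub>R A) \<beta>) * ennreal ((\<beta> $ k)\<^sup>2 / (2 * s2)) \<partial>lborel)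
        \<le> ennreal (ig_density ig_shape ig_scale s2) * ennreal (y \<bullet> y / m * (1 / s2) + B)"
        by (intro mult_left_mono inner True) auto
      also have "ennreal (y \<bullet> y / m * (1 / s2) + B) = ennreal (y \<bullet> y / m) * ennreal (s2 powr (- 1)) + ennreal B"
        using m True B0 by (subst ennreal_mult[symmetric]) (auto simp: powr_minus_divide ennreal_plus)
      finally show ?thesis by (simp add: distrib_left mult_ac)
    qed (simp add: ig_density_def)
  qed
  also have "\<dots> = ennreal (y \<bullet> y / m) * ennreal (Gamma (ig_shape + 1) / Gamma ig_shape * ig_scale powr (- 1)) + ennreal B"
    using nn_integral_ig_powr[OF ig_shape_pos ig_scale_pos, of 1] ig_shape_pos
    by (simp add: nn_integral_add nn_integral_cmult nn_integral_multc nn_integral_ig[OF ig_shape_pos ig_scale_pos])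
  also have "\<dots> \<le> ennreal (y \<bullet> y / m) * ennreal (Gamma (ig_shape + 1) / Gamma ig_shape / b') + ennreal B"
  proof (intro add_right_mono mult_left_mono ennreal_leI)
    have "ig_scale powr (- 1) \<le> 1 / b'"
      using ig_scale_bounds(1) b' by (simp add: powr_minus_divide frac_le)
    then have "Gamma (ig_shape + 1) / Gamma ig_shape * ig_scale powr (- 1) \<le> Gamma (ig_shape + 1) / Gamma ig_shape * (1 / b')"
      using ig_shape_pos by (intro mult_left_mono) (auto intro!: divide_nonneg_pos Gamma_real_pos less_imp_le[OF Gamma_real_pos])
    then show "Gamma (ig_shape + 1) / Gamma ig_shape * ig_scale powr (- 1) \<le> Gamma (ig_shape + 1) / Gamma ig_shape / b'" by simp
  qed simp
  also have "\<dots> = ennreal (y \<bullet> y / m * (Gamma (ig_shape + 1) / Gamma ig_shape / b') + B)"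
  proof -
    have "0 \<le> Gamma (ig_shape + 1) / Gamma ig_shape / b'" "0 \<le> y \<bullet> y / m"
      using ig_shape_pos b' m Gamma_real_pos[of "ig_shape + 1"] Gamma_real_pos[of ig_shape] by auto
    then show ?thesis using B0 by (simp only: ennreal_mult[symmetric] ennreal_plus mult_nonneg_nonneg)
  qed
  finally show ?thesis by (simp add: B_def)
qed

text \<open>Given \<open>t\<close>, the transform is exactly \<open>1 / (1 + u * s * lam_k)\<close>.
  Here \<open>lam_k\<close> is lowered to \<open>1 / A_kk\<close>, so that the base matches that of
  \<open>M1_exp\<close>, and the convex function of \<open>u\<close> is replaced by its chord
  between 0 and 1. The chord is affine, so integrating over \<open>t\<close> only leaves the mean of
  \<open>u\<close>.\<close>

lemma M2_exp:
  assumes s: "s \<ge> 0"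
  shows "(\<integral>\<^sup>+x. ennreal (exp (- (s * (fst x / snd x $ k)))) \<partial>M2)
    \<le> ennreal ((1 - (\<integral>t. u k t \<partial>T)) + (\<integral>t. u k t \<partial>T) * (1 + s / A $ k $ k) powr (- 1))"
proof -
  define z where "z = s / A $ k $ k"
  have z: "z \<ge> 0" using s A_diag_pos[of k] by (simp add: z_def)
  have zlam: "z \<le> s * lam $ k"
  proof -
    have "1 / A $ k $ k \<le> lam $ k"
      using A_diag[of k] XX_diag[of k] lam[of k] A_diag_pos[of k] by (simp add: field_simps)
    then have "s * (1 / A $ k $ k) \<le> s * lam $ k" using s by (rule mult_left_mono)
    then show ?thesis by (simp add: z_def)
  qed
  have "(\<integral>\<^sup>+x. ennreal (exp (- (s * (fst x / snd x $ k)))) \<partial>M2)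
     = (\<integral>\<^sup>+t. (\<integral>\<^sup>+nu. ennreal (\<Prod>k\<in>UNIV. ig_density 1 (1 + t / lam $ k) (nu $ k)) * ennreal (exp (- (s * (t / nu $ k)))) \<partial>lborel) \<partial>T)"
    by (subst nn_integral_M2) auto
  also have "\<dots> \<le> (\<integral>\<^sup>+t. ennreal ((1 - u k t) + u k t * (1 + z) powr (- 1)) \<partial>T)"
  proof (rule nn_integral_mono_AE, rule eventually_mono[OF AE_T_pos])
    fix t :: real assume t: "t > 0"
    have q: "1 + t / lam $ k > 0" using nu_rate_pos[OF t] .
    have "(\<integral>\<^sup>+nu. ennreal (\<Prod>k\<in>UNIV. ig_density 1 (1 + t / lam $ k) (nu $ k)) * ennreal (exp (- (s * (t / nu $ k)))) \<partial>lborel)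
      = (\<integral>\<^sup>+x. ennreal (ig_density 1 (1 + t / lam $ k) x) * ennreal (exp (- (s * (t / x)))) \<partial>lborel)"
      by (rule nn_integral_prod_ig_coord[OF nu_rate_pos[OF t], of "\<lambda>x. exp (- (s * (t / x)))"]) auto
    also have "\<dots> = (\<integral>\<^sup>+x. ennreal (ig_density 1 (1 + t / lam $ k) x) * ennreal (exp (- ((s * t) / x))) \<partial>lborel)"
      by simp
    also have "\<dots> = ennreal ((1 + t / lam $ k) / (1 + t / lam $ k + s * t))"
      using q s t by (intro nn_integral_ig_exp) auto
    also have "\<dots> \<le> ennreal ((1 - u k t) + u k t * (1 + z) powr (- 1))"
    proof (rule ennreal_leI)
      define v where "v = u k t"
      have v: "0 \<le> v" "v \<le> 1" using u_bounds[OF t, of k] by (auto simp: v_def)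
      have vz: "0 \<le> v * z" using v z by simp
      have "(1 + t / lam $ k) / (1 + t / lam $ k + s * t) = 1 / (1 + v * (s * lam $ k))"
      proof -
        have "1 + t / lam $ k = (t + lam $ k) / lam $ k" using lam[of k] by (simp add: field_simps)
        moreover have "s * t = (t + lam $ k) / lam $ k * (v * (s * lam $ k))"
          using lam[of k] t by (simp add: v_def)
        ultimately have "1 + t / lam $ k + s * t = (1 + t / lam $ k) * (1 + v * (s * lam $ k))"
          by (simp only: distrib_left mult_1_right)
        then show ?thesis using q by simp
      qed
      also have "\<dots> \<le> 1 / (1 + v * z)"
        using zlam v vz mult_nonneg_nonneg[OF v(1) order_trans[OF z zlam]]
        by (intro divide_left_mono add_left_mono mult_left_mono mult_pos_pos add_pos_nonneg) (auto intro: order_trans)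
      also have "\<dots> \<le> (1 + z - v * z) / (1 + z)"
      proof -
        have "(1 + v * z) * (1 + z - v * z) = 1 + z + v * (1 - v) * (z * z)" by (simp add: algebra_simps)
        moreover have "0 \<le> v * (1 - v) * (z * z)" using v by simp
        ultimately have "1 + z \<le> (1 + z - v * z) * (1 + v * z)" by (simp add: mult.commute)
        then have "1 * (1 + z) \<le> (1 + z - v * z) * (1 + v * z)" by simp
        then show ?thesis using z vz by (intro frac_le_eq[THEN iffD2] | simp add: divide_le_eq pos_le_divide_eq)+
      qed
      also have "\<dots> = (1 - v) + v * (1 + z) powr (- 1)"
        using z by (simp add: powr_minus_divide field_simps)
      finally show "(1 + t / lam $ k) / (1 + t / lam $ k + s * t) \<le> (1 - u k t) + u k t * (1 + z) powr (- 1)"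
        by (simp only: v_def)
    qed
    finally show "(\<integral>\<^sup>+nu. ennreal (\<Prod>k\<in>UNIV. ig_density 1 (1 + t / lam $ k) (nu $ k)) * ennreal (exp (- (s * (t / nu $ k)))) \<partial>lborel)
      \<le> ennreal ((1 - u k t) + u k t * (1 + z) powr (- 1))" .
  qed
  also have "\<dots> = ennreal (\<integral>t. (1 - u k t) + u k t * (1 + z) powr (- 1) \<partial>T)"
  proof (rule nn_integral_eq_integral)
    show "integrable T (\<lambda>t. (1 - u k t) + u k t * (1 + z) powr (- 1))"
      using u_integrable[of k] by (intro Bochner_Integration.integrable_add Bochner_Integration.integrable_diff integrable_mult_left) auto
    show "AE t in T. 0 \<le> (1 - u k t) + u k t * (1 + z) powr (- 1)"
    proof (rule eventually_mono[OF AE_T_pos])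
      fix t :: real assume "t > 0"
      then show "0 \<le> (1 - u k t) + u k t * (1 + z) powr (- 1)"
        using u_bounds[of t k] by (intro add_nonneg_nonneg mult_nonneg_nonneg) auto
    qed
  qed
  also have "(\<integral>t. (1 - u k t) + u k t * (1 + z) powr (- 1) \<partial>T) = (1 - (\<integral>t. u k t \<partial>T)) + (\<integral>t. u k t \<partial>T) * (1 + z) powr (- 1)"
  proof -
    note ui = u_integrable[of k]
    have "(\<integral>t. (1 - u k t) + u k t * (1 + z) powr (- 1) \<partial>T) = (\<integral>t. 1 - u k t \<partial>T) + (\<integral>t. u k t * (1 + z) powr (- 1) \<partial>T)"
      by (intro Bochner_Integration.integral_add Bochner_Integration.integrable_diff integrable_mult_left ui) simp
    also have "(\<integral>t. 1 - u k t \<partial>T) = 1 - (\<integral>t. u k t \<partial>T)" using ui T.prob_space by simp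
    also have "(\<integral>t. u k t * (1 + z) powr (- 1) \<partial>T) = (\<integral>t. u k t \<partial>T) * (1 + z) powr (- 1)" by (rule integral_mult_left_zero)
    finally show ?thesis .
  qed
  finally show ?thesis by (simp only: z_def)
qed

text \<open>Given \<open>t\<close>, the moment is exactly \<open>Gamma (1 + \<delta>)\<close> times
  the \<delta>-th power of \<open>lam_k * u\<close>. Replacing the concave power of \<open>u\<close>
  by its tangent at 1 again leaves only the mean of \<open>u\<close>.\<close>

lemma M2_powr:
  assumes \<delta>: "0 < \<delta>" "\<delta> < 1"
  shows "(\<integral>\<^sup>+x. ennreal ((fst x / snd x $ k) powr \<delta>) \<partial>M2)
    \<le> ennreal (Gamma (1 + \<delta>) * (lam $ k) powr \<delta> * (1 - \<delta> * (1 - (\<integral>t. u k t \<partial>T))))"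
proof -
  have G: "Gamma (1 + \<delta>) > 0" using \<delta> by (intro Gamma_real_pos) simp
  have "(\<integral>\<^sup>+x. ennreal ((fst x / snd x $ k) powr \<delta>) \<partial>M2)
     = (\<integral>\<^sup>+t. (\<integral>\<^sup>+nu. ennreal (\<Prod>k\<in>UNIV. ig_density 1 (1 + t / lam $ k) (nu $ k)) * ennreal ((t / nu $ k) powr \<delta>) \<partial>lborel) \<partial>T)"
    by (subst nn_integral_M2) auto
  also have "\<dots> \<le> (\<integral>\<^sup>+t. ennreal (Gamma (1 + \<delta>) * (lam $ k) powr \<delta> * (1 - \<delta> * (1 - u k t))) \<partial>T)"
  proof (rule nn_integral_mono_AE, rule eventually_mono[OF AE_T_pos])
    fix t :: real assume t: "t > 0"
    define q where "q = 1 + t / lam $ k"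
    have q: "q > 0" using nu_rate_pos[OF t] by (simp add: q_def)
    have u0: "u k t > 0" using t lam[of k] by (simp add: add_pos_pos)
    have "(\<integral>\<^sup>+nu. ennreal (\<Prod>k\<in>UNIV. ig_density 1 (1 + t / lam $ k) (nu $ k)) * ennreal ((t / nu $ k) powr \<delta>) \<partial>lborel)
      = (\<integral>\<^sup>+x. ennreal (ig_density 1 q x) * ennreal ((t / x) powr \<delta>) \<partial>lborel)"
      unfolding q_def by (rule nn_integral_prod_ig_coord[OF nu_rate_pos[OF t], of "\<lambda>x. (t / x) powr \<delta>"]) auto
    also have "\<dots> = (\<integral>\<^sup>+x. ennreal (t powr \<delta>) * (ennreal (ig_density 1 q x) * ennreal (x powr (- \<delta>))) \<partial>lborel)"
    proof (rule nn_integral_cong)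
      fix x :: real
      show "ennreal (ig_density 1 q x) * ennreal ((t / x) powr \<delta>) = ennreal (t powr \<delta>) * (ennreal (ig_density 1 q x) * ennreal (x powr (- \<delta>)))"
      proof (cases "x > 0")
        case True
        have "(t / x) powr \<delta> = t powr \<delta> * x powr (- \<delta>)" using t True by (simp add: powr_divide powr_minus_divide)
        then show ?thesis by (simp add: ennreal_mult mult.left_commute)
      qed (simp add: ig_density_def)
    qed
    also have "\<dots> = ennreal (t powr \<delta>) * ennreal (Gamma (1 + \<delta>) * q powr (- \<delta>))"
      using nn_integral_ig_powr[of 1 q \<delta>] q \<delta> by (subst nn_integral_cmult) auto
    also have "\<dots> = ennreal (Gamma (1 + \<delta>) * (lam $ k) powr \<delta> * (u k t) powr \<delta>)"
    proof -
      have "t powr \<delta> * q powr (- \<delta>) = (t / q) powr \<delta>" using t q by (simp add: powr_divide powr_minus_divide)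
      also have "t / q = lam $ k * u k t" using lam[of k] t by (simp add: q_def field_simps)
      also have "\<dots> powr \<delta> = (lam $ k) powr \<delta> * (u k t) powr \<delta>" using lam[of k] u0 by (subst powr_mult) auto
      finally have "t powr \<delta> * (Gamma (1 + \<delta>) * q powr (- \<delta>)) = Gamma (1 + \<delta>) * (lam $ k) powr \<delta> * (u k t) powr \<delta>"
        by (simp add: mult.left_commute[of "t powr \<delta>"])
      then show ?thesis using G by (subst ennreal_mult[symmetric]) auto
    qed
    also have "\<dots> \<le> ennreal (Gamma (1 + \<delta>) * (lam $ k) powr \<delta> * (1 - \<delta> * (1 - u k t)))"
      using powr_le_affine[OF u0, of \<delta>] \<delta> G by (intro ennreal_leI mult_left_mono) auto
    finally show "(\<integral>\<^sup>+nu. ennreal (\<Prod>k\<in>UNIV. ig_density 1 (1 + t / lam $ k) (nu $ k)) * ennreal ((t / nu $ k) powr \<delta>) \<partial>lborel)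
      \<le> ennreal (Gamma (1 + \<delta>) * (lam $ k) powr \<delta> * (1 - \<delta> * (1 - u k t)))" .
  qed
  also have "\<dots> = ennreal (\<integral>t. Gamma (1 + \<delta>) * (lam $ k) powr \<delta> * (1 - \<delta> * (1 - u k t)) \<partial>T)"
  proof (rule nn_integral_eq_integral)
    show "integrable T (\<lambda>t. Gamma (1 + \<delta>) * (lam $ k) powr \<delta> * (1 - \<delta> * (1 - u k t)))"
      using u_integrable[of k] by (intro integrable_mult_right Bochner_Integration.integrable_diff) auto
    show "AE t in T. 0 \<le> Gamma (1 + \<delta>) * (lam $ k) powr \<delta> * (1 - \<delta> * (1 - u k t))"
    proof (rule eventually_mono[OF AE_T_pos])
      fix t :: real assume t: "t > 0"
      have "\<delta> * (1 - u k t) \<le> 1 * 1" using \<delta> u_bounds[OF t, of k] by (intro mult_mono) auto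
      then show "0 \<le> Gamma (1 + \<delta>) * (lam $ k) powr \<delta> * (1 - \<delta> * (1 - u k t))" using G by simp
    qed
  qed
  also have "(\<integral>t. Gamma (1 + \<delta>) * (lam $ k) powr \<delta> * (1 - \<delta> * (1 - u k t)) \<partial>T)
     = Gamma (1 + \<delta>) * (lam $ k) powr \<delta> * (1 - \<delta> * (1 - (\<integral>t. u k t \<partial>T)))"
  proof -
    note ui = u_integrable[of k]
    have "(\<integral>t. 1 - \<delta> * (1 - u k t) \<partial>T) = 1 - \<delta> * (1 - (\<integral>t. u k t \<partial>T))"
      using ui T.prob_space by (simp del: times_divide_eq_right)
    then show ?thesis by (simp only: integral_mult_right_zero)
  qed
  finally show ?thesis .
qed

end

lemma pos_not_nonpos_Int: "0 < x \<Longrightarrow> (x::real) \<notin> \<int>\<^sub>\<le>\<^sub>0"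
  by (auto elim!: nonpos_Ints_cases)

section \<open>Moments of the new local scales after one step\<close>

context horseshoe_step begin

abbreviation (input) "step_density \<equiv> alg1_density y X a' b' a b c lam"

lemma step_density_eq:
  "step_density (\<beta>, s2, l, t, nu) = dens1 (s2, \<beta>) * dens2 (t, nu) * dens3 (s2, \<beta>) (t, nu) l"
proof (cases "s2 > 0")
  case True
  then show ?thesis
    unfolding alg1_density_def Let_def prod.case A_def[symmetric] \<mu>_def[symmetric] ig_shape_def[symmetric]
      ig_scale_def[symmetric] mvn_density_eq[OF pos_def_A True] dens1_eq dens2_def dens3_def
    by (simp only: mult.assoc)
next
  case False
  then show ?thesis by (simp add: alg1_density_def Let_def dens1_def ig_density_def)
qed

lemma dens_nonneg: "0 \<le> dens1 x" "0 \<le> dens2 z" "0 \<le> dens3 x z l"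
proof -
  show "0 \<le> dens1 x"
  proof (cases "fst x > 0")
    case True
    then show ?thesis using gauss_prec_nonneg[OF pos_def_A_scaled] ig_density_nonneg[OF ig_shape_pos]
      by (cases x) (simp add: dens1_eq)
  next
    case False
    then show ?thesis by (cases x) (simp add: dens1_eq ig_density_def)
  qed
  show "0 \<le> dens2 z" by (cases z) (simp add: dens2_def tau_density_nonneg prod_nonneg ig_density_nonneg)
  show "0 \<le> dens3 x z l" by (cases x; cases z) (simp add: dens3_def prod_nonneg ig_density_nonneg)
qed

lemma sigma_finite_M: "sigma_finite_measure M1" "sigma_finite_measure M2"
  using prob_M1 prob_M2 by (auto intro: prob_space_imp_sigma_finite)

text \<open>In the state tuple the new \<open>lam\<close> stands between the blocks
  \<open>(\<beta>, s2)\<close> and \<open>(t, nu)\<close> on which it depends. Repeated exchanges of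
  integrals move it to the innermost place and turn the outer integrals into expectations over the
  two independent blocks.\<close>

lemma nn_integral_step:
  assumes [measurable]: "G \<in> borel_measurable borel"
  shows "(\<integral>\<^sup>+s'. ennreal (step_density s') * G (fst (snd (snd s'))) \<partial>lborel)
    = (\<integral>\<^sup>+x. \<integral>\<^sup>+z. (\<integral>\<^sup>+l. ennreal (dens3 x z l) * G l \<partial>lborel) \<partial>M2 \<partial>M1)"
proof -
  define H where "H \<beta> s2 l w = ennreal (dens1 (s2, \<beta>)) * (ennreal (dens2 w) * (ennreal (dens3 (s2, \<beta>) w l) * G l))" for \<beta> s2 l w
  have H_eq: "ennreal (step_density s') * G (fst (snd (snd s'))) = H (fst s') (fst (snd s')) (fst (snd (snd s'))) (snd (snd (snd s')))" for s'
    by (cases s') (simp add: H_def step_density_eq ennreal_mult dens_nonneg mult.assoc)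
  have H_meas[measurable (raw)]: "(\<lambda>x. H (f1 x) (f2 x) (f3 x) (f4 x)) \<in> borel_measurable M"
    if [measurable]: "f1 \<in> M \<rightarrow>\<^sub>M borel" "f2 \<in> M \<rightarrow>\<^sub>M borel" "f3 \<in> M \<rightarrow>\<^sub>M borel" "f4 \<in> M \<rightarrow>\<^sub>M borel \<Otimes>\<^sub>M borel"
    for M :: "'q measure" and f1 f2 f3 f4
    unfolding H_def by measurable
  note space_pair_measure[simp]
  have b4: "(\<lambda>p. H (fst p) (fst (snd p)) (fst (snd (snd p))) (snd (snd (snd p)))) \<in> borel_measurable borel"
    unfolding borel_prod[symmetric] by measurable
  have b3: "(\<lambda>p. H \<beta> (fst p) (fst (snd p)) (snd (snd p))) \<in> borel_measurable borel" for \<beta>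
    unfolding borel_prod[symmetric] by measurable
  have b2: "(\<lambda>p. H \<beta> s2 (fst p) (snd p)) \<in> borel_measurable borel" for \<beta> s2
    unfolding borel_prod[symmetric] by measurable
  have "(\<integral>\<^sup>+s'. ennreal (step_density s') * G (fst (snd (snd s'))) \<partial>lborel)
      = (\<integral>\<^sup>+\<beta>. \<integral>\<^sup>+s2. \<integral>\<^sup>+l. \<integral>\<^sup>+w. H \<beta> s2 l w \<partial>lborel \<partial>lborel \<partial>lborel \<partial>lborel)"
    unfolding H_eq by (simp add: nn_integral_lborel_pair[OF b4] nn_integral_lborel_pair[OF b3] nn_integral_lborel_pair[OF b2])
  also have "\<dots> = (\<integral>\<^sup>+\<beta>. \<integral>\<^sup>+s2. \<integral>\<^sup>+l. \<integral>\<^sup>+w. H \<beta> s2 l w \<partial>(lborel \<Otimes>\<^sub>M lborel) \<partial>lborel \<partial>lborel \<partial>lborel)"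
    by (simp add: lborel_prod)
  also have "\<dots> = (\<integral>\<^sup>+s2. \<integral>\<^sup>+\<beta>. \<integral>\<^sup>+l. \<integral>\<^sup>+w. H \<beta> s2 l w \<partial>(lborel \<Otimes>\<^sub>M lborel) \<partial>lborel \<partial>lborel \<partial>lborel)"
    by (rule lborel_pair.Fubini') measurable
  also have "\<dots> = (\<integral>\<^sup>+s2. \<integral>\<^sup>+\<beta>. \<integral>\<^sup>+w. \<integral>\<^sup>+l. H \<beta> s2 l w \<partial>lborel \<partial>(lborel \<Otimes>\<^sub>M lborel) \<partial>lborel \<partial>lborel)"
  proof (rule nn_integral_cong, rule nn_integral_cong)
    fix s2 :: real and \<beta> :: "real^'p"
    have "(\<integral>\<^sup>+l. \<integral>\<^sup>+w. H \<beta> s2 l w \<partial>lborel \<partial>lborel) = (\<integral>\<^sup>+w. \<integral>\<^sup>+l. H \<beta> s2 l w \<partial>lborel \<partial>lborel)"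
    proof (rule lborel_pair.Fubini')
      show "(\<lambda>(w, l). H \<beta> s2 l w) \<in> borel_measurable (lborel \<Otimes>\<^sub>M lborel)"
        unfolding lborel_prod[symmetric] by measurable
    qed
    then show "(\<integral>\<^sup>+l. \<integral>\<^sup>+w. H \<beta> s2 l w \<partial>(lborel \<Otimes>\<^sub>M lborel) \<partial>lborel) = (\<integral>\<^sup>+w. \<integral>\<^sup>+l. H \<beta> s2 l w \<partial>lborel \<partial>(lborel \<Otimes>\<^sub>M lborel))"
      by (simp add: lborel_prod)
  qed
  also have "\<dots> = (\<integral>\<^sup>+x. \<integral>\<^sup>+w. \<integral>\<^sup>+l. H (snd x) (fst x) l w \<partial>lborel \<partial>(lborel \<Otimes>\<^sub>M lborel) \<partial>(lborel \<Otimes>\<^sub>M lborel))"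
    by (subst lborel.nn_integral_fst[symmetric]) (auto simp: lborel_prod[symmetric])
  also have "\<dots> = (\<integral>\<^sup>+x. ennreal (dens1 x) * (\<integral>\<^sup>+w. ennreal (dens2 w) * (\<integral>\<^sup>+l. ennreal (dens3 x w l) * G l \<partial>lborel) \<partial>(lborel \<Otimes>\<^sub>M lborel)) \<partial>(lborel \<Otimes>\<^sub>M lborel))"
  proof (rule nn_integral_cong)
    fix x :: "real \<times> (real^'p)"
    have "(\<integral>\<^sup>+l. H (snd x) (fst x) l w \<partial>lborel) = ennreal (dens1 x) * (ennreal (dens2 w) * (\<integral>\<^sup>+l. ennreal (dens3 x w l) * G l \<partial>lborel))" for w
    proof -
      have "(\<integral>\<^sup>+l. ennreal (dens2 w) * (ennreal (dens3 x w l) * G l) \<partial>lborel) = ennreal (dens2 w) * (\<integral>\<^sup>+l. ennreal (dens3 x w l) * G l \<partial>lborel)"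
        by (rule nn_integral_cmult) measurable
      moreover have "(\<integral>\<^sup>+l. H (snd x) (fst x) l w \<partial>lborel) = ennreal (dens1 x) * (\<integral>\<^sup>+l. ennreal (dens2 w) * (ennreal (dens3 x w l) * G l) \<partial>lborel)"
        unfolding H_def prod.collapse by (rule nn_integral_cmult) measurable
      ultimately show ?thesis by simp
    qed
    then show "(\<integral>\<^sup>+w. \<integral>\<^sup>+l. H (snd x) (fst x) l w \<partial>lborel \<partial>(lborel \<Otimes>\<^sub>M lborel))
        = ennreal (dens1 x) * (\<integral>\<^sup>+w. ennreal (dens2 w) * (\<integral>\<^sup>+l. ennreal (dens3 x w l) * G l \<partial>lborel) \<partial>(lborel \<Otimes>\<^sub>M lborel))"
      by (simp only:) (rule nn_integral_cmult, measurable)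
  qed
  also have "\<dots> = (\<integral>\<^sup>+x. ennreal (dens1 x) * (\<integral>\<^sup>+z. (\<integral>\<^sup>+l. ennreal (dens3 x z l) * G l \<partial>lborel) \<partial>M2) \<partial>(lborel \<Otimes>\<^sub>M lborel))"
    unfolding M2_def by (subst nn_integral_density) simp_all
  also have "\<dots> = (\<integral>\<^sup>+x. \<integral>\<^sup>+z. (\<integral>\<^sup>+l. ennreal (dens3 x z l) * G l \<partial>lborel) \<partial>M2 \<partial>M1)"
  proof -
    interpret M2: sigma_finite_measure M2 by (rule sigma_finite_M)
    show ?thesis unfolding M1_def by (rule nn_integral_density[symmetric]) measurable
  qed
  finally show ?thesis .
qed

lemma rates_pos:
  fixes x z :: "real \<times> (real^'p)"
  assumes "fst x > 0" "fst z > 0 \<and> (\<forall>k. snd z $ k > 0)"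
  shows "0 < (snd x $ k)\<^sup>2 / (2 * fst x) + fst z / snd z $ k"
  using assms by (intro add_nonneg_pos) auto

lemma dens3_moment:
  fixes x z :: "real \<times> (real^'p)"
  assumes "fst x > 0" "fst z > 0 \<and> (\<forall>k. snd z $ k > 0)" and e: "e < 1"
  shows "(\<integral>\<^sup>+l. ennreal (dens3 x z l) * ennreal ((l $ k) powr e) \<partial>lborel)
    = ennreal (Gamma (1 - e) * ((snd x $ k)\<^sup>2 / (2 * fst x) + fst z / snd z $ k) powr e)"
  using nn_integral_prod_ig_powr[OF rates_pos[OF assms(1,2)] e, where j = k] by (simp add: dens3_def split_beta')

lemma step_prob: "(\<integral>\<^sup>+s'. ennreal (step_density s') \<partial>lborel) = 1"
proof -
  have "(\<integral>\<^sup>+s'. ennreal (step_density s') \<partial>lborel) = (\<integral>\<^sup>+s'. ennreal (step_density s') * 1 \<partial>lborel)" by simp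
  also have "\<dots> = (\<integral>\<^sup>+x. \<integral>\<^sup>+z. (\<integral>\<^sup>+l. ennreal (dens3 x z l) * 1 \<partial>lborel) \<partial>M2 \<partial>M1)"
    by (rule nn_integral_step[of "\<lambda>_. 1"]) simp
  also have "\<dots> = (\<integral>\<^sup>+x. \<integral>\<^sup>+z. 1 \<partial>M2 \<partial>M1)"
  proof (rule nn_integral_cong_AE, rule eventually_mono[OF AE_M1], rule nn_integral_cong_AE, rule eventually_mono[OF AE_M2])
    fix x :: "real \<times> (real^'p)" and z :: "real \<times> (real^'p)"
    assume "0 < fst x" "0 < fst z \<and> (\<forall>k. 0 < snd z $ k)"
    then show "(\<integral>\<^sup>+l. ennreal (dens3 x z l) * 1 \<partial>lborel) = 1"
      using nn_integral_prod_ig[OF rates_pos] by (simp add: dens3_def split_beta')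
  qed
  also have "\<dots> = 1"
    using prob_space.emeasure_space_1[OF prob_M1] prob_space.emeasure_space_1[OF prob_M2] by simp
  finally show ?thesis .
qed

lemma u_mean_bounds: "0 \<le> (\<integral>t. u k t \<partial>T)" "(\<integral>t. u k t \<partial>T) \<le> 1"
  using T_integral_mono[of "\<lambda>_. 0" "u k"] T_integral_mono[of "u k" "\<lambda>_. 1"] u_integrable[of k] u_bounds[of _ k] T.prob_space
  by auto

text \<open>Writing the negative power as a Laplace transform factorises the expectation over
  \<open>M1\<close> and \<open>M2\<close>; the bounds of the two factors combine to beta prime integrals.\<close>

lemma step_neg_moment:
  assumes \<delta>: "0 < \<delta>" "\<delta> < 1/2"
  shows "(\<integral>\<^sup>+s'. ennreal (step_density s') * ennreal ((fst (snd (snd s')) $ k) powr (- \<delta>)) \<partial>lborel)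
    \<le> ennreal (Gamma (1/2 - \<delta>) * Gamma (1 + \<delta>) / Gamma (1/2) * (1 - 2 * \<delta> * (\<integral>t. u k t \<partial>T))
        * ((lam $ k) powr (- \<delta>) + ((transpose X ** X) $ k $ k) powr \<delta>))"
proof -
  interpret M1: sigma_finite_measure M1 by (rule sigma_finite_M)
  interpret M2: sigma_finite_measure M2 by (rule sigma_finite_M)
  interpret M1l: pair_sigma_finite M1 "lborel :: real measure" ..
  interpret M2l: pair_sigma_finite M2 "lborel :: real measure" ..
  define r1 where "r1 x = (snd x $ k)\<^sup>2 / (2 * fst x)" for x :: "real \<times> (real^'p)"
  define r2 where "r2 z = fst z / snd z $ k" for z :: "real \<times> (real^'p)"
  have [measurable]: "r1 \<in> borel_measurable (borel \<Otimes>\<^sub>M borel)" "r2 \<in> borel_measurable (borel \<Otimes>\<^sub>M borel)"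
    unfolding r1_def[abs_def] r2_def[abs_def] by measurable
  define l where "l = 1 / A $ k $ k"
  have l: "l > 0" using A_diag_pos[of k] by (simp add: l_def)
  define v where "v = (\<integral>t. u k t \<partial>T)"
  have v: "0 \<le> v" "v \<le> 1"
    unfolding v_def by (rule u_mean_bounds)+
  \<comment> \<open>The weight in the Laplace representation of a negative power is
    \<open>s powr (\<delta> - 1) / Gamma \<delta>\<close>; multiplied by the factor
    \<open>Gamma (1 + \<delta>)\<close> of the inverse gamma moment it has the constant
    \<delta>.\<close>
  define g where "g s = ennreal (\<delta> * s powr (\<delta> - 1)) * indicator {0<..} s" for s :: real
  have [measurable]: "g \<in> borel_measurable borel" unfolding g_def[abs_def] by measurable
  have Gd: "Gamma \<delta> > 0" "Gamma (1 + \<delta>) = \<delta> * Gamma \<delta>"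
    using \<delta> Gamma_plus1[OF pos_not_nonpos_Int, of \<delta>] by (simp_all add: Gamma_real_pos add.commute)
  have "(\<integral>\<^sup>+s'. ennreal (step_density s') * ennreal ((fst (snd (snd s')) $ k) powr (- \<delta>)) \<partial>lborel)
    = (\<integral>\<^sup>+x. \<integral>\<^sup>+z. (\<integral>\<^sup>+l. ennreal (dens3 x z l) * ennreal ((l $ k) powr (- \<delta>)) \<partial>lborel) \<partial>M2 \<partial>M1)"
    by (rule nn_integral_step) measurable
  also have "\<dots> = (\<integral>\<^sup>+x. \<integral>\<^sup>+z. \<integral>\<^sup>+s. g s * ennreal (exp (- (s * r1 x))) * ennreal (exp (- (s * r2 z))) \<partial>lborel \<partial>M2 \<partial>M1)"
  proof (rule nn_integral_cong_AE, rule eventually_mono[OF AE_M1], rule nn_integral_cong_AE, rule eventually_mono[OF AE_M2])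
    fix x :: "real \<times> (real^'p)" and z :: "real \<times> (real^'p)"
    assume x: "0 < fst x" and z: "0 < fst z \<and> (\<forall>k. 0 < snd z $ k)"
    have r: "0 < r1 x + r2 z" unfolding r1_def r2_def by (rule rates_pos[OF x z])
    have "(\<integral>\<^sup>+l. ennreal (dens3 x z l) * ennreal ((l $ k) powr (- \<delta>)) \<partial>lborel) = ennreal (Gamma (1 + \<delta>) * (r1 x + r2 z) powr (- \<delta>))"
      using dens3_moment[OF x z, of "- \<delta>" k] \<delta> by (simp add: r1_def r2_def)
    also have "\<dots> = ennreal \<delta> * ennreal (Gamma \<delta> * (r1 x + r2 z) powr (- \<delta>))"
      using \<delta> Gd by (simp add: ennreal_mult[symmetric] mult.assoc)
    also have "ennreal (Gamma \<delta> * (r1 x + r2 z) powr (- \<delta>)) = (\<integral>\<^sup>+s\<in>{0<..}. ennreal (s powr (\<delta> - 1) * exp (- ((r1 x + r2 z) * s))) \<partial>lborel)"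
      by (rule nn_integral_Gamma[OF \<delta>(1) r, symmetric])
    also have "ennreal \<delta> * \<dots> = (\<integral>\<^sup>+s. ennreal \<delta> * (ennreal (s powr (\<delta> - 1) * exp (- ((r1 x + r2 z) * s))) * indicator {0<..} s) \<partial>lborel)"
      by (rule nn_integral_cmult[symmetric]) measurable
    also have "\<dots> = (\<integral>\<^sup>+s. g s * ennreal (exp (- (s * r1 x))) * ennreal (exp (- (s * r2 z))) \<partial>lborel)"
    proof (rule nn_integral_cong)
      fix s :: real
      have "exp (- ((r1 x + r2 z) * s)) = exp (- (s * r1 x)) * exp (- (s * r2 z))"
        by (simp add: exp_add[symmetric] algebra_simps)
      then show "ennreal \<delta> * (ennreal (s powr (\<delta> - 1) * exp (- ((r1 x + r2 z) * s))) * indicator {0<..} s)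
          = g s * ennreal (exp (- (s * r1 x))) * ennreal (exp (- (s * r2 z)))"
        using \<delta> by (simp add: g_def ennreal_mult mult_ac)
    qed
    finally show "(\<integral>\<^sup>+l. ennreal (dens3 x z l) * ennreal ((l $ k) powr (- \<delta>)) \<partial>lborel)
      = (\<integral>\<^sup>+s. g s * ennreal (exp (- (s * r1 x))) * ennreal (exp (- (s * r2 z))) \<partial>lborel)" .
  qed
  also have "\<dots> = (\<integral>\<^sup>+x. \<integral>\<^sup>+s. \<integral>\<^sup>+z. g s * ennreal (exp (- (s * r1 x))) * ennreal (exp (- (s * r2 z))) \<partial>M2 \<partial>lborel \<partial>M1)"
    by (intro nn_integral_cong M2l.Fubini'[symmetric]) measurable
  also have "\<dots> = (\<integral>\<^sup>+s. \<integral>\<^sup>+x. \<integral>\<^sup>+z. g s * ennreal (exp (- (s * r1 x))) * ennreal (exp (- (s * r2 z))) \<partial>M2 \<partial>M1 \<partial>lborel)"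
    by (rule M1l.Fubini'[symmetric]) measurable
  also have "\<dots> = (\<integral>\<^sup>+s. g s * (\<integral>\<^sup>+x. ennreal (exp (- (s * r1 x))) \<partial>M1) * (\<integral>\<^sup>+z. ennreal (exp (- (s * r2 z))) \<partial>M2) \<partial>lborel)"
    by (simp add: nn_integral_cmult nn_integral_multc mult.assoc)
  also have "\<dots> \<le> (\<integral>\<^sup>+s. ennreal (\<delta> * (1 - v)) * (ennreal (s powr (\<delta> - 1) * (1 + s * l) powr (- (1/2))) * indicator {0<..} s)
      + ennreal (\<delta> * v) * (ennreal (s powr (\<delta> - 1) * (1 + s * l) powr (- (3/2))) * indicator {0<..} s) \<partial>lborel)"
  proof (rule nn_integral_mono)
    fix s :: real
    show "g s * (\<integral>\<^sup>+x. ennreal (exp (- (s * r1 x))) \<partial>M1) * (\<integral>\<^sup>+z. ennreal (exp (- (s * r2 z))) \<partial>M2)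
      \<le> ennreal (\<delta> * (1 - v)) * (ennreal (s powr (\<delta> - 1) * (1 + s * l) powr (- (1/2))) * indicator {0<..} s)
      + ennreal (\<delta> * v) * (ennreal (s powr (\<delta> - 1) * (1 + s * l) powr (- (3/2))) * indicator {0<..} s)"
    proof (cases "s > 0")
      case s: True
      have sl: "1 + s * l > 0" using s l by (simp add: add_pos_pos)
      have "g s * (\<integral>\<^sup>+x. ennreal (exp (- (s * r1 x))) \<partial>M1) * (\<integral>\<^sup>+z. ennreal (exp (- (s * r2 z))) \<partial>M2)
        \<le> g s * ennreal ((1 + s * l) powr (- (1/2))) * ennreal ((1 - v) + v * (1 + s * l) powr (- 1))"
        using M1_exp[of s k] M2_exp[of s k] s unfolding r1_def r2_def v_def l_def
        by (intro mult_mono mult_left_mono) auto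
      also have "\<dots> = ennreal (\<delta> * s powr (\<delta> - 1) * (1 + s * l) powr (- (1/2)) * ((1 - v) + v * (1 + s * l) powr (- 1)))"
        using s \<delta> v by (simp add: g_def ennreal_mult)
      also have "\<delta> * s powr (\<delta> - 1) * (1 + s * l) powr (- (1/2)) * ((1 - v) + v * (1 + s * l) powr (- 1))
         = \<delta> * (1 - v) * (s powr (\<delta> - 1) * (1 + s * l) powr (- (1/2))) + \<delta> * v * (s powr (\<delta> - 1) * ((1 + s * l) powr (- (1/2)) * (1 + s * l) powr (- 1)))"
        by (simp add: algebra_simps)
      also have "(1 + s * l) powr (- (1/2)) * (1 + s * l) powr (- 1) = (1 + s * l) powr (- (3/2))"
        unfolding powr_add[symmetric] by simp
      also have "ennreal (\<delta> * (1 - v) * (s powr (\<delta> - 1) * (1 + s * l) powr (- (1/2))) + \<delta> * v * (s powr (\<delta> - 1) * (1 + s * l) powr (- (3/2))))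
        = ennreal (\<delta> * (1 - v)) * ennreal (s powr (\<delta> - 1) * (1 + s * l) powr (- (1/2))) + ennreal (\<delta> * v) * ennreal (s powr (\<delta> - 1) * (1 + s * l) powr (- (3/2)))"
        using \<delta> v by (subst ennreal_plus) (auto simp: ennreal_mult)
      finally show ?thesis using s by simp
    qed (simp add: g_def)
  qed
  \<comment> \<open>The integral with exponent 1/2 converges only for \<delta> < 1/2: a squared
    Gaussian has finite negative moments only below that order.\<close>
  also have "\<dots> = ennreal (\<delta> * (1 - v)) * ennreal (l powr (- \<delta>) * Gamma \<delta> * Gamma (1/2 - \<delta>) / Gamma (1/2))
      + ennreal (\<delta> * v) * ennreal (l powr (- \<delta>) * Gamma \<delta> * Gamma (3/2 - \<delta>) / Gamma (3/2))"
    using nn_integral_beta_prime[of \<delta> "1/2" l] nn_integral_beta_prime[of \<delta> "3/2" l] \<delta> l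
    by (simp add: nn_integral_add nn_integral_cmult)
  also have "\<dots> = ennreal (\<delta> * (1 - v) * (l powr (- \<delta>) * Gamma \<delta> * Gamma (1/2 - \<delta>) / Gamma (1/2))
      + \<delta> * v * (l powr (- \<delta>) * Gamma \<delta> * Gamma (3/2 - \<delta>) / Gamma (3/2)))"
  proof -
    have "0 \<le> l powr (- \<delta>) * Gamma \<delta> * Gamma (1/2 - \<delta>) / Gamma (1/2)" "0 \<le> l powr (- \<delta>) * Gamma \<delta> * Gamma (3/2 - \<delta>) / Gamma (3/2)"
      using \<delta> Gd by (auto intro!: divide_nonneg_pos mult_nonneg_nonneg Gamma_real_pos less_imp_le[OF Gamma_real_pos])
    moreover have "0 \<le> \<delta> * (1 - v)" "0 \<le> \<delta> * v" using \<delta> v by auto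
    ultimately show ?thesis by (simp only: ennreal_mult ennreal_plus mult_nonneg_nonneg)
  qed
  \<comment> \<open>The functional equation gives \<open>Gamma (3/2 - \<delta>) / Gamma (3/2) = (1 -
    2 * \<delta>) * Gamma (1/2 - \<delta>) / Gamma (1/2)\<close>, and
    \<open>(1 - v) + v * (1 - 2 * \<delta>) = 1 - 2 * \<delta> * v\<close>.\<close>
  also have "\<delta> * (1 - v) * (l powr (- \<delta>) * Gamma \<delta> * Gamma (1/2 - \<delta>) / Gamma (1/2))
      + \<delta> * v * (l powr (- \<delta>) * Gamma \<delta> * Gamma (3/2 - \<delta>) / Gamma (3/2))
      = Gamma (1/2 - \<delta>) * Gamma (1 + \<delta>) / Gamma (1/2) * (1 - 2 * \<delta> * v) * l powr (- \<delta>)"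
  proof -
    have "Gamma (3/2 - \<delta>) = (1/2 - \<delta>) * Gamma (1/2 - \<delta>)" 
      using Gamma_plus1[OF pos_not_nonpos_Int, of "1/2 - \<delta>"] \<delta> by (simp add: algebra_simps)
    moreover have "Gamma (3/2 :: real) = 1/2 * Gamma (1/2)" 
      using Gamma_plus1[OF pos_not_nonpos_Int, of "1/2"] by simp
    moreover have "Gamma (1/2 :: real) > 0" by (intro Gamma_real_pos) simp
    moreover have "\<delta> * (1 - v) * (L * D * g / h) + \<delta> * v * (L * D * ((1/2 - \<delta>) * g) / (1/2 * h)) = g * (\<delta> * D) / h * (1 - 2 * \<delta> * v) * L"
      if "h > 0" for L D g h :: real using that by (simp add: field_simps)
    ultimately show ?thesis unfolding Gd(2) by metis
  qed
  also have "ennreal (Gamma (1/2 - \<delta>) * Gamma (1 + \<delta>) / Gamma (1/2) * (1 - 2 * \<delta> * v) * l powr (- \<delta>))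
     \<le> ennreal (Gamma (1/2 - \<delta>) * Gamma (1 + \<delta>) / Gamma (1/2) * (1 - 2 * \<delta> * v)
        * ((lam $ k) powr (- \<delta>) + ((transpose X ** X) $ k $ k) powr \<delta>))"
  proof (intro ennreal_leI mult_left_mono)
    have "l powr (- \<delta>) = (1 / lam $ k + (transpose X ** X) $ k $ k) powr \<delta>"
      using A_diag_pos[of k] A_diag[of k] by (simp add: l_def powr_minus_divide powr_divide add.commute)
    also have "\<dots> \<le> (1 / lam $ k) powr \<delta> + ((transpose X ** X) $ k $ k) powr \<delta>"
      using lam[of k] XX_diag[of k] \<delta> by (intro powr_add_le) (auto simp: less_imp_le)
    also have "(1 / lam $ k) powr \<delta> = (lam $ k) powr (- \<delta>)"
      using lam[of k] by (simp add: powr_minus_divide powr_divide)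
    finally show "l powr (- \<delta>) \<le> (lam $ k) powr (- \<delta>) + ((transpose X ** X) $ k $ k) powr \<delta>" .
    have "2 * \<delta> * v \<le> 1 * 1" using \<delta> v by (intro mult_mono) auto
    then show "0 \<le> Gamma (1/2 - \<delta>) * Gamma (1 + \<delta>) / Gamma (1/2) * (1 - 2 * \<delta> * v)"
      using \<delta> by (intro mult_nonneg_nonneg divide_nonneg_pos Gamma_real_pos less_imp_le[OF Gamma_real_pos]) auto
  qed
  finally show ?thesis by (simp only: v_def)
qed

text \<open>Subadditivity of the power separates the two rates. The Gaussian one is bounded by a
  constant, so only \<open>t / nu_k\<close> grows with \<open>lam_k\<close>, and it does so with a
  factor lowered by the mean of \<open>1 - u\<close>.\<close>

lemma step_pos_moment:
  assumes \<delta>: "0 < \<delta>" "\<delta> < 1" and B: "(\<integral>\<^sup>+x. ennreal ((snd x $ k)\<^sup>2 / (2 * fst x)) \<partial>M1) \<le> ennreal B" "0 \<le> B"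
  shows "(\<integral>\<^sup>+s'. ennreal (step_density s') * ennreal ((fst (snd (snd s')) $ k) powr \<delta>) \<partial>lborel)
    \<le> ennreal (Gamma (1 - \<delta>) * (1 + B) + Gamma (1 - \<delta>) * Gamma (1 + \<delta>) * ((lam $ k) powr \<delta> * (1 - \<delta> * (1 - (\<integral>t. u k t \<partial>T)))))"
proof -
  define r1 where "r1 x = (snd x $ k)\<^sup>2 / (2 * fst x)" for x :: "real \<times> (real^'p)"
  define r2 where "r2 z = fst z / snd z $ k" for z :: "real \<times> (real^'p)"
  have [measurable]: "r1 \<in> borel_measurable (borel \<Otimes>\<^sub>M borel)" "r2 \<in> borel_measurable (borel \<Otimes>\<^sub>M borel)"
    unfolding r1_def[abs_def] r2_def[abs_def] by measurable
  define v where "v = (\<integral>t. u k t \<partial>T)"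
  have v: "0 \<le> v" "v \<le> 1" unfolding v_def by (rule u_mean_bounds)+
  define D where "D = Gamma (1 + \<delta>) * (lam $ k) powr \<delta> * (1 - \<delta> * (1 - v))"
  have G1: "Gamma (1 - \<delta>) > 0" "Gamma (1 + \<delta>) > 0" using \<delta> by (auto intro!: Gamma_real_pos)
  have D0: "D \<ge> 0"
  proof -
    have "\<delta> * (1 - v) \<le> 1" using \<delta> v by (intro mult_le_one) auto
    then show ?thesis using G1 by (simp add: D_def)
  qed
  have "(\<integral>\<^sup>+s'. ennreal (step_density s') * ennreal ((fst (snd (snd s')) $ k) powr \<delta>) \<partial>lborel)
    = (\<integral>\<^sup>+x. \<integral>\<^sup>+z. (\<integral>\<^sup>+l. ennreal (dens3 x z l) * ennreal ((l $ k) powr \<delta>) \<partial>lborel) \<partial>M2 \<partial>M1)"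
    by (rule nn_integral_step) measurable
  also have "\<dots> \<le> (\<integral>\<^sup>+x. \<integral>\<^sup>+z. ennreal (Gamma (1 - \<delta>)) * (1 + ennreal (r1 x) + ennreal (r2 z powr \<delta>)) \<partial>M2 \<partial>M1)"
  proof (rule nn_integral_mono_AE, rule eventually_mono[OF AE_M1], rule nn_integral_mono_AE, rule eventually_mono[OF AE_M2])
    fix x :: "real \<times> (real^'p)" and z :: "real \<times> (real^'p)"
    assume x: "0 < fst x" and z: "0 < fst z \<and> (\<forall>k. 0 < snd z $ k)"
    have r1: "0 \<le> r1 x" using x by (simp add: r1_def)
    have r2: "0 \<le> r2 z" using z by (simp add: r2_def less_imp_le)
    have "(r1 x + r2 z) powr \<delta> \<le> r1 x powr \<delta> + r2 z powr \<delta>" using r1 r2 \<delta> by (intro powr_add_le) auto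
    also have "r1 x powr \<delta> \<le> 1 + r1 x"
    proof (cases "r1 x = 0")
      case False
      have "r1 x powr \<delta> \<le> 1 - \<delta> * (1 - r1 x)" using False r1 \<delta> by (intro powr_le_affine) auto
      also have "\<dots> = 1 - \<delta> + \<delta> * r1 x" by (simp add: algebra_simps)
      also have "\<dots> \<le> 1 + 1 * r1 x" using \<delta> r1 by (intro add_mono mult_right_mono) auto
      finally show ?thesis by simp
    qed simp
    finally have "Gamma (1 - \<delta>) * (r1 x + r2 z) powr \<delta> \<le> Gamma (1 - \<delta>) * (1 + r1 x + r2 z powr \<delta>)"
      using G1 by (intro mult_left_mono) auto
    then have "ennreal (Gamma (1 - \<delta>) * (r1 x + r2 z) powr \<delta>) \<le> ennreal (Gamma (1 - \<delta>) * (1 + r1 x + r2 z powr \<delta>))"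
      by (rule ennreal_leI)
    also have "\<dots> = ennreal (Gamma (1 - \<delta>)) * (1 + ennreal (r1 x) + ennreal (r2 z powr \<delta>))"
      using G1 r1 by (simp add: ennreal_mult)
    finally show "(\<integral>\<^sup>+l. ennreal (dens3 x z l) * ennreal ((l $ k) powr \<delta>) \<partial>lborel)
      \<le> ennreal (Gamma (1 - \<delta>)) * (1 + ennreal (r1 x) + ennreal (r2 z powr \<delta>))"
      using dens3_moment[OF x z \<delta>(2), of k] by (simp add: r1_def r2_def)
  qed
  also have "\<dots> = ennreal (Gamma (1 - \<delta>)) * (1 + (\<integral>\<^sup>+x. ennreal (r1 x) \<partial>M1) + (\<integral>\<^sup>+z. ennreal (r2 z powr \<delta>) \<partial>M2))"
    using prob_space.emeasure_space_1[OF prob_M1] prob_space.emeasure_space_1[OF prob_M2]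
    by (simp add: nn_integral_cmult nn_integral_add)
  also have "\<dots> \<le> ennreal (Gamma (1 - \<delta>)) * (1 + ennreal B + ennreal D)"
    using B(1) M2_powr[OF \<delta>, of k] unfolding r1_def r2_def D_def v_def by (intro mult_left_mono add_mono) auto
  also have "\<dots> = ennreal (Gamma (1 - \<delta>) * (1 + B + D))"
    using G1 B D0 by (simp add: ennreal_mult)
  also have "Gamma (1 - \<delta>) * (1 + B + D) = Gamma (1 - \<delta>) * (1 + B) + Gamma (1 - \<delta>) * Gamma (1 + \<delta>) * ((lam $ k) powr \<delta> * (1 - \<delta> * (1 - v)))"
    by (simp add: D_def algebra_simps)
  finally show ?thesis by (simp only: v_def)
qed

end

section \<open>Drift\<close>

text \<open>Both products equal 1 at \<open>\<delta> = 0\<close>, with derivatives \<open>2 * (ln 2 - m)\<close> and \<open>- \<kappa>\<close>: the constant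
  \<open>ln 2\<close> of the theorem is half of \<open>Digamma 1 - Digamma (1/2)\<close>.\<close>

lemma exponent_exists:
  fixes m \<kappa> :: real
  assumes m: "m > ln 2" and \<kappa>: "\<kappa> > 0"
  obtains \<delta> where "0 < \<delta>" "\<delta> < 1/2"
    "Gamma (1/2 - \<delta>) * Gamma (1 + \<delta>) / Gamma (1/2) * (1 - 2 * \<delta> * m) < 1"
    "Gamma (1 - \<delta>) * Gamma (1 + \<delta>) * (1 - \<delta> * \<kappa>) < 1"
proof -
  have np: "(1/2 :: real) \<notin> \<int>\<^sub>\<le>\<^sub>0" "(1 :: real) \<notin> \<int>\<^sub>\<le>\<^sub>0" by (rule pos_not_nonpos_Int, simp)+
  have "Gamma (1/2 :: real) > 0" by (rule Gamma_real_pos) simp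
  then have G0: "Gamma (1/2 :: real) \<noteq> 0" by (rule less_imp_neq[symmetric])
  define F where "F \<delta> = Gamma (1/2 - \<delta>) * Gamma (1 + \<delta>) / Gamma (1/2) * (1 - 2 * \<delta> * m)" for \<delta> :: real
  define H where "H \<delta> = Gamma (1 - \<delta>) * Gamma (1 + \<delta>) * (1 - \<delta> * \<kappa>)" for \<delta> :: real
  have F0: "F 0 = 1" "H 0 = 1" using G0 by (simp_all add: F_def H_def)
  have "(F has_real_derivative (Digamma 1 - Digamma (1/2) - 2 * m)) (at 0)"
    unfolding F_def[abs_def] using np G0
    by (auto intro!: derivative_eq_intros simp del: Gamma_one_half_real simp: field_simps)
  also have "Digamma 1 - Digamma (1/2) - 2 * m = 2 * (ln 2 - m)" by (simp add: Digamma_one_half)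
  finally have "\<exists>d>0. \<forall>h>0. h < d \<longrightarrow> F 0 > F (0 + h)"
    using m has_real_derivative_neg_dec_right[of F _ 0 UNIV] by auto
  then obtain d1 where d1: "d1 > 0" "\<And>h. 0 < h \<Longrightarrow> h < d1 \<Longrightarrow> F h < 1" using F0 by auto
  have "(H has_real_derivative (- \<kappa>)) (at 0)"
    unfolding H_def[abs_def] using np
    by (auto intro!: derivative_eq_intros)
  then have "\<exists>d>0. \<forall>h>0. h < d \<longrightarrow> H 0 > H (0 + h)"
    using \<kappa> has_real_derivative_neg_dec_right[of H _ 0 UNIV] by auto
  then obtain d2 where d2: "d2 > 0" "\<And>h. 0 < h \<Longrightarrow> h < d2 \<Longrightarrow> H h < 1" using F0 by auto
  define \<delta> where "\<delta> = min (1/4) (min d1 d2 / 2)"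
  have "0 < \<delta>" "\<delta> < 1/2" "\<delta> < d1" "\<delta> < d2" using d1(1) d2(1) by (auto simp: \<delta>_def min_def)
  then show thesis using that[of \<delta>] d1(2)[of \<delta>] d2(2)[of \<delta>] by (simp add: F_def H_def)
qed

lemma gram_lower_bound:
  fixes X :: "real^'p^'n"
  assumes "invertible (transpose X ** X)"
  obtains m where "m > 0" "\<And>x. m * (x \<bullet> x) \<le> (X *v x) \<bullet> (X *v x)"
proof -
  have inj: "inj ((*v) X)"
  proof (rule injI)
    fix x z assume "X *v x = X *v z"
    then have "(transpose X ** X) *v x = (transpose X ** X) *v z" by (simp only: matrix_vector_mul_assoc[symmetric])
    then show "x = z" using inj_matrix_vector_mult[OF assms] by (rule injD[rotated])
  qed
  obtain B where B: "B > 0" "\<And>x. B * norm x \<le> norm (X *v x)"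
    using linear_inj_bounded_below_pos[OF matrix_vector_mul_linear inj] by metis
  have "B\<^sup>2 * (x \<bullet> x) \<le> (X *v x) \<bullet> (X *v x)" for x
    using power_mono[OF B(2)[of x], of 2] B(1) by (simp add: power_mult_distrib power2_norm_eq_inner)
  then show thesis using that[of "B\<^sup>2"] B(1) by simp
qed

definition lyap :: "real \<Rightarrow> ('p::finite) state \<Rightarrow> real" where
  "lyap \<delta> s = (\<Sum>k\<in>UNIV. (fst (snd (snd s)) $ k) powr (- \<delta>) + (fst (snd (snd s)) $ k) powr \<delta>)"

lemma lyap_nonneg: "0 \<le> lyap \<delta> s"
  by (simp add: lyap_def sum_nonneg)

lemma lyap_eq: "lyap \<delta> s = (\<Sum>k\<in>UNIV. (fst (snd (snd s)) $ k) powr (- \<delta>)) + (\<Sum>k\<in>UNIV. (fst (snd (snd s)) $ k) powr \<delta>)"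
  by (simp add: lyap_def sum.distrib)

lemma measurable_lyap[measurable]: "lyap \<delta> \<in> borel_measurable borel"
  unfolding lyap_def[abs_def] borel_prod[symmetric] by measurable

text \<open>The constants \<open>m\<close> and \<kappa> are fixed before \<delta>, which is then
  taken so small that the multipliers of both families of powers fall below 1; all additive
  constants may depend on \<delta>. The one-step moments are summed over the coordinates, and the
  weighted means of \<open>u\<close> are inserted with the sign in which each bound is
  available.\<close>

lemma lyap_drift:
  fixes y :: "real^'n" and X :: "real^'p^'n" and a' b' a b c :: real
  assumes XX: "invertible (transpose X ** X)" and a': "a' > 0" and b': "b' > 0"
    and a: "a > 0" and b: "b > 0" and c: "c > 0" and ap: "a / real CARD('p) > ln 2 - 1/2"
  obtains \<delta> \<gamma> C where "0 < \<delta>" "\<delta> < 1/2" "0 \<le> \<gamma>" "\<gamma> < 1" "0 \<le> C"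
    "\<And>s :: 'p state. (\<forall>k. fst (snd (snd s)) $ k > 0) \<Longrightarrow>
      (\<integral>\<^sup>+s'. ennreal (alg1_density y X a' b' a b c (fst (snd (snd s))) s') * ennreal (lyap \<delta> s') \<partial>lborel)
        \<le> ennreal (\<gamma> * lyap \<delta> s + C)"
proof -
  define p where "p = real CARD('p)"
  have p: "p > 0" by (simp add: p_def)
  obtain m where m: "m > ln 2" and m_le:
    "\<And>\<delta>. 0 < \<delta> \<Longrightarrow> \<delta> < 1 \<Longrightarrow> \<exists>B\<ge>0. \<forall>lam :: real^'p. (\<forall>k. lam $ k > 0) \<longrightarrow>
      m * (\<Sum>k\<in>UNIV. (lam $ k) powr (- \<delta>)) - B
        \<le> (\<Sum>k\<in>UNIV. (lam $ k) powr (- \<delta>) * (\<integral>t. t / (t + lam $ k) \<partial>tau_law.T a b c lam))"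
    using weighted_u_lower_uniform[OF a b c ap] by blast
  define \<kappa> where "\<kappa> = (p / 2 + b) / (p + a + b)"
  have \<kappa>: "\<kappa> > 0" using p a b by (simp add: \<kappa>_def)
  obtain \<delta> where \<delta>: "0 < \<delta>" "\<delta> < 1/2"
    and c1: "Gamma (1/2 - \<delta>) * Gamma (1 + \<delta>) / Gamma (1/2) * (1 - 2 * \<delta> * m) < 1"
    and c2: "Gamma (1 - \<delta>) * Gamma (1 + \<delta>) * (1 - \<delta> * \<kappa>) < 1"
    using exponent_exists[OF m \<kappa>] by blast
  define G1 where "G1 = Gamma (1/2 - \<delta>) * Gamma (1 + \<delta>) / Gamma (1/2)"
  define G2 where "G2 = Gamma (1 - \<delta>) * Gamma (1 + \<delta>)"
  define G3 where "G3 = Gamma (1 - \<delta>)"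
  have Gpos: "G1 > 0" "G2 > 0" "G3 > 0"
    unfolding G1_def G2_def G3_def using \<delta>
    by (intro divide_pos_pos mult_pos_pos Gamma_real_pos; simp)+
  obtain B1 where B1: "B1 \<ge> 0" "\<And>lam :: real^'p. (\<forall>k. lam $ k > 0) \<Longrightarrow>
      m * (\<Sum>k\<in>UNIV. (lam $ k) powr (- \<delta>)) - B1
        \<le> (\<Sum>k\<in>UNIV. (lam $ k) powr (- \<delta>) * (\<integral>t. t / (t + lam $ k) \<partial>tau_law.T a b c lam))"
    using m_le[of \<delta>] \<delta> by auto
  obtain mX where mX: "mX > 0" "\<And>x. mX * (x \<bullet> x) \<le> (X *v x) \<bullet> (X *v x)"
    using gram_lower_bound[OF XX] by blast
  define sh where "sh = real CARD('n) / 2 + a'"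
  define B2 where "B2 = y \<bullet> y / mX * (Gamma (sh + 1) / Gamma sh / b') + 4 * sqrt (2 ^ CARD('p)) / mX"
  have "sh > 0" using a' by (simp add: sh_def add_nonneg_pos)
  then have B2: "B2 \<ge> 0"
    using mX(1) b' Gamma_real_pos[of "sh + 1"] Gamma_real_pos[of sh] by (auto simp: B2_def intro!: add_nonneg_nonneg mult_nonneg_nonneg)
  define xx where "xx = (\<Sum>k\<in>UNIV. ((transpose X ** X) $ k $ k) powr \<delta>)"
  define C2 where "C2 = (a + b) * p * c powr \<delta> / (p + a + b)"
  have C2: "C2 \<ge> 0" using a b p by (simp add: C2_def)
  have xx: "xx \<ge> 0" by (simp add: xx_def sum_nonneg)
  \<comment> \<open>The larger of the two contraction factors. The 0 only secures the sign, as
    \<open>m\<close> is not bounded from above here.\<close>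
  define \<gamma> where "\<gamma> = max 0 (max (G1 * (1 - 2 * \<delta> * m)) (G2 * (1 - \<delta> * \<kappa>)))"
  define C where "C = G1 * (2 * \<delta> * B1) + G1 * xx + p * (G3 * (1 + B2)) + G2 * (\<delta> * C2)"
  show thesis
  proof (rule that[OF \<delta>])
    show "0 \<le> \<gamma>" "\<gamma> < 1" using c1 c2 by (auto simp: \<gamma>_def G1_def G2_def)
    show "0 \<le> C" using Gpos B1(1) B2 C2 xx \<delta> p by (simp add: C_def)
    fix s :: "'p state" assume pos: "\<forall>k. fst (snd (snd s)) $ k > 0"
    define lam where "lam = fst (snd (snd s))"
    interpret horseshoe_step a b c lam y X a' b'
      using pos XX a' b' a b c by unfold_locales (auto simp: lam_def)
    define W1 where "W1 = (\<Sum>k\<in>UNIV. (lam $ k) powr (- \<delta>))"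
    define W2 where "W2 = (\<Sum>k\<in>UNIV. (lam $ k) powr \<delta>)"
    define v where "v k = (\<integral>t. u k t \<partial>T)" for k
    have v: "0 \<le> v k" "v k \<le> 1" for k unfolding v_def by (rule u_mean_bounds)+
    have W0: "0 \<le> W1" "0 \<le> W2" by (simp_all add: W1_def W2_def sum_nonneg)
    define e1 where "e1 k = G1 * (1 - 2 * \<delta> * v k) * ((lam $ k) powr (- \<delta>) + ((transpose X ** X) $ k $ k) powr \<delta>)" for k
    define e2 where "e2 k = G3 * (1 + B2) + G2 * ((lam $ k) powr \<delta> * (1 - \<delta> * (1 - v k)))" for k
    have e1: "(\<integral>\<^sup>+s'. ennreal (step_density s') * ennreal ((fst (snd (snd s')) $ k) powr (- \<delta>)) \<partial>lborel) \<le> ennreal (e1 k)" for k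
      using step_neg_moment[OF \<delta>, of k] by (simp only: e1_def G1_def v_def)
    have e2: "(\<integral>\<^sup>+s'. ennreal (step_density s') * ennreal ((fst (snd (snd s')) $ k) powr \<delta>) \<partial>lborel) \<le> ennreal (e2 k)" for k
      using step_pos_moment[of \<delta> k B2] M1_square[OF mX, of k] B2 \<delta> unfolding e2_def G2_def G3_def v_def B2_def sh_def ig_shape_def by simp
    have dv: "2 * \<delta> * v k \<le> 1" "\<delta> * (1 - v k) \<le> 1" for k
      using v[of k] \<delta> mult_le_one[of "2 * \<delta>" "v k"] mult_le_one[of \<delta> "1 - v k"] by auto
    have e0: "0 \<le> e1 k" "0 \<le> e2 k" for k
      using Gpos B2 dv[of k] by (simp_all add: e1_def e2_def)
    have [measurable]: "(\<lambda>s'. ennreal (step_density s')) \<in> borel_measurable borel"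
    proof -
      have "(\<lambda>s'. step_density s') = (\<lambda>s'. dens1 (fst (snd s'), fst s') * dens2 (fst (snd (snd (snd s'))), snd (snd (snd (snd s'))))
          * dens3 (fst (snd s'), fst s') (fst (snd (snd (snd s'))), snd (snd (snd (snd s')))) (fst (snd (snd s'))))"
      proof (rule ext)
        fix s' :: "'p state" show "step_density s' = dens1 (fst (snd s'), fst s') * dens2 (fst (snd (snd (snd s'))), snd (snd (snd (snd s'))))
          * dens3 (fst (snd s'), fst s') (fst (snd (snd (snd s'))), snd (snd (snd (snd s')))) (fst (snd (snd s')))"
          by (cases s') (simp add: step_density_eq)
      qed
      then show ?thesis unfolding borel_prod[symmetric] by simp
    qed
    have [measurable]: "(\<lambda>s' :: 'p state. ennreal ((fst (snd (snd s')) $ k) powr e)) \<in> borel_measurable borel" for k e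
      unfolding borel_prod[symmetric] by measurable
    have "(\<integral>\<^sup>+s'. ennreal (step_density s') * ennreal (lyap \<delta> s') \<partial>lborel)
      = (\<integral>\<^sup>+s'. (\<Sum>k\<in>UNIV. ennreal (step_density s') * ennreal ((fst (snd (snd s')) $ k) powr (- \<delta>))
          + ennreal (step_density s') * ennreal ((fst (snd (snd s')) $ k) powr \<delta>)) \<partial>lborel)"
      unfolding lyap_def by (simp add: sum_ennreal[symmetric] sum_distrib_left distrib_left)
    also have "\<dots> = (\<Sum>k\<in>UNIV. (\<integral>\<^sup>+s'. ennreal (step_density s') * ennreal ((fst (snd (snd s')) $ k) powr (- \<delta>)) \<partial>lborel)
          + (\<integral>\<^sup>+s'. ennreal (step_density s') * ennreal ((fst (snd (snd s')) $ k) powr \<delta>) \<partial>lborel))"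
      by (subst nn_integral_sum) (simp_all add: nn_integral_add)
    also have "\<dots> \<le> (\<Sum>k\<in>UNIV. ennreal (e1 k) + ennreal (e2 k))" by (intro sum_mono add_mono e1 e2)
    also have "\<dots> = ennreal ((\<Sum>k\<in>UNIV. e1 k) + (\<Sum>k\<in>UNIV. e2 k))"
      using e0 by (simp add: ennreal_plus[symmetric] sum.distrib[symmetric] sum_ennreal del: ennreal_plus)
    also have "\<dots> \<le> ennreal (\<gamma> * lyap \<delta> s + C)"
    proof (rule ennreal_leI)
      have "(\<Sum>k\<in>UNIV. e1 k) \<le> (\<Sum>k\<in>UNIV. G1 * ((lam $ k) powr (- \<delta>)) - G1 * (2 * \<delta>) * ((lam $ k) powr (- \<delta>) * v k) + G1 * ((transpose X ** X) $ k $ k) powr \<delta>)"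
      proof (rule sum_mono)
        fix k
        have "0 \<le> G1 * (2 * \<delta> * v k) * ((transpose X ** X) $ k $ k) powr \<delta>" using Gpos \<delta> v[of k] by simp
        then show "e1 k \<le> G1 * ((lam $ k) powr (- \<delta>)) - G1 * (2 * \<delta>) * ((lam $ k) powr (- \<delta>) * v k) + G1 * ((transpose X ** X) $ k $ k) powr \<delta>"
          by (simp add: e1_def algebra_simps)
      qed
      also have "\<dots> = G1 * W1 - G1 * (2 * \<delta>) * (\<Sum>k\<in>UNIV. (lam $ k) powr (- \<delta>) * v k) + G1 * xx"
        by (simp add: sum.distrib sum_subtractf sum_distrib_left[symmetric] W1_def xx_def)
      also have "\<dots> \<le> G1 * W1 - G1 * (2 * \<delta>) * (m * W1 - B1) + G1 * xx"
        using B1(2)[of lam] pos Gpos \<delta> unfolding lam_def[symmetric] W1_def v_def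
        by (intro add_right_mono diff_left_mono mult_left_mono) auto
      also have "\<dots> = G1 * (1 - 2 * \<delta> * m) * W1 + (G1 * (2 * \<delta> * B1) + G1 * xx)" by (simp add: algebra_simps)
      also have "\<dots> \<le> \<gamma> * W1 + (G1 * (2 * \<delta> * B1) + G1 * xx)"
        using W0 by (intro add_right_mono mult_right_mono) (auto simp: \<gamma>_def)
      finally have s1: "(\<Sum>k\<in>UNIV. e1 k) \<le> \<gamma> * W1 + (G1 * (2 * \<delta> * B1) + G1 * xx)" .
      have "(\<Sum>k\<in>UNIV. e2 k) = p * (G3 * (1 + B2)) + G2 * ((1 - \<delta>) * W2 + \<delta> * (\<Sum>k\<in>UNIV. (lam $ k) powr \<delta> * v k))"
      proof -
        define K0 where "K0 = G3 * (1 + B2)"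
        have "e2 k = K0 + (G2 * (1 - \<delta>) * (lam $ k) powr \<delta> + G2 * \<delta> * ((lam $ k) powr \<delta> * v k))" for k
          by (simp add: e2_def K0_def algebra_simps)
        then have "(\<Sum>k\<in>UNIV. e2 k) = p * K0 + (G2 * (1 - \<delta>) * W2 + G2 * \<delta> * (\<Sum>k\<in>UNIV. (lam $ k) powr \<delta> * v k))"
          by (simp only: sum.distrib sum_distrib_left[symmetric] W2_def sum_constant p_def)
        then show ?thesis unfolding K0_def[symmetric] by (simp add: distrib_left mult.assoc)
      qed
      also have "(\<Sum>k\<in>UNIV. (lam $ k) powr \<delta> * v k) \<le> (1 - \<kappa>) * W2 + C2"
        using weighted_u_upper[OF \<delta>(1)] unfolding \<kappa>_def C2_def W2_def v_def p_def by simp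
      finally have "(\<Sum>k\<in>UNIV. e2 k) \<le> p * (G3 * (1 + B2)) + G2 * ((1 - \<delta>) * W2 + \<delta> * ((1 - \<kappa>) * W2 + C2))"
        using Gpos \<delta> by (simp add: mult_left_mono)
      also have "\<dots> = G2 * (1 - \<delta> * \<kappa>) * W2 + (p * (G3 * (1 + B2)) + G2 * (\<delta> * C2))" by (simp add: algebra_simps)
      also have "\<dots> \<le> \<gamma> * W2 + (p * (G3 * (1 + B2)) + G2 * (\<delta> * C2))"
        using W0 by (intro add_right_mono mult_right_mono) (auto simp: \<gamma>_def)
      finally have s2: "(\<Sum>k\<in>UNIV. e2 k) \<le> \<gamma> * W2 + (p * (G3 * (1 + B2)) + G2 * (\<delta> * C2))" .
      have "lyap \<delta> s = W1 + W2" by (simp add: lyap_eq W1_def W2_def lam_def)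
      then show "(\<Sum>k\<in>UNIV. e1 k) + (\<Sum>k\<in>UNIV. e2 k) \<le> \<gamma> * lyap \<delta> s + C"
        using s1 s2 by (simp add: C_def algebra_simps)
    qed
    finally show "(\<integral>\<^sup>+s'. ennreal (alg1_density y X a' b' a b c (fst (snd (snd s))) s') * ennreal (lyap \<delta> s') \<partial>lborel)
        \<le> ennreal (\<gamma> * lyap \<delta> s + C)" by (simp only: lam_def)
  qed
qed

section \<open>Minorization\<close>

lemma ig_density_one_ge:
  assumes "0 < q0" "q0 \<le> q" "q \<le> q1" "1 < x" "x < 2"
  shows "q0 / 4 * exp (- q1) \<le> ig_density 1 q x"
proof -
  have "q / x \<le> q" using assms by (simp add: divide_le_eq)
  then have "exp (- q1) \<le> exp (- q / x)" using assms by simp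
  moreover have "q0 / 4 \<le> q * (1 / x\<^sup>2)"
  proof -
    have "x\<^sup>2 \<le> 2\<^sup>2" using assms by (intro power_mono) auto
    then have "q0 * (1 / 4) \<le> q * (1 / x\<^sup>2)" using assms by (intro mult_mono divide_left_mono) auto
    then show ?thesis by simp
  qed
  moreover have "ig_density 1 q x = q * (1 / x\<^sup>2) * exp (- q / x)"
    using assms by (simp add: ig_density_def powr_minus_divide)
  ultimately show ?thesis using assms by (simp only:) (intro mult_mono, auto)
qed

text \<open>A comparison of Gaussian integrals instead of eigenvalues: the larger form has the
  smaller integral, hence the larger determinant.\<close>

lemma det_ge_power:
  fixes A :: "real^'n^'n"
  assumes A: "pos_def A" and m: "m > 0" and le: "\<And>x. m * (x \<bullet> x) \<le> x \<bullet> (A *v x)"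
  shows "m ^ CARD('n) \<le> det A"
proof -
  define I where "I = m *\<^sub>R (mat 1 :: real^'n^'n)"
  have Iv: "I *v x = m *\<^sub>R x" for x by (simp add: I_def scaleR_matrix_vector_assoc[symmetric])
  have I: "pos_def I"
    unfolding pos_def_def
  proof (intro conjI allI impI)
    show "I $ i $ j = I $ j $ i" for i j by (auto simp: I_def mat_def)
    show "x \<noteq> 0 \<Longrightarrow> x \<bullet> (I *v x) > 0" for x using m by (simp add: Iv)
  qed
  have dI: "det I = m ^ CARD('n)" by (simp add: I_def det_scaleR)
  note gA = gaussian_integral[OF A] and gI = gaussian_integral[OF I]
  have "(\<integral>\<^sup>+x. ennreal (exp (- (x \<bullet> (A *v x)) / 2)) \<partial>lborel) \<le> (\<integral>\<^sup>+x. ennreal (exp (- (x \<bullet> (I *v x)) / 2)) \<partial>lborel)"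
    using le by (intro nn_integral_mono ennreal_leI) (simp add: Iv)
  then have "sqrt ((2 * pi) ^ CARD('n) / det A) \<le> sqrt ((2 * pi) ^ CARD('n) / det I)"
    unfolding gA(2) gI(2) using gI(1) by (subst (asm) ennreal_le_iff) auto
  then have "(2 * pi) ^ CARD('n) / det A \<le> (2 * pi) ^ CARD('n) / det I" by simp
  then show ?thesis using gA(1) gI(1) dI by (simp add: divide_le_cancel field_simps)
qed

text \<open>The particular numbers are arbitrary. What counts is that the box is open and nonempty,
  hence of positive measure, bounded, and that its scale coordinates stay away from 0.\<close>

definition small_box :: "('p::finite) state set" where
  "small_box = box 0 (vec 1) \<times> {1<..<2} \<times> box (vec 1) (vec 2) \<times> {1<..<2} \<times> box (vec 1) (vec 2)"

lemma small_boxD: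
  assumes "(\<beta>, s2, l, t, nu) \<in> small_box"
  shows "0 < \<beta> $ k" "\<beta> $ k < 1" "1 < s2" "s2 < 2" "1 < l $ k" "l $ k < 2" "1 < t" "t < 2" "1 < nu $ k" "nu $ k < 2"
  using assms by (auto simp: small_box_def mem_box_cart)

lemma open_small_box: "open small_box"
  unfolding small_box_def by (intro open_Times open_box open_greaterThanLessThan)

lemma small_box_not_null: "emeasure lborel (small_box :: ('p::finite) state set) > 0"
proof -
  have "(vec (1/2) :: real^'p, 3/2 :: real, vec (3/2) :: real^'p, 3/2 :: real, vec (3/2) :: real^'p) \<in> small_box"
    by (simp add: small_box_def mem_box_cart)
  then have "(small_box :: 'p state set) \<noteq> {}" by auto
  then have "\<not> negligible (small_box :: 'p state set)" using open_small_box open_not_negligible by blast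
  then have "emeasure lborel (small_box :: 'p state set) \<noteq> 0"
    using open_small_box
    by (metis (no_types, lifting) borel_open negligible_iff_null_sets null_sets_completionI null_setsI sets_lborel)
  then show ?thesis by (simp add: zero_less_iff_neq_zero)
qed

text \<open>The density is a product of five conditional densities, each bounded below on the box by
  a constant that depends on \<open>lam\<close> only through \<open>L\<close>. The exponents are
  bounded directly; the normalisers need a lower bound on \<open>det A\<close>, from the Gram
  matrix, and an upper bound on \<open>Z\<close>.\<close>

lemma density_minorant:
  fixes y :: "real^'n" and X :: "real^'p^'n" and a' b' a b c L :: real
  assumes XX: "invertible (transpose X ** X)" and a': "a' > 0" and b': "b' > 0"
    and a: "a > 0" and b: "b > 0" and c: "c > 0" and L: "L \<ge> 1"
  obtains \<epsilon> where "\<epsilon> > 0"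
    "\<And>lam s'. (\<forall>k. 1 / L \<le> lam $ k \<and> lam $ k \<le> L) \<Longrightarrow> s' \<in> small_box \<Longrightarrow> \<epsilon> \<le> alg1_density y X a' b' a b c lam s'"
proof -
  define sh where "sh = real CARD('n) / 2 + a'"
  have sh: "sh > 0" using a' by (simp add: sh_def add_nonneg_pos)
  define sc where "sc = (y \<bullet> y) / 2 + b'"
  obtain m where m: "m > 0" "\<And>x. m * (x \<bullet> x) \<le> (X *v x) \<bullet> (X *v x)"
    using gram_lower_bound[OF XX] by blast
  obtain N where N: "\<And>x. norm (X *v x) \<le> norm x * N"
    using bounded_linear.bounded[OF matrix_vector_mul_bounded_linear[of X]] by blast
  define p where "p = real CARD('p)"
  \<comment> \<open>Bounds the quadratic form at \<open>\<beta> - \<mu>\<close> by twice its value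
    at \<beta> plus twice its value at \<mu>: the former is at most
    \<open>p * N\<^sup>2 + p * L\<close> on the box, the latter at most
    \<open>y \<bullet> y\<close>.\<close>
  define q where "q = 2 * (p * N\<^sup>2 + p * L) + 2 * (y \<bullet> y)"
  define e1 where "e1 = b' powr sh * 2 powr (- sh - 1) * exp (- sc) / Gamma sh"
  define e2 where "e2 = exp (- q) / sqrt ((2 * pi) ^ CARD('p) * 2 ^ CARD('p) / m ^ CARD('p))"
  define C where "C = (\<integral>t. pi_tau a b c t \<partial>lborel)"
  \<comment> \<open>Numerator and denominator bound the unnormalised density from below and
    \<open>Z\<close> from above. With \<open>C + 1\<close> instead of \<open>C\<close>, positivity
    of the denominator follows from \<open>C \<ge> 0\<close>.\<close>
  define e3 where "e3 = (1/2 * (c + 2) powr (- (a + b)) / C_abc a b c * (1 / (L + 2)) ^ CARD('p)) / ((C + 1) * sqrt L ^ CARD('p))"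
  define e4 where "e4 = (1 / 4 * exp (- (1 + 2 * L))) ^ CARD('p)"
  \<comment> \<open>On the box the rate of each new local scale lies between 1/2 and 5/2: the part
    \<open>t / nu\<close> lies between 1/2 and 2, the Gaussian part between 0 and 1/2.\<close>
  define e5 where "e5 = ((1/2) / 4 * exp (- (5/2 :: real))) ^ CARD('p)"
  have Cabc: "C_abc a b c > 0" by (rule C_abc_pos[OF a b c])
  have C0: "C \<ge> 0" unfolding C_def by (intro integral_nonneg_AE) (simp add: pi_tau_nonneg[OF a b c])
  have pos: "e1 > 0" "e2 > 0" "e3 > 0" "e4 > 0" "e5 > 0"
  proof -
    show "e1 > 0" using b' Gamma_real_pos[OF sh] by (simp add: e1_def)
    show "e2 > 0" using m(1) by (simp add: e2_def)
    show "e3 > 0" unfolding e3_def using c Cabc L C0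
      by (intro divide_pos_pos mult_pos_pos zero_less_power) auto
    show "e4 > 0" "e5 > 0" by (simp_all add: e4_def e5_def)
  qed
  show thesis
  proof (rule that[of "e1 * e2 * (e3 * e4) * e5"])
    show "e1 * e2 * (e3 * e4) * e5 > 0" using pos by simp
    fix lam :: "real^'p" and s' :: "'p state"
    assume lamL: "\<forall>k. 1 / L \<le> lam $ k \<and> lam $ k \<le> L" and s': "s' \<in> small_box"
    have lam_pos: "lam $ k > 0" for k using lamL L by (smt (verit) divide_pos_pos)
    interpret horseshoe_step a b c lam y X a' b'
      using lam_pos XX a' b' a b c by unfold_locales
    obtain \<beta> s2 l t nu where s'_eq: "s' = (\<beta>, s2, l, t, nu)" by (cases s') auto
    note B = small_boxD[OF s'[unfolded s'_eq]]
    have inv_lam: "1 / lam $ k \<le> L" for k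
      using lamL[THEN spec, of k] L lam_pos[of k] by (simp add: field_simps)
    have quadA: "m * (x \<bullet> x) \<le> x \<bullet> (A *v x)" for x
    proof -
      have "0 \<le> (\<Sum>k\<in>UNIV. (x $ k)\<^sup>2 / lam $ k)" using lam_pos by (intro sum_nonneg) (auto simp: less_imp_le)
      then show ?thesis using m(2)[of x] unfolding A_def Amat_quad by linarith
    qed
    have 1: "e1 \<le> ig_density ig_shape ig_scale s2"
    proof -
      have "b' powr sh \<le> ig_scale powr sh" using ig_scale_bounds b' sh by (intro powr_mono2) auto
      moreover have "2 powr (- sh - 1) \<le> s2 powr (- sh - 1)" using B(3,4) sh by (intro powr_mono2') auto
      moreover have "exp (- sc) \<le> exp (- ig_scale / s2)"
      proof -
        have "ig_scale / s2 \<le> ig_scale" using B(3) ig_scale_pos by (simp add: divide_le_eq)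
        then show ?thesis using ig_scale_bounds(2) by (simp add: sc_def)
      qed
      ultimately have "b' powr sh * 2 powr (- sh - 1) * exp (- sc) \<le> ig_scale powr sh * s2 powr (- sh - 1) * exp (- ig_scale / s2)"
        by (intro mult_mono) auto
      then show ?thesis using B(3) Gamma_real_pos[OF sh]
        unfolding e1_def ig_density_def ig_shape_def sh_def[symmetric] by (simp add: divide_right_mono)
    qed
    have 2: "e2 \<le> gauss_prec \<mu> ((1 / s2) *\<^sub>R A) \<beta>"
    proof -
      have A0: "0 \<le> x \<bullet> (A *v x)" for x using pos_def_A by (cases "x = 0") (auto simp: pos_def_def intro: less_imp_le)
      have sym: "A $ i $ j = A $ j $ i" for i j unfolding A_def by (rule Amat_sym)
      have \<beta>2: "(\<beta> $ k)\<^sup>2 \<le> 1" for k using B(1,2)[of k] by (simp add: power_le_one)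
      have n\<beta>: "\<beta> \<bullet> \<beta> \<le> p"
        unfolding inner_vec_def p_def using sum_mono[of UNIV "\<lambda>k. \<beta> $ k \<bullet> \<beta> $ k" "\<lambda>_. 1"] \<beta>2 by (simp add: power2_eq_square)
      have "(X *v \<beta>) \<bullet> (X *v \<beta>) \<le> p * N\<^sup>2"
      proof -
        have "(norm (X *v \<beta>))\<^sup>2 \<le> (norm \<beta> * N)\<^sup>2" using N[of \<beta>] by (intro power_mono) auto
        also have "\<dots> = (\<beta> \<bullet> \<beta>) * N\<^sup>2" by (simp add: power_mult_distrib power2_norm_eq_inner)
        also have "\<dots> \<le> p * N\<^sup>2" using n\<beta> by (intro mult_right_mono) auto
        finally show ?thesis by (simp add: power2_norm_eq_inner)
      qed
      moreover have "(\<Sum>k\<in>UNIV. (\<beta> $ k)\<^sup>2 / lam $ k) \<le> p * L"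
      proof -
        have "(\<beta> $ k)\<^sup>2 * (1 / lam $ k) \<le> 1 * L" for k
          using \<beta>2[of k] inv_lam[of k] lam_pos[of k] L by (intro mult_mono) auto
        then have "(\<Sum>k\<in>UNIV. (\<beta> $ k)\<^sup>2 / lam $ k) \<le> (\<Sum>k\<in>(UNIV :: 'p set). L)" by (intro sum_mono) simp
        then show ?thesis by (simp add: p_def)
      qed
      ultimately have bA: "\<beta> \<bullet> (A *v \<beta>) \<le> p * N\<^sup>2 + p * L" unfolding A_def Amat_quad by linarith
      have muA: "\<mu> \<bullet> (A *v \<mu>) \<le> y \<bullet> y"
      proof -
        have "\<mu> \<bullet> (A *v \<mu>) = (X *v \<mu>) \<bullet> y" unfolding A_mu by (metis mu_inner inner_commute)
        moreover have "0 \<le> (y - X *v \<mu>) \<bullet> (y - X *v \<mu>)" by simp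
        ultimately show ?thesis using X_mu_le by (simp add: inner_diff_left inner_diff_right inner_commute)
      qed
      \<comment> \<open>The parallelogram identity for the form, with its nonnegative value at
        \<open>\<beta> + \<mu>\<close> discarded.\<close>
      have "(\<beta> - \<mu>) \<bullet> (A *v (\<beta> - \<mu>)) \<le> 2 * (\<beta> \<bullet> (A *v \<beta>)) + 2 * (\<mu> \<bullet> (A *v \<mu>))"
        using A0[of "\<beta> + \<mu>"] quad_form_diff[of A \<beta> \<mu>, OF sym] quad_form_diff[of A \<beta> "- \<mu>", OF sym]
        by (simp add: linear_neg[OF matrix_vector_mul_linear])
      then have le_q: "(\<beta> - \<mu>) \<bullet> (A *v (\<beta> - \<mu>)) \<le> q" using bA muA by (simp add: q_def)
      have "exp (- q) \<le> exp (- ((\<beta> - \<mu>) \<bullet> (A *v (\<beta> - \<mu>))) / (2 * s2))"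
      proof -
        have "(\<beta> - \<mu>) \<bullet> (A *v (\<beta> - \<mu>)) / (2 * s2) \<le> (\<beta> - \<mu>) \<bullet> (A *v (\<beta> - \<mu>)) / 1"
          using B(3) A0 by (intro divide_left_mono) auto
        then show ?thesis using le_q by simp
      qed
      moreover have "sqrt ((2 * pi) ^ CARD('p) * s2 ^ CARD('p) / det A) \<le> sqrt ((2 * pi) ^ CARD('p) * 2 ^ CARD('p) / m ^ CARD('p))"
        using det_ge_power[OF pos_def_A m(1) quadA] B(3,4) m(1)
        by (intro real_sqrt_le_mono frac_le mult_left_mono power_mono) auto
      ultimately show ?thesis
        unfolding gauss_prec_A[OF less_trans[OF zero_less_one B(3)]] e2_def
        using B(3) gaussian_integral(1)[OF pos_def_A] by (intro frac_le) auto
    qed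
    have 3: "e3 \<le> tau_density a b c lam t"
    proof -
      have "1/2 * (c + 2) powr (- (a + b)) \<le> t powr (a - 1) * (c + t) powr (- (a + b))"
      proof (intro mult_mono)
        have "1/2 \<le> t powr a / t"
          using B(7,8) a ge_one_powr_ge_zero[of t a] by (simp add: pos_le_divide_eq)
        then show "1/2 \<le> t powr (a - 1)" using B(7) by (simp add: powr_diff)
        show "(c + 2) powr (- (a + b)) \<le> (c + t) powr (- (a + b))"
          using B(7,8) a b c by (intro powr_mono2') auto
      qed auto
      then have pt: "1/2 * (c + 2) powr (- (a + b)) / C_abc a b c \<le> pi_tau a b c t"
      proof -
        have "pi_tau a b c t = t powr (a - 1) * (c + t) powr (- (a + b)) / C_abc a b c"
          using B(7) by (simp add: pi_tau_def)
        then show ?thesis using divide_right_mono[OF \<open>1/2 * _ \<le> _\<close> less_imp_le[OF Cabc]] by (simp only:)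
      qed
      have pr: "(1 / (L + 2)) ^ CARD('p) \<le> (\<Prod>k\<in>UNIV. t powr (1/2) / (lam $ k + t))"
      proof -
        have "1 / (L + 2) \<le> t powr (1/2) / (lam $ k + t)" for k
          using B(7,8) lamL[THEN spec, of k] lam_pos[of k] L by (intro frac_le) (auto intro: ge_one_powr_ge_zero)
        then have "(\<Prod>k\<in>(UNIV :: 'p set). 1 / (L + 2)) \<le> (\<Prod>k\<in>UNIV. t powr (1/2) / (lam $ k + t))"
          using L by (intro prod_mono) auto
        then show ?thesis by simp
      qed
      have ge: "1/2 * (c + 2) powr (- (a + b)) / C_abc a b c * (1 / (L + 2)) ^ CARD('p) \<le> tau_unnorm a b c lam t"
        unfolding tau_unnorm_def using B(7) pt pr pi_tau_nonneg[OF a b c, of t] L by (simp only: if_True less_trans[OF zero_less_one]) (intro mult_mono, auto)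
      have Z: "Z \<le> (C + 1) * sqrt L ^ CARD('p)"
      proof -
        have "1 / (2 * sqrt (lam $ k)) \<le> sqrt L" for k
        proof -
          have "1 / (2 * sqrt (lam $ k)) \<le> 1 / sqrt (lam $ k)" using lam_pos[of k] by (intro divide_left_mono) auto
          also have "\<dots> = sqrt (1 / lam $ k)" by (simp add: real_sqrt_divide)
          also have "\<dots> \<le> sqrt L" using inv_lam[of k] by (rule real_sqrt_le_mono)
          finally show ?thesis .
        qed
        then have "(\<Prod>k\<in>(UNIV :: 'p set). 1 / (2 * sqrt (lam $ k))) \<le> (\<Prod>k\<in>(UNIV :: 'p set). sqrt L)"
          using lam_pos by (intro prod_mono) (auto simp: less_imp_le)
        then have "C * (\<Prod>k\<in>(UNIV :: 'p set). 1 / (2 * sqrt (lam $ k))) \<le> (C + 1) * sqrt L ^ CARD('p)"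
          using C0 L lam_pos by (intro mult_mono) (auto intro!: prod_nonneg simp: less_imp_le)
        then show ?thesis using Z_le by (simp add: C_def)
      qed
      show ?thesis unfolding tau_density_eq e3_def using ge Z Z_pos f_nonneg
        by (intro frac_le) auto
    qed
    have 4: "e4 \<le> (\<Prod>k\<in>UNIV. ig_density 1 (1 + t / lam $ k) (nu $ k))"
    proof -
      have "1 / 4 * exp (- (1 + 2 * L)) \<le> ig_density 1 (1 + t / lam $ k) (nu $ k)" for k
      proof (rule ig_density_one_ge)
        have "t * (1 / lam $ k) \<le> 2 * L" using inv_lam[of k] B(7,8) lam_pos[of k] by (intro mult_mono) auto
        then show "1 + t / lam $ k \<le> 1 + 2 * L" by simp
        show "1 \<le> 1 + t / lam $ k" using B(7) lam_pos[of k] by simp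
      qed (use B in auto)
      then have "(\<Prod>k\<in>(UNIV :: 'p set). 1 / 4 * exp (- (1 + 2 * L))) \<le> (\<Prod>k\<in>UNIV. ig_density 1 (1 + t / lam $ k) (nu $ k))"
        by (intro prod_mono) auto
      then show ?thesis by (simp add: e4_def)
    qed
    have 5: "e5 \<le> (\<Prod>k\<in>UNIV. ig_density 1 ((\<beta> $ k)\<^sup>2 / (2 * s2) + t / nu $ k) (l $ k))"
    proof -
      have "(1/2) / 4 * exp (- (5/2 :: real)) \<le> ig_density 1 ((\<beta> $ k)\<^sup>2 / (2 * s2) + t / nu $ k) (l $ k)" for k
      proof (rule ig_density_one_ge)
        have \<beta>2: "(\<beta> $ k)\<^sup>2 \<le> 1" using B(1,2)[of k] by (simp add: power_le_one)
        have "(\<beta> $ k)\<^sup>2 / (2 * s2) \<le> 1 / 2" using \<beta>2 B(3) by (intro frac_le) auto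
        moreover have "t / nu $ k \<le> 2 / 1" using B(7,8) B(9)[of k] by (intro frac_le) auto
        ultimately show "(\<beta> $ k)\<^sup>2 / (2 * s2) + t / nu $ k \<le> 5/2" by linarith
        have "1 / 2 \<le> t / nu $ k" using B(7) B(9,10)[of k] by (intro frac_le) auto
        moreover have "0 \<le> (\<beta> $ k)\<^sup>2 / (2 * s2)" using B(3) by simp
        ultimately show "1 / 2 \<le> (\<beta> $ k)\<^sup>2 / (2 * s2) + t / nu $ k" by linarith
      qed (use B in auto)
      then have "(\<Prod>k\<in>(UNIV :: 'p set). (1/2) / 4 * exp (- (5/2 :: real))) \<le> (\<Prod>k\<in>UNIV. ig_density 1 ((\<beta> $ k)\<^sup>2 / (2 * s2) + t / nu $ k) (l $ k))"
        by (intro prod_mono) auto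
      then show ?thesis by (simp add: e5_def)
    qed
    have "e1 * e2 \<le> dens1 (s2, \<beta>)" unfolding dens1_eq
      using 1 2 pos ig_density_nonneg[OF ig_shape_pos] by (intro mult_mono) auto
    moreover have "e3 * e4 \<le> dens2 (t, nu)" unfolding dens2_def prod.case
      using 3 4 pos tau_density_nonneg by (intro mult_mono) auto
    moreover have "e5 \<le> dens3 (s2, \<beta>) (t, nu) l" unfolding dens3_def prod.case by (rule 5)
    ultimately show "e1 * e2 * (e3 * e4) * e5 \<le> alg1_density y X a' b' a b c lam s'"
      unfolding s'_eq step_density_eq using pos dens_nonneg by (intro mult_mono) auto
  qed
qed

section \<open>Geometric ergodicity\<close>

lemma measurable_det[measurable (raw)]:
  fixes A :: "'a \<Rightarrow> real^'n^'n"
  assumes [measurable]: "\<And>i j. (\<lambda>x. A x $ i $ j) \<in> borel_measurable M"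
  shows "(\<lambda>x. det (A x)) \<in> borel_measurable M"
  unfolding det_def by measurable

definition cramer_mean :: "real^'n \<Rightarrow> real^'p^'n \<Rightarrow> real^'p \<Rightarrow> 'p \<Rightarrow> real" where
  "cramer_mean y X lam k =
     det (\<chi> i j. if j = k then (transpose X *v y) $ i else Amat X lam $ i $ j) / det (Amat X lam)"

text \<open>The transition density with the posterior mean written by Cramer's rule, which makes its
  joint measurability evident; it is meaningful only where all coordinates of \<open>lam\<close> are positive.\<close>

definition joint_density ::
  "real^'n \<Rightarrow> real^'p^'n \<Rightarrow> real \<Rightarrow> real \<Rightarrow> real \<Rightarrow> real \<Rightarrow> real \<Rightarrow> real^'p \<Rightarrow> ('p::finite) state \<Rightarrow> real" where
  "joint_density y X a' b' a b c lam s' =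
     (let \<beta> = fst s'; s2 = fst (snd s'); l = fst (snd (snd s')); t = fst (snd (snd (snd s'))); nu = snd (snd (snd (snd s')));
        mu = cramer_mean y X lam in
      ig_density (real CARD('n) / 2 + a') ((y \<bullet> y - (\<Sum>k\<in>UNIV. (transpose X *v y) $ k * mu k)) / 2 + b') s2
      * (exp (- (\<Sum>i\<in>UNIV. \<Sum>j\<in>UNIV. Amat X lam $ i $ j * (\<beta> $ i - mu i) * (\<beta> $ j - mu j)) / (2 * s2))
          / sqrt ((2 * pi) ^ CARD('p) * s2 ^ CARD('p) / det (Amat X lam)))
      * (tau_unnorm a b c lam t / (\<integral>r. tau_unnorm a b c lam r \<partial>lborel))
      * (\<Prod>k\<in>UNIV. ig_density 1 (1 + t / lam $ k) (nu $ k))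
      * (\<Prod>k\<in>UNIV. ig_density 1 ((\<beta> $ k)\<^sup>2 / (2 * s2) + t / nu $ k) (l $ k)))"

lemma (in horseshoe_step) joint_density_eq: "step_density s' = joint_density y X a' b' a b c lam s'"
proof -
  have mu: "\<mu> $ k = cramer_mean y X lam k" for k
  proof -
    have "\<mu> = (\<chi> k. det (\<chi> i j. if j = k then (transpose X *v y) $ i else A $ i $ j) / det A)"
      using cramer[of A \<mu> "transpose X *v y"] A_mu gaussian_integral(1)[OF pos_def_A] by simp
    from arg_cong[OF this, of "\<lambda>v. v $ k"] show ?thesis
      by (simp only: cramer_mean_def A_def vec_lambda_beta)
  qed
  have sc: "ig_scale = (y \<bullet> y - (\<Sum>k\<in>UNIV. (transpose X *v y) $ k * cramer_mean y X lam k)) / 2 + b'"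
    by (simp only: ig_scale_def inner_vec_def[of "transpose X *v y" \<mu>] mu inner_real_def)
  obtain \<beta> s2 l t nu where s': "s' = (\<beta>, s2, l, t, nu)" by (cases s') auto
  have quad: "(\<beta> - \<mu>) \<bullet> (A *v (\<beta> - \<mu>)) = (\<Sum>i\<in>UNIV. \<Sum>j\<in>UNIV. Amat X lam $ i $ j * (\<beta> $ i - cramer_mean y X lam i) * (\<beta> $ j - cramer_mean y X lam j))"
    unfolding quad_form_expand by (simp only: A_def vector_minus_component mu)
  show ?thesis
    unfolding s' step_density_eq joint_density_def Let_def fst_conv snd_conv dens1_def dens2_def dens3_def prod.case
      quad sc ig_shape_def tau_density_def
    by (simp only: A_def mult.assoc)
qed

lemma Amat_component: "Amat X lam $ i $ j = (transpose X ** X) $ i $ j + (if i = j then 1 / lam $ i else 0)"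
  by (simp add: Amat_def Psi_def)

lemma measurable_Amat[measurable (raw)]:
  assumes [measurable]: "g \<in> M \<rightarrow>\<^sub>M borel"
  shows "(\<lambda>x. Amat X (g x) $ i $ j) \<in> borel_measurable M"
  unfolding Amat_component by measurable

lemma measurable_cramer_mean[measurable (raw)]:
  assumes [measurable]: "g \<in> M \<rightarrow>\<^sub>M borel"
  shows "(\<lambda>x. cramer_mean y X (g x) k) \<in> borel_measurable M"
  unfolding cramer_mean_def
proof (intro borel_measurable_divide measurable_det)
  fix i j
  show "(\<lambda>x. (\<chi> i j. if j = k then (transpose X *v y) $ i else Amat X (g x) $ i $ j) $ i $ j) \<in> borel_measurable M"
    by (cases "j = k") simp_all
  show "(\<lambda>x. Amat X (g x) $ i $ j) \<in> borel_measurable M" by measurable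
qed

lemma measurable_tau_unnorm[measurable (raw)]:
  assumes [measurable]: "g \<in> M \<rightarrow>\<^sub>M borel" "h \<in> borel_measurable M"
  shows "(\<lambda>x. tau_unnorm a b c (g x) (h x)) \<in> borel_measurable M"
  unfolding tau_unnorm_def by measurable

lemma measurable_joint_density:
  "(\<lambda>x :: 'p state \<times> ('p::finite) state. joint_density y X a' b' a b c (fst (snd (snd (fst x)))) (snd x)) \<in> borel_measurable (borel \<Otimes>\<^sub>M borel)"
  unfolding joint_density_def Let_def borel_prod[symmetric] by measurable

lemma alg1_space_iff: "s \<in> alg1_space \<longleftrightarrow>
   fst (snd s) > 0 \<and> (\<forall>k. fst (snd (snd s)) $ k > 0) \<and> fst (snd (snd (snd s))) > 0 \<and> (\<forall>k. snd (snd (snd (snd s))) $ k > 0)"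
  by (cases s) (simp add: alg1_space_def)

lemma sets_alg1_space[measurable]: "(alg1_space :: ('p::finite) state set) \<in> sets borel"
proof -
  have "Measurable.pred (borel \<Otimes>\<^sub>M borel \<Otimes>\<^sub>M borel \<Otimes>\<^sub>M borel \<Otimes>\<^sub>M borel) (\<lambda>s :: 'p state. fst (snd s) > 0 \<and> (\<forall>k. fst (snd (snd s)) $ k > 0) \<and> fst (snd (snd (snd s))) > 0 \<and> (\<forall>k. snd (snd (snd (snd s))) $ k > 0))"
    by measurable
  moreover have "alg1_space = {s :: 'p state. fst (snd s) > 0 \<and> (\<forall>k. fst (snd (snd s)) $ k > 0) \<and> fst (snd (snd (snd s))) > 0 \<and> (\<forall>k. snd (snd (snd (snd s))) $ k > 0)}"
    by (auto simp: alg1_space_iff)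
  ultimately show ?thesis by (simp add: pred_def borel_prod space_pair_measure)
qed

section \<open>The transition kernel and Harris' conditions\<close>

context
  fixes y :: "real^'n" and X :: "real^'p^'n" and a' b' a b c :: real
  assumes XX: "invertible (transpose X ** X)" and a': "a' > 0" and b': "b' > 0"
    and a: "a > 0" and b: "b > 0" and c: "c > 0"
begin

abbreviation (input) "kern \<equiv> alg1_kernel y X a' b' a b c"
abbreviation (input) "dens \<equiv> \<lambda>s :: 'p state. alg1_density y X a' b' a b c (fst (snd (snd s)))"

lemma horseshoe_stepI: "s \<in> alg1_space \<Longrightarrow> horseshoe_step a b c (fst (snd (snd s))) X a' b'"
  using XX a' b' a b c by unfold_locales (auto simp: alg1_space_iff)

lemma dens_eq: "s \<in> alg1_space \<Longrightarrow> dens s = joint_density y X a' b' a b c (fst (snd (snd s)))"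
  using horseshoe_step.joint_density_eq[OF horseshoe_stepI] by blast

lemma measurable_dens: "s \<in> alg1_space \<Longrightarrow> dens s \<in> borel_measurable borel"
  unfolding dens_eq using measurable_compose[OF measurable_Pair1' measurable_joint_density[of y X a' b' a b c], of s]
  by simp

lemma nn_integral_kern:
  assumes "s \<in> alg1_space" "h \<in> borel_measurable borel"
  shows "(\<integral>\<^sup>+s'. h s' \<partial>kern s) = (\<integral>\<^sup>+s'. ennreal (dens s s') * h s' \<partial>lborel)"
  unfolding alg1_kernel_def using assms measurable_dens[OF assms(1)]
  by (simp add: nn_integral_density)

lemma sets_kern: "sets (kern s) = sets borel"
  by (simp add: alg1_kernel_def)

lemma kern_prob: "prob_space (kern s)"
proof (cases "s \<in> alg1_space")
  case True
  have "emeasure (kern s) (space (kern s)) = (\<integral>\<^sup>+s'. 1 \<partial>kern s)" by simp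
  also have "\<dots> = (\<integral>\<^sup>+s'. ennreal (dens s s') * 1 \<partial>lborel)" by (rule nn_integral_kern[OF True]) simp
  also have "\<dots> = 1" using horseshoe_step.step_prob[OF horseshoe_stepI[OF True], of y] by simp
  finally show ?thesis by (rule prob_spaceI)
qed (simp add: alg1_kernel_def prob_space_return)

lemma measurable_kern: "kern \<in> borel \<rightarrow>\<^sub>M subprob_algebra borel"
proof (rule measurable_subprob_algebra)
  fix B :: "'p state set" assume B[measurable]: "B \<in> sets borel"
  have jd[measurable]: "(\<lambda>(s :: 'p state, s' :: 'p state). joint_density y X a' b' a b c (fst (snd (snd s))) s') \<in> borel_measurable (borel \<Otimes>\<^sub>M borel)"
    using measurable_joint_density[of y X a' b' a b c] by (simp add: split_beta')
  have "emeasure (kern s) B = (if s \<in> alg1_space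
      then (\<integral>\<^sup>+s'. ennreal (joint_density y X a' b' a b c (fst (snd (snd s))) s') * indicator B s' \<partial>lborel) else indicator B s)" for s
  proof (cases "s \<in> alg1_space")
    case True
    have "emeasure (kern s) B = (\<integral>\<^sup>+s'. indicator B s' \<partial>kern s)" using B by (simp add: sets_kern)
    also have "\<dots> = (\<integral>\<^sup>+s'. ennreal (dens s s') * indicator B s' \<partial>lborel)" by (rule nn_integral_kern[OF True]) simp
    finally show ?thesis using True by (simp add: dens_eq)
  qed (simp add: alg1_kernel_def emeasure_return B)
  then show "(\<lambda>s. emeasure (kern s) B) \<in> borel_measurable borel"
    by (simp only:) measurable
qed (auto simp: sets_kern intro: prob_space_imp_subprob_space kern_prob)

lemma dens_zero: "s' \<notin> alg1_space \<Longrightarrow> dens s s' = 0"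
proof -
  assume s': "s' \<notin> alg1_space"
  obtain \<beta> s2 l t nu where eq: "s' = (\<beta>, s2, l, t, nu)" by (cases s') auto
  have pr: "(\<Prod>k\<in>UNIV. ig_density 1 (r k) (v $ k)) = 0" if "\<not> v $ j > 0" for r j and v :: "real^'p"
    using that by (intro prod_zero bexI[of _ j]) (auto simp: ig_density_def)
  from s' consider "\<not> s2 > 0" | j where "\<not> l $ j > 0" | "\<not> t > 0" | j where "\<not> nu $ j > 0"
    unfolding eq alg1_space_def by auto
  then show "dens s s' = 0"
    by cases (simp_all add: eq alg1_density_def Let_def pr, simp_all add: ig_density_def tau_density_def tau_unnorm_def)
qed

lemma kern_alg1_space:
  assumes "s \<in> alg1_space"
  shows "emeasure (kern s) alg1_space = 1"
proof -
  have "emeasure (kern s) alg1_space = (\<integral>\<^sup>+s'. indicator alg1_space s' \<partial>kern s)" by (simp add: sets_kern)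
  also have "\<dots> = (\<integral>\<^sup>+s'. ennreal (dens s s') * indicator alg1_space s' \<partial>lborel)" by (rule nn_integral_kern[OF assms]) simp
  also have "\<dots> = (\<integral>\<^sup>+s'. ennreal (dens s s') \<partial>lborel)"
    by (intro nn_integral_cong) (auto simp: indicator_def dens_zero)
  also have "\<dots> = 1" using horseshoe_step.step_prob[OF horseshoe_stepI[OF assms], of y] by simp
  finally show ?thesis .
qed

text \<open>This is why both signs of the exponent occur in \<open>lyap\<close>: the negative powers
  keep every coordinate away from 0 and the positive ones away from infinity. The sublevel set thus
  lies in a box of the kind on which the density is bounded below, with
  \<open>L = R powr (1 / \<delta>)\<close>.\<close>

lemma lyap_sublevel:
  assumes \<delta>: "0 < \<delta>" and s: "s \<in> alg1_space" and R: "lyap \<delta> s \<le> R" "1 \<le> R"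
  shows "1 / R powr (1 / \<delta>) \<le> fst (snd (snd s)) $ k \<and> fst (snd (snd s)) $ k \<le> R powr (1 / \<delta>)"
proof -
  define l where "l = fst (snd (snd s)) $ k"
  have l: "l > 0" using s by (simp add: l_def alg1_space_iff)
  have "l powr (- \<delta>) + l powr \<delta> \<le> lyap \<delta> s"
    unfolding lyap_def l_def by (rule member_le_sum) auto
  then have le: "l powr (- \<delta>) \<le> R" "l powr \<delta> \<le> R"
    using R powr_ge_zero[of l \<delta>] powr_ge_zero[of l "- \<delta>"] by linarith+
  have "(l powr \<delta>) powr (1 / \<delta>) \<le> R powr (1 / \<delta>)" using le \<delta> by (intro powr_mono2) auto
  moreover have "(l powr (- \<delta>)) powr (1 / \<delta>) \<le> R powr (1 / \<delta>)" using le \<delta> by (intro powr_mono2) auto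
  ultimately have "l \<le> R powr (1 / \<delta>)" "1 / l \<le> R powr (1 / \<delta>)"
    unfolding powr_powr using \<delta> l by (simp_all add: powr_minus_divide)
  moreover have "R powr (1 / \<delta>) > 0" using R by simp
  ultimately show ?thesis using l unfolding l_def[symmetric] by (simp add: field_simps)
qed

lemma kern_minorant:
  assumes \<delta>: "0 < \<delta>"
  shows "\<exists>\<nu>. sets \<nu> = sets borel \<and> 0 < emeasure \<nu> UNIV \<and>
    (\<forall>s\<in>alg1_space. lyap \<delta> s \<le> R \<longrightarrow> (\<forall>h \<in> borel_measurable borel. (\<integral>\<^sup>+z. h z \<partial>\<nu>) \<le> (\<integral>\<^sup>+z. h z \<partial>kern s)))"
proof -
  \<comment> \<open>Enlarging the level only strengthens the minorization; a level of at least 1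
    makes \<open>R' powr (1 / \<delta>)\<close> an admissible \<open>L\<close>.\<close>
  define R' where "R' = max 1 R"
  have "R' powr (1 / \<delta>) \<ge> 1" using \<delta> by (intro ge_one_powr_ge_zero) (auto simp: R'_def)
  then obtain \<epsilon> where \<epsilon>: "\<epsilon> > 0" "\<And>lam s'. (\<forall>k. 1 / R' powr (1 / \<delta>) \<le> lam $ k \<and> lam $ k \<le> R' powr (1 / \<delta>)) \<Longrightarrow> s' \<in> small_box \<Longrightarrow>
       \<epsilon> \<le> alg1_density y X a' b' a b c lam s'"
    using density_minorant[OF XX a' b' a b c] by blast
  have [measurable]: "(small_box :: 'p state set) \<in> sets borel" by (rule borel_open[OF open_small_box])
  define \<nu> where "\<nu> = density lborel (\<lambda>s' :: 'p state. ennreal \<epsilon> * indicator small_box s')"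
  have int: "(\<integral>\<^sup>+z. h z \<partial>\<nu>) = (\<integral>\<^sup>+z. ennreal \<epsilon> * indicator small_box z * h z \<partial>lborel)"
    if [measurable]: "h \<in> borel_measurable borel" for h
    unfolding \<nu>_def by (rule nn_integral_density) measurable
  show ?thesis
  proof (intro exI[of _ \<nu>] conjI ballI impI)
    show "sets \<nu> = sets borel" by (simp add: \<nu>_def)
    have "emeasure \<nu> UNIV = ennreal \<epsilon> * emeasure lborel (small_box :: 'p state set)"
      by (simp add: \<nu>_def emeasure_density nn_integral_cmult)
    then show "0 < emeasure \<nu> UNIV" using \<epsilon>(1) small_box_not_null by (simp add: ennreal_zero_less_mult_iff)
    fix s :: "'p state" and h :: "'p state \<Rightarrow> ennreal"
    assume s: "s \<in> alg1_space" "lyap \<delta> s \<le> R" and h: "h \<in> borel_measurable borel"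
    have "\<epsilon> \<le> dens s s'" if "s' \<in> small_box" for s'
      using \<epsilon>(2)[OF _ that] lyap_sublevel[OF \<delta> s(1), of R'] s(2) by (simp add: R'_def)
    then show "(\<integral>\<^sup>+z. h z \<partial>\<nu>) \<le> (\<integral>\<^sup>+z. h z \<partial>kern s)"
      unfolding int[OF h] nn_integral_kern[OF s(1) h]
      by (intro nn_integral_mono mult_right_mono) (auto simp: indicator_def intro: ennreal_leI)
  qed
qed

lemma alg1_geom_ergodic:
  assumes ap: "a / real CARD('p) > ln 2 - 1/2"
  shows "geom_ergodic alg1_space kern"
proof (rule lyap_drift[OF XX a' b' a b c ap, of y])
  fix \<delta> \<gamma> C :: real
  assume \<delta>: "0 < \<delta>" and \<gamma>: "0 \<le> \<gamma>" "\<gamma> < 1" and C: "0 \<le> C"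
    and drift: "\<And>s :: 'p state. (\<forall>k. fst (snd (snd s)) $ k > 0) \<Longrightarrow>
      (\<integral>\<^sup>+s'. ennreal (dens s s') * ennreal (lyap \<delta> s') \<partial>lborel) \<le> ennreal (\<gamma> * lyap \<delta> s + C)"
  have "harris_kernel alg1_space kern (lyap \<delta>) \<gamma> C"
  proof (rule harris_kernel.intro)
    show "kern \<in> borel \<rightarrow>\<^sub>M subprob_algebra borel" by (rule measurable_kern)
    show "alg1_space \<in> sets borel" by (rule sets_alg1_space)
    show "s \<in> alg1_space \<Longrightarrow> emeasure (kern s) alg1_space = 1" for s :: "'p state" by (rule kern_alg1_space)
    show "lyap \<delta> \<in> borel_measurable borel" by (rule measurable_lyap)
    show "0 \<le> lyap \<delta> s" for s :: "'p state" by (rule lyap_nonneg)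
    show "0 \<le> \<gamma>" "\<gamma> < 1" "0 \<le> C" by (rule \<gamma> C)+
    show "\<exists>\<nu>. sets \<nu> = sets borel \<and> 0 < emeasure \<nu> UNIV \<and>
      (\<forall>s\<in>alg1_space. lyap \<delta> s \<le> R \<longrightarrow> (\<forall>h \<in> borel_measurable borel. (\<integral>\<^sup>+z. h z \<partial>\<nu>) \<le> (\<integral>\<^sup>+z. h z \<partial>kern s)))" for R
      by (rule kern_minorant[OF \<delta>])
    fix s :: "'p state" assume s: "s \<in> alg1_space"
    have "(\<integral>\<^sup>+z. ennreal (lyap \<delta> z) \<partial>kern s) = (\<integral>\<^sup>+s'. ennreal (dens s s') * ennreal (lyap \<delta> s') \<partial>lborel)"
      by (rule nn_integral_kern[OF s]) measurable
    also have "\<dots> \<le> ennreal (\<gamma> * lyap \<delta> s + C)"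
      using s by (intro drift) (simp add: alg1_space_iff)
    finally show "(\<integral>\<^sup>+z. ennreal (lyap \<delta> z) \<partial>kern s) \<le> ennreal (\<gamma> * lyap \<delta> s + C)" .
  qed
  moreover have "(0, 1, vec 1, 1, vec 1) \<in> (alg1_space :: 'p state set)" by (simp add: alg1_space_def)
  then have "(alg1_space :: 'p state set) \<noteq> {}" by blast
  ultimately show ?thesis by (rule harris_kernel.geom_ergodic)
qed

end

theorem theorem1:
  fixes y :: "real^'n" and X :: "real^'p^'n" and a' b' a b c :: real
  assumes "invertible (transpose X ** X)"
    and "a' > 0" and "b' > 0" and "a > 0" and "b > 0" and "c > 0"
  shows "(a > real CARD('p) / 2 \<longrightarrow> geom_ergodic alg1_space (alg1_kernel y X a' b' a b c))
       \<and> ((a \<le> real CARD('p) / 2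
           \<and> (even CARD('p) \<longrightarrow> a \<notin> {real k | k. k \<ge> 1})
           \<and> (odd CARD('p) \<longrightarrow> a \<notin> {real k - 1/2 | k. k \<ge> 1})
           \<and> a / real CARD('p) > ln 2 - 1/2)
          \<longrightarrow> geom_ergodic alg1_space (alg1_kernel y X a' b' a b c))"
proof -
  \<comment> \<open>For \<open>a > p / 2\<close> the ratio exceeds 1/2, while
    \<open>ln 2 < 1\<close> puts the threshold below 1/2; part (i) therefore rests on the same drift
    estimate.\<close>
  have "a / real CARD('p) > ln 2 - 1/2" if "a > real CARD('p) / 2"
  proof -
    have "1/2 < a / real CARD('p)" using that by (simp add: field_simps)
    then show ?thesis using ln_2_less_1 by linarith
  qed
  then show ?thesis using alg1_geom_ergodic[OF assms] by blast
qed

end
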